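(* Let $u\in \mathcal{C}^0(\overline{\Omega}\setminus\{0\})$ be a weak solution to $$ \begin{cases} (-\Delta)^s u=\dfrac{g(u)}{|x|^{2s}}+f(x,u) & \text{in } \Omega,\\ u>0 & \text{in } \Omega,\\ u=0 & \text{in } \mathbb{R}^N\setminus\Omega, \end{cases} $$ and let $\Omega$ be convex with respect to the $x_1$-direction and symmetric with respect to $T_0=\{x\in\mathbb{R}^N : x_1=0\}$. For $x=(x_1,x')$ and $\lambda\in\mathbb{R}$ set $x_\lambda=(2\lambda-x_1,x')$, and assume that $$f(x,t)\leq f(x_\lambda,t)\quad\text{if } \lambda<0,\ x\in\Omega\cap\{x_1<\lambda\},\ t\in[0,\infty),$$ and $$f(x,t)=f(x_0,t)\quad\text{if } x\in\Omega\cap\{x_1<0\},\ t\in[0,\infty),$$ where $x_0=(-x_1,x')$. Assume also that either (a) or (b) holds, where: (a) $f$ is a Carathéodory function which is locally Lipschitz continuous in the second variable, namely for any $M>0$ there is $L_f(M)$ with $|f(x,t_1)-f(x,t_2)|\le L_f(M)|t_1-t_2|$ for $x\in\Omega$, $t_1,t_2\in[0,M]$; $g$ is locally Lipschitz continuous, namely for any $M>0$ there is $L_g(M)$ with $|g(t_1)-g(t_2)|\le L_g(M)|t_1-t_2|$ for $t_1,t_2\in[0,M]$; moreover $f(x,t)$ is nondecreasing with respect to $t$ for any $x\in\Omega$, and $g(t)$ is nondecreasing with respect to $t$; (b) $f$ is a Carathéodory function which is locally Lipschitz continuous in the second variable and $g$ is locally Lipschitz continuous (both in the sense written out in (a)),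 and $f$ is Hölder continuous with respect to $x$ away from the origin, namely for any $M>0$ and $r>0$, for some $\gamma\in(0,1)$, it holds that $|f(x_1,t)-f(x_2,t)|\le C(M,r)|x_1-x_2|^\gamma$ for $x_1,x_2\in\Omega\setminus B_r(0)$ and $t\in[0,M]$. Then $u$ is symmetric with respect to the $x_1$-variable (that is, $u(x_1,x')=u(-x_1,x')$) and strictly increasing with respect to the $x_1$-direction for $x_1<0$. Moreover, if $\Omega$ is a ball, then $u$ is radial and strictly radially decreasing.
   Context: Throughout, $0<s<1$, $N>2s$, $\Omega\subset\mathbb{R}^N$ is a bounded smooth domain with $0\in\Omega$, and $f:\Omega\times[0,\infty)\to\mathbb{R}$, $g:[0,\infty)\to\mathbb{R}$. Fractional Laplacian: $(-\Delta)^s u(x)=c_{N,s}\,\mathrm{P.V.}\int_{\mathbb{R}^N}\frac{u(x)-u(y)}{|x-y|^{N+2s}}\,dy$ with $c_{N,s}=\left(\int_{\mathbb{R}^N}\frac{1-\cos(\xi_1)}{|\xi|^{N+2s}}\,d\xi\right)^{-1}$. $H^s_0(\Omega)=\{u\in H^s(\mathbb{R}^N): u=0 \text{ in } \mathbb{R}^N\setminus\Omega\}$. Weak solution: $u\in H^s_0(\Omega)$ (with $u>0$ in $\Omega$) is a weak solution of the problem if $\frac{g(u)}{|x|^{2s}}\in L^1(\Omega)$, $f(x,u)\in L^1(\Omega)$ and, for all $\varphi\in H^s_0(\Omega)\cap L^\infty(\Omega)$, $$\frac{c_{N,s}}{2}\int_Q\frac{(u(x)-u(y))(\varphi(x)-\varphi(y))}{|x-y|^{N+2s}}\,dx\,dy=\int_\Omega\frac{g(u)}{|x|^{2s}}\varphi\,dx+\int_\Omega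 f(x,u)\varphi\,dx,$$ where $Q=\mathbb{R}^{2N}\setminus(\Omega^c\times\Omega^c)$.
   Formalization: Formalized with the added assumption g ≥ 0 on [0,∞), and the final ball claim is for balls centred at the origin with both reflection conditions on f assumed in every unit direction, not only x_1; without these the printed statement is false. *)

theory Defs
  imports "HOL-Analysis.Analysis"
begin

text \<open>
  \<open>\<real>\<^sup>N\<close> is \<open>real^'n\<close> with \<open>N = CARD('n)\<close>; the coordinate \<open>x\<^sub>1\<close> is \<open>x $ k\<close> for a distinguished
  index \<open>k\<close>, so the \<open>x\<^sub>1\<close>-direction is the unit vector \<open>axis k 1\<close>.
\<close>

subsection \<open>Domains and reflections\<close>

primrec Ck_fun :: "nat \<Rightarrow> (real^'n \<Rightarrow> real) \<Rightarrow> bool" where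
  "Ck_fun 0 h \<longleftrightarrow> continuous_on UNIV h"
| "Ck_fun (Suc m) h \<longleftrightarrow>
     (\<forall>x. h differentiable (at x)) \<and> (\<forall>v. Ck_fun m (\<lambda>x. frechet_derivative h (at x) v))"

definition smooth_fun :: "(real^'n \<Rightarrow> real) \<Rightarrow> bool" where
  "smooth_fun h \<longleftrightarrow> (\<forall>m. Ck_fun m h)"

text \<open>
  Near each boundary point the domain is the region below the graph, in some direction \<open>\<nu>\<close>, of a
  smooth function \<open>h\<close> of the component \<open>x - (x \<bullet> \<nu>) \<nu>\<close> orthogonal to \<open>\<nu>\<close>.
\<close>
definition smooth_boundary :: "(real^'n) set \<Rightarrow> bool" where
  "smooth_boundary \<Omega> \<longleftrightarrow>
     (\<forall>p\<in>frontier \<Omega>. \<exists>r>0. \<exists>\<nu> h. norm \<nu> = 1 \<and> smooth_fun h \<and>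
        \<Omega> \<inter> ball p r = {x \<in> ball p r. x \<bullet> \<nu> < h (x - (x \<bullet> \<nu>) *\<^sub>R \<nu>)})"

definition bounded_smooth_domain :: "(real^'n) set \<Rightarrow> bool" where
  "bounded_smooth_domain \<Omega> \<longleftrightarrow>
     open \<Omega> \<and> connected \<Omega> \<and> bounded \<Omega> \<and> smooth_boundary \<Omega>"

text \<open>
  Reflection in the hyperplane \<open>x \<bullet> e = \<mu>\<close>, for a unit vector \<open>e\<close>.
\<close>
definition hyp_reflect :: "real^'n \<Rightarrow> real \<Rightarrow> real^'n \<Rightarrow> real^'n" where
  "hyp_reflect e \<mu> x = x + (2 * (\<mu> - x \<bullet> e)) *\<^sub>R e"

lemma hyp_reflect_axis:
  "hyp_reflect (axis k 1) \<mu> x = (\<chi> i. if i = k then 2 * \<mu> - x $ k else x $ i)"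
proof -
  have "x \<bullet> axis k 1 = x $ k"
    by (simp add: inner_axis)
  then show ?thesis
    by (simp add: hyp_reflect_def vec_eq_iff axis_def)
qed

definition convex_in_direction :: "real^'n \<Rightarrow> (real^'n) set \<Rightarrow> bool" where
  "convex_in_direction e \<Omega> \<longleftrightarrow>
     (\<forall>x\<in>\<Omega>. \<forall>t. x + t *\<^sub>R e \<in> \<Omega> \<longrightarrow> closed_segment x (x + t *\<^sub>R e) \<subseteq> \<Omega>)"

definition symmetric_in_direction :: "real^'n \<Rightarrow> (real^'n) set \<Rightarrow> bool" where
  "symmetric_in_direction e \<Omega> \<longleftrightarrow> hyp_reflect e 0 ` \<Omega> = \<Omega>"

subsection \<open>Fractional Sobolev spaces and weak solutions\<close>

text \<open>
  The value of the constant does not depend on the choice of the coordinate \<open>k\<close>.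
\<close>
definition frac_const :: "'n::finite \<Rightarrow> real \<Rightarrow> real" where
  "frac_const k s =
     inverse (\<integral>\<xi>. (1 - cos (\<xi> $ k)) / norm \<xi> powr (real CARD('n) + 2 * s)
                \<partial>(lebesgue :: (real^'n) measure))"

definition Hs :: "real \<Rightarrow> (real^'n \<Rightarrow> real) set" where
  "Hs s = {u. u \<in> borel_measurable lebesgue \<and> integrable lebesgue (\<lambda>x. (u x)\<^sup>2) \<and>
      integrable (lebesgue :: ((real^'n) \<times> (real^'n)) measure)
        (\<lambda>(x, y). (u x - u y)\<^sup>2 / norm (x - y) powr (real CARD('n) + 2 * s))}"

definition Hs0 :: "real \<Rightarrow> (real^'n) set \<Rightarrow> (real^'n \<Rightarrow> real) set" where
  "Hs0 s \<Omega> = {u \<in> Hs s. AE x in lebesgue. x \<notin> \<Omega> \<longrightarrow> u x = 0}"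

definition Linfty :: "(real^'n \<Rightarrow> real) set" where
  "Linfty = {u. u \<in> borel_measurable lebesgue \<and> (\<exists>C. AE x in lebesgue. \<bar>u x\<bar> \<le> C)}"

text \<open>
  The sign condition excludes the origin, where a solution that is continuous on the closure of
  \<open>\<Omega>\<close> minus the origin has no meaningful value. The exterior condition is pointwise, so that it
  includes the boundary of \<open>\<Omega>\<close>, which \<^const>\<open>Hs0\<close> does not see.
\<close>
definition weak_solution ::
  "'n::finite \<Rightarrow> real \<Rightarrow> (real^'n) set \<Rightarrow> (real \<Rightarrow> real) \<Rightarrow> (real^'n \<Rightarrow> real \<Rightarrow> real) \<Rightarrow> (real^'n \<Rightarrow> real) \<Rightarrow> bool"
where
  "weak_solution k s \<Omega> g f u \<longleftrightarrow>
     u \<in> Hs0 s \<Omega> \<and>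
     (\<forall>x\<in>\<Omega> - {0}. u x > 0) \<and>
     (\<forall>x. x \<notin> \<Omega> \<longrightarrow> u x = 0) \<and>
     set_integrable lebesgue \<Omega> (\<lambda>x. g (u x) / norm x powr (2 * s)) \<and>
     set_integrable lebesgue \<Omega> (\<lambda>x. f x (u x)) \<and>
     (\<forall>\<phi> \<in> Hs0 s \<Omega> \<inter> Linfty.
        frac_const k s / 2 *
          set_lebesgue_integral (lebesgue :: ((real^'n) \<times> (real^'n)) measure) (- ((- \<Omega>) \<times> (- \<Omega>)))
            (\<lambda>(x, y). (u x - u y) * (\<phi> x - \<phi> y) / norm (x - y) powr (real CARD('n) + 2 * s))
        = set_lebesgue_integral lebesgue \<Omega> (\<lambda>x. g (u x) / norm x powr (2 * s) * \<phi> x)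
          + set_lebesgue_integral lebesgue \<Omega> (\<lambda>x. f x (u x) * \<phi> x))"

subsection \<open>Hypotheses on the nonlinearities\<close>

definition reflection_monotone ::
  "real^'n \<Rightarrow> (real^'n) set \<Rightarrow> (real^'n \<Rightarrow> real \<Rightarrow> real) \<Rightarrow> bool" where
  "reflection_monotone e \<Omega> f \<longleftrightarrow>
     (\<forall>\<mu><0. \<forall>x\<in>\<Omega>. x \<bullet> e < \<mu> \<longrightarrow> (\<forall>t\<ge>0. f x t \<le> f (hyp_reflect e \<mu> x) t)) \<and>
     (\<forall>x\<in>\<Omega>. x \<bullet> e < 0 \<longrightarrow> (\<forall>t\<ge>0. f x t = f (hyp_reflect e 0 x) t))"

definition caratheodory :: "(real^'n) set \<Rightarrow> (real^'n \<Rightarrow> real \<Rightarrow> real) \<Rightarrow> bool" where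
  "caratheodory \<Omega> f \<longleftrightarrow>
     (\<forall>t\<ge>0. (\<lambda>x. f x t) \<in> borel_measurable (lebesgue_on \<Omega>)) \<and>
     (AE x in lebesgue_on \<Omega>. continuous_on {0..} (f x))"

definition loc_lipschitz_snd :: "(real^'n) set \<Rightarrow> (real^'n \<Rightarrow> real \<Rightarrow> real) \<Rightarrow> bool" where
  "loc_lipschitz_snd \<Omega> f \<longleftrightarrow>
     (\<forall>M>0. \<exists>L. \<forall>x\<in>\<Omega>. \<forall>t1\<in>{0..M}. \<forall>t2\<in>{0..M}. \<bar>f x t1 - f x t2\<bar> \<le> L * \<bar>t1 - t2\<bar>)"

definition loc_lipschitz :: "(real \<Rightarrow> real) \<Rightarrow> bool" where
  "loc_lipschitz g \<longleftrightarrow>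
     (\<forall>M>0. \<exists>L. \<forall>t1\<in>{0..M}. \<forall>t2\<in>{0..M}. \<bar>g t1 - g t2\<bar> \<le> L * \<bar>t1 - t2\<bar>)"

definition holder_away_from_origin ::
  "(real^'n) set \<Rightarrow> (real^'n \<Rightarrow> real \<Rightarrow> real) \<Rightarrow> bool" where
  "holder_away_from_origin \<Omega> f \<longleftrightarrow>
     (\<forall>M>0. \<forall>r>0. \<exists>\<gamma>\<in>{0<..<1}. \<exists>C.
        \<forall>x\<in>\<Omega> - ball 0 r. \<forall>y\<in>\<Omega> - ball 0 r. \<forall>t\<in>{0..M}.
          \<bar>f x t - f y t\<bar> \<le> C * norm (x - y) powr \<gamma>)"

definition hypothesis_a ::
  "(real^'n) set \<Rightarrow> (real^'n \<Rightarrow> real \<Rightarrow> real) \<Rightarrow> (real \<Rightarrow> real) \<Rightarrow> bool" where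
  "hypothesis_a \<Omega> f g \<longleftrightarrow>
     caratheodory \<Omega> f \<and> loc_lipschitz_snd \<Omega> f \<and> loc_lipschitz g \<and>
     (\<forall>x\<in>\<Omega>. mono_on {0..} (f x)) \<and> mono_on {0..} g"

definition hypothesis_b ::
  "(real^'n) set \<Rightarrow> (real^'n \<Rightarrow> real \<Rightarrow> real) \<Rightarrow> (real \<Rightarrow> real) \<Rightarrow> bool" where
  "hypothesis_b \<Omega> f g \<longleftrightarrow>
     caratheodory \<Omega> f \<and> loc_lipschitz_snd \<Omega> f \<and> loc_lipschitz g \<and>
     holder_away_from_origin \<Omega> f"

end

theory Submission
  imports Defs
begin

text \<open>
  The proof is the method of moving planes, carried out in the weak formulation: every estimate
  comes from one well-chosen test function.

  For a unit vector \<open>e\<close> and \<open>\<mu> < 0\<close> let \<open>R\<close> be the reflection in the plane \<open>x \<bullet> e = \<mu>\<close> and let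
  \<open>w = u - u \<circ> R\<close>, which is odd under \<open>R\<close>. The test function is the positive part of \<open>w\<close> on the
  side \<open>x \<bullet> e \<le> \<mu>\<close>, extended to an odd function. Averaging the double integral of the energy over
  reflections of either variable turns it into an integral in which every pair of points enters with
  the two kernel values \<open>K(x - y)\<close> and \<open>K(x - R y)\<close>, and the first is the larger one for points on the
  same side. This makes truncation lower the energy
  (\<open>odd_positive_part_reflected_form\<close>, \<open>energy_odd_positive_part_ge\<close>), with an explicit surplus that
  couples the positive to the negative part of \<open>w\<close>. The right-hand side, tested with the same
  function, becomes the difference of the nonlinearity at \<open>x\<close> and at \<open>R x\<close>. By the monotonicity of
  \<open>f\<close> under reflections, by \<open>|R x| \<le> |x|\<close> and \<open>g \<ge> 0\<close>, and by the Lipschitz conditions it is at most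
  a constant times \<open>w\<close> where \<open>w > 0\<close>, the constant being uniform as long as \<open>\<mu>\<close> stays
  away from 0, where \<open>u\<close> is bounded on \<open>x \<bullet> e \<le> \<mu>\<close>. The singular point \<open>R 0\<close> does no harm, since
  \<open>w\<close> is positive only where \<open>u \<circ> R\<close> is smaller than the bounded function \<open>u\<close>.

  Two maximum principles follow. If the set where \<open>w > 0\<close> has small measure, the kernel has
  large mass outside it, so the energy of the truncation dominates its \<open>L\<^sup>2\<close> norm and \<open>w \<le> 0\<close>
  (\<open>small_overlap_principle\<close>). If \<open>w \<le> 0\<close>, then \<open>w < 0\<close> inside \<open>\<Omega>\<close>: otherwise a small concave bump is
  added to \<open>u\<close> near a point of contact, and the surplus term above, fed by a ball where \<open>w\<close> is strictly
  negative, beats all other terms, which are as small as the bump (\<open>strong_maximum_principle\<close>).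

  Finally let \<open>m\<close> be the infimum of the positions \<open>\<mu> < 0\<close> at which \<open>w \<le> 0\<close> fails, and suppose that
  there are such positions. By continuity the inequality holds at \<open>m\<close>, hence strictly.
  Along a sequence of failing positions that decreases to \<open>m\<close> the sets where \<open>w > 0\<close> therefore shrink to a null
  set, their measures tend to 0 by dominated convergence, and the first maximum principle gives
  a contradiction (\<open>reflection_order\<close>). Letting \<open>\<mu>\<close> tend to 0 and using \<open>- e\<close> as well as \<open>e\<close> gives the
  symmetry; on a ball all directions \<open>e\<close> are available.
\<close>

section \<open>The kernel of the fractional Laplacian\<close>

definition frac_kernel :: "real \<Rightarrow> real^'n \<Rightarrow> real" where
  "frac_kernel s t = 1 / norm t powr (real CARD('n) + 2 * s)"

lemma frac_kernel_nonneg [simp]: "0 \<le> frac_kernel s t"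
  by (simp add: frac_kernel_def)

lemma frac_kernel_minus [simp]: "frac_kernel s (- t) = frac_kernel s t"
  by (simp add: frac_kernel_def)

lemma measurable_frac_kernel [measurable]: "frac_kernel s \<in> borel_measurable borel"
  unfolding frac_kernel_def by measurable

text \<open>
  Division by zero gives the kernel the value 0 at the origin, whence the condition on \<open>x\<close>.
\<close>
lemma frac_kernel_antimono:
  fixes x y :: "real^'n"
  assumes "0 < s" "x \<noteq> 0" "norm x \<le> norm y"
  shows "frac_kernel s y \<le> frac_kernel s x"
  using assms unfolding frac_kernel_def by (intro divide_left_mono powr_mono2 mult_pos_pos) auto

lemma frac_kernel_strict_antimono:
  fixes x y :: "real^'n"
  assumes "0 < s" "x \<noteq> 0" "norm x < norm y"
  shows "frac_kernel s y < frac_kernel s x"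
proof -
  have "norm x powr (real CARD('n) + 2 * s) < norm y powr (real CARD('n) + 2 * s)"
    using assms by (intro powr_less_mono2) (auto intro: add_pos_pos)
  then show ?thesis
    using assms by (simp add: frac_kernel_def frac_less2 divide_strict_left_mono)
qed

text \<open>
  The function is dominated by the sum of the constants \<open>c j\<close> on the balls of radius \<open>\<rho> j\<close>, whose
  integral is a multiple of the series. With geometric radii this integrates a power singularity
  without polar coordinates.
\<close>
lemma integrable_dyadic:
  fixes f :: "real^'n \<Rightarrow> real" and \<rho> c :: "nat \<Rightarrow> real"
  assumes [measurable]: "f \<in> borel_measurable borel"
    and nonneg: "\<And>t. 0 \<le> f t" "\<And>j. 0 \<le> c j" "\<And>j. 0 \<le> \<rho> j"
    and cover: "\<And>t. f t \<noteq> 0 \<Longrightarrow> \<exists>j. norm t \<le> \<rho> j \<and> f t \<le> c j"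
    and summ: "summable (\<lambda>j. c j * \<rho> j ^ CARD('n))"
  shows "integrable lborel f"
proof (rule integrableI_nonneg)
  let ?\<omega> = "unit_ball_vol (real CARD('n))"
  have "(\<integral>\<^sup>+t. ennreal (f t) \<partial>lborel) \<le> (\<integral>\<^sup>+t. (\<Sum>j. ennreal (c j) * indicator (cball (0::real^'n) (\<rho> j)) t) \<partial>lborel)"
  proof (rule nn_integral_mono)
    fix t :: "real^'n"
    show "ennreal (f t) \<le> (\<Sum>j. ennreal (c j) * indicator (cball 0 (\<rho> j)) t)"
    proof (cases "f t = 0")
      case False
      then obtain j where j: "norm t \<le> \<rho> j" "f t \<le> c j" using cover by blast
      then have "ennreal (f t) \<le> ennreal (c j) * indicator (cball 0 (\<rho> j)) t"
        by (auto intro: ennreal_leI)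
      also have "\<dots> \<le> (\<Sum>j. ennreal (c j) * indicator (cball 0 (\<rho> j)) t)"
      proof -
        define g where "g = (\<lambda>j. ennreal (c j) * indicator (cball 0 (\<rho> j)) t)"
        have "g j \<le> suminf g" using sum_le_suminf[of g "{j}"] by simp
        then show ?thesis unfolding g_def .
      qed
      finally show ?thesis .
    qed auto
  qed
  also have "\<dots> = (\<Sum>j. ennreal (c j) * emeasure lborel (cball (0::real^'n) (\<rho> j)))"
  proof -
    have [measurable]: "cball (0::real^'n) (\<rho> i) \<in> sets borel" for i by (intro borel_closed closed_cball)
    show ?thesis by (subst nn_integral_suminf) (auto simp: nn_integral_cmult_indicator)
  qed
  also have "\<dots> = (\<Sum>j. ennreal (?\<omega> * (c j * \<rho> j ^ CARD('n))))"
    using nonneg by (intro suminf_cong) (simp add: emeasure_cball ennreal_mult'[symmetric] algebra_simps)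
  also have "\<dots> < \<infinity>"
    using summ nonneg by (subst suminf_ennreal2) (auto intro!: summable_mult mult_nonneg_nonneg)
  finally show "(\<integral>\<^sup>+t. ennreal (f t) \<partial>lborel) < \<infinity>" .
qed (use nonneg in auto)

text \<open>
  The shells \<open>2\<^sup>j \<le> |t| < 2\<^sup>j\<^sup>+\<^sup>1\<close> contribute a geometric series of ratio \<open>2 powr (- 2 s)\<close> outwards and of
  ratio \<open>2 powr (- (2 - 2 s))\<close> inwards; these are less than 1 for \<open>0 < s < 1\<close>.
\<close>
lemma integrable_frac_kernel_min:
  fixes s :: real
  assumes s: "0 < s" "s < 1"
  shows "integrable lborel (\<lambda>t::real^'n. min 1 ((norm t)\<^sup>2) * frac_kernel s t)"
proof -
  let ?N = "real CARD('n)"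
  let ?p = "?N + 2 * s"
  have p: "?p > 0" using s by (simp add: add_pos_pos)
  have geo: "summable (\<lambda>j::nat. (2 powr (- a)) ^ j)" if "0 < a" for a :: real
    using that by (intro summable_geometric) (auto simp: powr_less_one)
  have powr_nat: "(2 powr a) ^ j = 2 powr (a * real j)" for a :: real and j :: nat
    by (simp add: powr_powr flip: powr_realpow)
  have outer: "integrable lborel (\<lambda>t::real^'n. indicator {t. 1 \<le> norm t} t * frac_kernel s t)"
  proof (rule integrable_dyadic[where \<rho> = "\<lambda>j. 2 powr (real j + 1)" and c = "\<lambda>j. 2 powr (- ?p * real j)"])
    fix t :: "real^'n" assume "indicator {t. 1 \<le> norm t} t * frac_kernel s t \<noteq> 0"
    then have t: "1 \<le> norm t" by (auto split: split_indicator_asm)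
    define j where "j = nat \<lfloor>log 2 (norm t)\<rfloor>"
    have t0: "0 < norm t" using t by linarith
    then have "0 \<le> log 2 (norm t)" using t by simp
    then have j: "real j \<le> log 2 (norm t)" "log 2 (norm t) < real j + 1"
      unfolding j_def by linarith+
    have lo: "2 powr real j \<le> norm t" and hi: "norm t \<le> 2 powr (real j + 1)"
      using j t0 by (auto simp: le_log_iff log_less_iff)
    have "(2 powr real j) powr ?p \<le> norm t powr ?p"
      using lo p by (intro powr_mono2) auto
    then have "frac_kernel s t \<le> 1 / (2 powr real j) powr ?p"
      unfolding frac_kernel_def by (intro divide_left_mono mult_pos_pos) (use t0 in auto)
    also have "\<dots> = 2 powr (- ?p * real j)"
      by (simp only: powr_powr minus_mult_left[symmetric] powr_minus_divide mult.commute[of "real j"])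
    finally show "\<exists>j. norm t \<le> 2 powr (real j + 1) \<and>
        indicator {t. 1 \<le> norm t} t * frac_kernel s t \<le> 2 powr (- ?p * real j)"
      using hi t by auto
  next
    have "2 powr (- ?p * real j) * (2 powr (real j + 1)) ^ CARD('n) = 2 powr ?N * (2 powr (- (2 * s))) ^ j" for j
      by (simp add: powr_powr algebra_simps flip: powr_realpow powr_add)
    then show "summable (\<lambda>j. 2 powr (- ?p * real j) * (2 powr (real j + 1)) ^ CARD('n))"
      using geo[of "2 * s"] s by (simp add: summable_mult)
  qed auto
  have inner: "integrable lborel (\<lambda>t::real^'n. indicator {t. norm t < 1} t * ((norm t)\<^sup>2 * frac_kernel s t))"
  proof (rule integrable_dyadic[where \<rho> = "\<lambda>j. 2 powr (- real j)" and c = "\<lambda>j. 2 powr (?p * (real j + 1) - 2 * real j)"])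
    fix t :: "real^'n" assume "indicator {t. norm t < 1} t * ((norm t)\<^sup>2 * frac_kernel s t) \<noteq> 0"
    then have t: "norm t < 1" "0 < norm t" by (auto split: split_indicator_asm)
    define j where "j = nat \<lfloor>- log 2 (norm t)\<rfloor>"
    have "0 < - log 2 (norm t)" using t by simp
    then have j: "real j \<le> - log 2 (norm t)" "- log 2 (norm t) < real j + 1"
      unfolding j_def by linarith+
    have lo: "2 powr (- (real j + 1)) \<le> norm t" and hi: "norm t \<le> 2 powr (- real j)"
      using j t by (auto simp: powr_le_iff le_powr_iff)
    have "(2 powr (- (real j + 1))) powr ?p \<le> norm t powr ?p"
      using lo p by (intro powr_mono2) auto
    then have "frac_kernel s t \<le> 1 / (2 powr (- (real j + 1))) powr ?p"
      unfolding frac_kernel_def by (intro divide_left_mono mult_pos_pos) (use t in auto)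
    also have "\<dots> = 2 powr (?p * (real j + 1))"
    proof -
      have "(2 powr (- (real j + 1))) powr ?p = 2 powr (- (?p * (real j + 1)))"
        by (simp add: powr_powr algebra_simps)
      then show ?thesis by (simp only: powr_minus_divide) simp
    qed
    finally have "frac_kernel s t \<le> 2 powr (?p * (real j + 1))" .
    moreover have "(norm t)\<^sup>2 \<le> (2 powr (- real j))\<^sup>2"
      using hi t by (intro power_mono) auto
    ultimately have "(norm t)\<^sup>2 * frac_kernel s t \<le> (2 powr (- real j))\<^sup>2 * 2 powr (?p * (real j + 1))"
      by (intro mult_mono) auto
    also have "\<dots> = 2 powr (?p * (real j + 1) - 2 * real j)"
      by (simp add: powr_nat algebra_simps power2_eq_square flip: powr_add)
    finally show "\<exists>j. norm t \<le> 2 powr (- real j) \<and>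
        indicator {t. norm t < 1} t * ((norm t)\<^sup>2 * frac_kernel s t) \<le> 2 powr (?p * (real j + 1) - 2 * real j)"
      using hi t by (intro exI[of _ j]) auto
  next
    have "2 powr (?p * (real j + 1) - 2 * real j) * (2 powr (- real j)) ^ CARD('n) = 2 powr ?p * (2 powr (- (2 - 2 * s))) ^ j" for j
      by (simp add: powr_powr algebra_simps flip: powr_realpow powr_add)
    then show "summable (\<lambda>j. 2 powr (?p * (real j + 1) - 2 * real j) * (2 powr (- real j)) ^ CARD('n))"
      using geo[of "2 - 2 * s"] s by (simp add: summable_mult)
  qed auto
  have "min 1 ((norm t)\<^sup>2) * frac_kernel s t =
      indicator {t. 1 \<le> norm t} t * frac_kernel s t + indicator {t. norm t < 1} t * ((norm t)\<^sup>2 * frac_kernel s t)"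
    for t :: "real^'n"
  proof (cases "1 \<le> norm t")
    case True
    then have "1 \<le> (norm t)\<^sup>2" by simp
    then show ?thesis using True by (simp add: min_absorb1)
  next
    case False
    then have "(norm t)\<^sup>2 \<le> 1" by (simp add: power_le_one)
    then show ?thesis using False by (simp add: min_absorb2)
  qed
  then show ?thesis using outer inner by simp
qed

text \<open>
  This is what makes the energy coercive on functions with small support, as in the fractional
  Faber--Krahn inequality. If \<open>D\<close> fills at most half of the ball of radius \<open>\<rho>\<close> about \<open>x\<close>, then the rest
  of that ball, where the kernel is at least \<open>\<rho> powr (- N - 2 s)\<close>, carries a mass of order \<open>\<rho> powr (- 2 s)\<close>.
\<close>
lemma frac_kernel_mass_outside_small_set:
  fixes s C :: real
  assumes s: "0 < s" and C: "0 < C"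
  obtains \<delta> where "0 < \<delta>" and
    "\<And>D x. D \<in> sets (borel :: (real^'n) measure) \<Longrightarrow> emeasure lborel D \<le> ennreal \<delta> \<Longrightarrow>
       ennreal C \<le> (\<integral>\<^sup>+y. indicator (- D) y * ennreal (frac_kernel s (x - y)) \<partial>lborel)"
proof -
  let ?N = "real CARD('n)"
  let ?p = "?N + 2 * s"
  let ?\<omega> = "unit_ball_vol ?N"
  have \<omega>: "?\<omega> > 0" by simp
  \<comment> \<open>half of the ball of radius \<open>\<rho>\<close> times the least kernel value on the ball is exactly \<open>C\<close>\<close>
  define \<rho> where "\<rho> = (?\<omega> / (2 * C)) powr (1 / (2 * s))"
  have q: "?\<omega> / (2 * C) > 0" using \<omega> C by (intro divide_pos_pos) auto
  have \<rho>: "\<rho> > 0" unfolding \<rho>_def powr_gt_zero using q by linarith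
  have \<rho>s: "\<rho> powr (2 * s) = ?\<omega> / (2 * C)"
    using s q C unfolding \<rho>_def powr_powr by simp
  define \<delta> where "\<delta> = ?\<omega> * \<rho> ^ CARD('n) / 2"
  show thesis
  proof
    show "0 < \<delta>" using \<rho> \<omega> by (simp add: \<delta>_def)
  next
    fix D :: "(real^'n) set" and x :: "real^'n"
    assume [measurable]: "D \<in> sets borel" and D: "emeasure lborel D \<le> ennreal \<delta>"
    let ?B = "ball x \<rho>"
    have "ennreal C = ennreal (1 / \<rho> powr ?p) * ennreal \<delta>"
      using \<rho> C less_imp_neq[OF \<omega>] by (simp add: \<delta>_def powr_add \<rho>s powr_realpow divide_simps flip: ennreal_mult)
    also have "ennreal \<delta> = ennreal (?\<omega> * \<rho> ^ CARD('n)) - ennreal \<delta>"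
      using \<rho> \<omega> by (subst ennreal_minus) (auto simp: \<delta>_def)
    also have "\<dots> \<le> emeasure lborel (?B - {x}) - emeasure lborel D"
      using \<rho> D by (intro ennreal_minus_mono) (auto simp: emeasure_ball emeasure_Diff_null_set finite_imp_null_set_lborel)
    also have "\<dots> \<le> emeasure lborel (?B - {x} - D)"
    proof -
      have "emeasure lborel (?B - {x}) \<le> emeasure lborel (D \<union> (?B - {x} - D))"
        by (intro emeasure_mono) auto
      also have "\<dots> \<le> emeasure lborel D + emeasure lborel (?B - {x} - D)"
        by (intro emeasure_subadditive) auto
      finally show ?thesis using neq_top_trans[OF ennreal_neq_top D] by (simp add: ennreal_minus_le_iff)
    qed
    finally have "ennreal C \<le> ennreal (1 / \<rho> powr ?p) * emeasure lborel (?B - {x} - D)"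
      by (simp add: mult_left_mono)
    also have "\<dots> = (\<integral>\<^sup>+y. ennreal (1 / \<rho> powr ?p) * indicator (?B - {x} - D) y \<partial>lborel)"
      by (subst nn_integral_cmult_indicator) auto
    also have "\<dots> \<le> (\<integral>\<^sup>+y. indicator (- D) y * ennreal (frac_kernel s (x - y)) \<partial>lborel)"
    proof (rule nn_integral_mono)
      fix y :: "real^'n"
      have "1 / \<rho> powr ?p \<le> frac_kernel s (x - y)" if "y \<in> ?B - {x}"
        unfolding frac_kernel_def using that s
        by (intro divide_left_mono powr_mono2 mult_pos_pos) (use \<rho> in \<open>auto simp: dist_norm\<close>)
      then show "ennreal (1 / \<rho> powr ?p) * indicator (?B - {x} - D) y \<le> indicator (- D) y * ennreal (frac_kernel s (x - y))"
        by (auto split: split_indicator intro: ennreal_leI)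
    qed
    finally show "ennreal C \<le> (\<integral>\<^sup>+y. indicator (- D) y * ennreal (frac_kernel s (x - y)) \<partial>lborel)" .
  qed
qed

text \<open>
  Passes from almost everywhere statements, which the weak formulation yields, to pointwise ones
  for continuous functions.
\<close>
lemma AE_lborel_open_ex:
  fixes S :: "'a::euclidean_space set"
  assumes "AE x in lborel. P x" "open S" "S \<noteq> {}"
  obtains x where "x \<in> S" "P x"
proof (rule ccontr)
  assume "\<not> thesis"
  then have none: "\<And>x. x \<in> S \<Longrightarrow> \<not> P x" using that by blast
  have "AE x in lborel. x \<notin> S"
    using assms(1) by eventually_elim (use none in auto)
  then have "S \<in> null_sets lborel"
    using assms(2) by (simp add: AE_iff_null_sets)
  then have "negligible S"
    by (metis negligible_iff_null_sets null_sets_completionI)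
  then show False using assms open_not_negligible by blast
qed

text \<open>
  An integral that diverged would be 0 by convention, and so would its inverse; the content is
  therefore the integrability.
\<close>
lemma frac_const_pos:
  fixes k :: "'n::finite"
  assumes s: "0 < s" "s < 1"
  shows "0 < frac_const k s"
proof -
  let ?f = "\<lambda>\<xi>::real^'n. (1 - cos (\<xi> $ k)) / norm \<xi> powr (real CARD('n) + 2 * s)"
  have [measurable]: "?f \<in> borel_measurable borel" by measurable
  have nn: "0 \<le> ?f \<xi>" for \<xi> by simp
  have int: "integrable lborel ?f"
  proof (rule Bochner_Integration.integrable_bound)
    show "integrable lborel (\<lambda>t::real^'n. 2 * (min 1 ((norm t)\<^sup>2) * frac_kernel s t))"
      using integrable_frac_kernel_min[OF s] by simp
    have "1 - cos (\<xi> $ k) \<le> 2 * min 1 ((norm \<xi>)\<^sup>2)" for \<xi> :: "real^'n"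
    proof -
      have "1 - cos (\<xi> $ k) = 2 * (sin (\<xi> $ k / 2))\<^sup>2"
        using cos_double_sin[of "\<xi> $ k / 2"] by simp
      also have "(sin (\<xi> $ k / 2))\<^sup>2 \<le> \<bar>\<xi> $ k / 2\<bar>\<^sup>2"
        using abs_sin_x_le_abs_x[of "\<xi> $ k / 2"] by (metis abs_le_square_iff abs_abs)
      also have "\<dots> \<le> (norm \<xi>)\<^sup>2"
        using component_le_norm_cart[of \<xi> k] by (intro power_mono) auto
      finally show ?thesis using cos_ge_minus_one[of "\<xi> $ k"] by (simp add: min_def)
    qed
    then show "AE \<xi> in lborel. norm (?f \<xi>) \<le> norm (2 * (min 1 ((norm \<xi>)\<^sup>2) * frac_kernel s \<xi>))"
      by (auto simp: frac_kernel_def abs_mult divide_right_mono intro!: AE_I2)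
  qed simp
  have "integral\<^sup>L lborel ?f \<noteq> 0"
  proof
    assume "integral\<^sup>L lborel ?f = 0"
    then have AE0: "AE \<xi> in lborel. ?f \<xi> = 0"
      using integral_nonneg_eq_0_iff_AE[OF int] nn by auto
    have "open {\<xi>::real^'n. 0 < \<xi> $ k \<and> \<xi> $ k < 1}"
      by (intro open_Collect_conj open_Collect_less continuous_intros)
    moreover have "(\<chi> i. 1 / 2) \<in> {\<xi>::real^'n. 0 < \<xi> $ k \<and> \<xi> $ k < 1}" by simp
    ultimately obtain \<xi> :: "real^'n" where \<xi>: "0 < \<xi> $ k" "\<xi> $ k < 1" "?f \<xi> = 0"
      using AE_lborel_open_ex[OF AE0] by (metis (mono_tags, lifting) empty_iff mem_Collect_eq)
    then have "\<xi> \<noteq> 0" by auto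
    with \<xi> have "cos (\<xi> $ k) = 1" by auto
    moreover have "cos (\<xi> $ k) < cos 0"
      using \<xi> pi_gt3 by (intro cos_monotone_0_pi) auto
    ultimately show False by simp
  qed
  moreover have "0 \<le> integral\<^sup>L lborel ?f" by (intro integral_nonneg_AE) auto
  moreover have "integral\<^sup>L lebesgue ?f = integral\<^sup>L lborel ?f"
    by (intro integral_completion) simp
  ultimately have "0 < integral\<^sup>L lebesgue ?f" by linarith
  then show ?thesis unfolding frac_const_def by (simp only: inverse_positive_iff_positive)
qed

section \<open>Reflections in hyperplanes\<close>

lemma hyp_reflect_inner:
  assumes "norm e = 1"
  shows "hyp_reflect e \<mu> x \<bullet> e = 2 * \<mu> - x \<bullet> e"
  using assms by (simp add: hyp_reflect_def inner_add_left norm_eq_1)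

lemma hyp_reflect_involution:
  assumes "norm e = 1"
  shows "hyp_reflect e \<mu> (hyp_reflect e \<mu> x) = x"
  using assms unfolding hyp_reflect_def
  by (simp add: inner_add_left norm_eq_1 algebra_simps flip: scaleR_add_left)

lemma hyp_reflect_diff: "hyp_reflect e \<mu> x - hyp_reflect e \<mu> y = hyp_reflect e 0 (x - y)"
  by (simp add: hyp_reflect_def algebra_simps inner_diff_left)

lemma norm_add_unit_sq:
  fixes x e :: "'a::real_inner"
  assumes "norm e = 1"
  shows "(norm (x + c *\<^sub>R e))\<^sup>2 = (norm x)\<^sup>2 + 2 * c * (x \<bullet> e) + c\<^sup>2"
  using assms unfolding power2_norm_eq_inner
  by (simp add: inner_add_left inner_add_right inner_commute norm_eq_1 power2_eq_square)

lemma norm_hyp_reflect_sq: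
  assumes "norm e = 1"
  shows "(norm (hyp_reflect e \<mu> x))\<^sup>2 = (norm x)\<^sup>2 + 4 * \<mu> * (\<mu> - x \<bullet> e)"
  unfolding hyp_reflect_def norm_add_unit_sq[OF assms] by (simp add: algebra_simps power2_eq_square)

lemma norm_hyp_reflect_0 [simp]:
  assumes "norm e = 1"
  shows "norm (hyp_reflect e 0 x) = norm x"
  using norm_hyp_reflect_sq[OF assms, of 0 x] by simp

lemma norm_diff_hyp_reflect:
  assumes "norm e = 1"
  shows "norm (hyp_reflect e \<mu> x - hyp_reflect e \<mu> y) = norm (x - y)"
  using assms by (simp add: hyp_reflect_diff)

lemma norm_diff_hyp_reflect_swap:
  assumes "norm e = 1"
  shows "norm (hyp_reflect e \<mu> x - y) = norm (x - hyp_reflect e \<mu> y)"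
  using norm_diff_hyp_reflect[OF assms, of \<mu> x "hyp_reflect e \<mu> y"] assms
  by (simp add: hyp_reflect_involution)

lemma norm_diff_hyp_reflect_sq:
  assumes "norm e = 1"
  shows "(norm (x - hyp_reflect e \<mu> y))\<^sup>2 = (norm (x - y))\<^sup>2 + 4 * (\<mu> - x \<bullet> e) * (\<mu> - y \<bullet> e)"
proof -
  have "x - hyp_reflect e \<mu> y = (x - y) + (- (2 * (\<mu> - y \<bullet> e))) *\<^sub>R e"
    by (simp add: hyp_reflect_def algebra_simps)
  then show ?thesis
    by (simp only: norm_add_unit_sq[OF assms]) (simp add: inner_diff_left algebra_simps power2_eq_square)
qed

lemma continuous_on_hyp_reflect [continuous_intros]:
  "continuous_on S f \<Longrightarrow> continuous_on S (\<lambda>x. hyp_reflect e \<mu> (f x))"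
  unfolding hyp_reflect_def by (intro continuous_intros)

lemma measurable_hyp_reflect [measurable]: "hyp_reflect e \<mu> \<in> borel \<rightarrow>\<^sub>M borel"
  by (intro borel_measurable_continuous_onI continuous_intros)

text \<open>
  Uniqueness of Haar measure by the usual Fubini argument: the double integral of
  \<open>1\<^sub>A(x) 1\<^sub>B(h y - x)\<close> for the unit ball \<open>B\<close>, evaluated in the two orders, is \<open>|A| |B|\<close> and \<open>|h\<^sup>-\<^sup>1 A| |B|\<close>,
  because \<open>B\<close> is invariant under \<open>h\<close>. This covers reflections in arbitrary directions on \<open>real^'n\<close>
  for every finite index type.
\<close>
lemma lborel_distr_linear_isometric_involution:
  fixes h :: "'a::euclidean_space \<Rightarrow> 'a"
  assumes lin: "linear h" and iso: "\<And>x. norm (h x) = norm x" and inv: "\<And>x. h (h x) = x"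
  shows "distr lborel borel h = lborel"
proof (rule measure_eqI)
  have [measurable]: "h \<in> borel \<rightarrow>\<^sub>M borel"
    using lin by (intro borel_measurable_continuous_onI linear_continuous_on) (simp add: linear_conv_bounded_linear)
  fix A assume "A \<in> sets (distr lborel borel h)"
  then have A[measurable]: "A \<in> sets borel" by simp
  have hdiff: "h x - y = h (x - h y)" for x y
    using lin by (simp add: linear_diff inv)
  have shift: "(\<integral>\<^sup>+y. \<psi> (y - x) \<partial>lborel) = (\<integral>\<^sup>+y. \<psi> y \<partial>lborel)" if [measurable]: "\<psi> \<in> borel_measurable borel" for \<psi> :: "'a \<Rightarrow> ennreal" and x
  proof -
    have "(\<integral>\<^sup>+y. \<psi> y \<partial>lborel) = (\<integral>\<^sup>+y. \<psi> y \<partial>distr lborel borel ((+) (- x)))"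
      by (simp add: lborel_distr_plus)
    also have "\<dots> = (\<integral>\<^sup>+y. \<psi> (y - x) \<partial>lborel)"
      by (subst nn_integral_distr) auto
    finally show ?thesis by simp
  qed
  have flip: "(\<integral>\<^sup>+y. \<psi> (x - y) \<partial>lborel) = (\<integral>\<^sup>+y. \<psi> y \<partial>lborel)" if [measurable]: "\<psi> \<in> borel_measurable borel" for \<psi> :: "'a \<Rightarrow> ennreal" and x
  proof -
    have "lborel = density (distr lborel borel (\<lambda>y::'a. x + (-1) *\<^sub>R y)) (\<lambda>_. \<bar>-1::real\<bar> ^ DIM('a))"
      by (rule lborel_affine) simp
    then have L: "lborel = distr lborel borel (\<lambda>y::'a. x - y)"
      by (simp add: density_1)
    have "(\<integral>\<^sup>+y. \<psi> y \<partial>lborel) = (\<integral>\<^sup>+y. \<psi> y \<partial>distr lborel borel (\<lambda>y::'a. x - y))"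
      using L by simp
    also have "\<dots> = (\<integral>\<^sup>+y. \<psi> (x - y) \<partial>lborel)"
      by (subst nn_integral_distr) auto
    finally show ?thesis by simp
  qed
  let ?B = "ball (0::'a) 1"
  let ?b = "emeasure lborel ?B"
  have [measurable]: "?B \<in> sets borel" by (intro borel_open open_ball)
  have b: "0 < ?b" "?b < \<infinity>"
    by (simp_all add: emeasure_ball ennreal_zero_less_top)
  have B: "h x \<in> ?B \<longleftrightarrow> x \<in> ?B" for x by (simp add: iso)
  have "emeasure lborel A * ?b = (\<integral>\<^sup>+x. indicator A x * ?b \<partial>lborel)"
    by (simp add: nn_integral_multc)
  also have "\<dots> = (\<integral>\<^sup>+x. indicator A x * (\<integral>\<^sup>+y. indicator ?B (y - h x) \<partial>lborel) \<partial>lborel)"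
    by (subst shift) auto
  also have "\<dots> = (\<integral>\<^sup>+x. (\<integral>\<^sup>+y. indicator A x * indicator ?B (h y - x) \<partial>lborel) \<partial>lborel)"
    by (simp add: nn_integral_cmult[symmetric] hdiff iso indicator_def)
  also have "\<dots> = (\<integral>\<^sup>+y. (\<integral>\<^sup>+x. indicator A x * indicator ?B (h y - x) \<partial>lborel) \<partial>lborel)"
    by (rule lborel_pair.Fubini'[symmetric]) measurable
  also have "\<dots> = (\<integral>\<^sup>+y. (\<integral>\<^sup>+x. indicator A (h y - x) * indicator ?B x \<partial>lborel) \<partial>lborel)"
  proof (rule nn_integral_cong)
    fix y
    show "(\<integral>\<^sup>+x. indicator A x * indicator ?B (h y - x) \<partial>lborel) = (\<integral>\<^sup>+x. indicator A (h y - x) * indicator ?B x \<partial>lborel)"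
      using flip[of "\<lambda>x. indicator A x * indicator ?B (h y - x)" "h y"] by simp
  qed
  also have "\<dots> = (\<integral>\<^sup>+x. (\<integral>\<^sup>+y. indicator A (h y - x) * indicator ?B x \<partial>lborel) \<partial>lborel)"
    by (rule lborel_pair.Fubini') measurable
  also have "\<dots> = (\<integral>\<^sup>+x. (\<integral>\<^sup>+y. indicator A (h (y - h x)) \<partial>lborel) * indicator ?B x \<partial>lborel)"
    by (simp add: nn_integral_multc hdiff)
  also have "\<dots> = (\<integral>\<^sup>+x. (\<integral>\<^sup>+y. indicator A (h y) \<partial>lborel) * indicator ?B x \<partial>lborel)"
    by (subst shift) auto
  also have "\<dots> = (\<integral>\<^sup>+y. indicator A (h y) \<partial>lborel) * ?b"
    by (simp add: nn_integral_cmult)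
  also have "(\<integral>\<^sup>+y. indicator A (h y) \<partial>lborel) = emeasure (distr lborel borel h) A"
    by (simp add: nn_integral_distr flip: nn_integral_indicator)
  finally have "?b * emeasure lborel A = ?b * emeasure (distr lborel borel h) A"
    by (simp add: mult.commute)
  then show "emeasure (distr lborel borel h) A = emeasure lborel A"
    using b by (auto simp: ennreal_mult_cancel_left)
qed simp

lemma lborel_distr_hyp_reflect:
  assumes "norm e = 1"
  shows "distr lborel borel (hyp_reflect e \<mu>) = lborel"
proof -
  have "linear (hyp_reflect e 0)"
    by (rule linearI) (simp_all add: hyp_reflect_def inner_add_left algebra_simps)
  then have 0: "distr lborel borel (hyp_reflect e 0) = lborel"
    using assms by (intro lborel_distr_linear_isometric_involution) (simp_all add: hyp_reflect_involution)
  have "hyp_reflect e \<mu> = (+) ((2 * \<mu>) *\<^sub>R e) \<circ> hyp_reflect e 0"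
    by (simp add: fun_eq_iff hyp_reflect_def algebra_simps)
  then have "distr lborel borel (hyp_reflect e \<mu>) = distr (distr lborel borel (hyp_reflect e 0)) borel ((+) ((2 * \<mu>) *\<^sub>R e))"
    by (simp add: distr_distr)
  then show ?thesis by (simp add: 0 lborel_distr_plus)
qed

lemma lborel_pair_distr_fst:
  fixes h :: "'a::euclidean_space \<Rightarrow> 'a"
  assumes [measurable]: "h \<in> borel \<rightarrow>\<^sub>M borel" and h: "distr lborel borel h = lborel"
  shows "distr lborel borel (\<lambda>(x, y). (h x, y::'b::euclidean_space)) = lborel"
proof -
  have "distr (lborel \<Otimes>\<^sub>M lborel) (borel \<Otimes>\<^sub>M borel) (\<lambda>(x, y). (h x, y::'b))
      = distr lborel borel h \<Otimes>\<^sub>M distr lborel borel (\<lambda>y::'b. y)"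
    by (rule pair_measure_distr[symmetric]) (auto simp: h lborel.sigma_finite_measure_axioms distr_id2)
  also have "distr lborel borel (\<lambda>y::'b. y) = lborel" by (simp add: distr_id2)
  finally show ?thesis by (simp add: h lborel_prod borel_prod)
qed

lemma lborel_pair_distr_snd:
  fixes h :: "'b::euclidean_space \<Rightarrow> 'b"
  assumes [measurable]: "h \<in> borel \<rightarrow>\<^sub>M borel" and h: "distr lborel borel h = lborel"
  shows "distr lborel borel (\<lambda>(x::'a::euclidean_space, y). (x, h y)) = lborel"
proof -
  have "distr (lborel \<Otimes>\<^sub>M lborel) (borel \<Otimes>\<^sub>M borel) (\<lambda>(x::'a, y). (x, h y))
      = distr lborel borel (\<lambda>x::'a. x) \<Otimes>\<^sub>M distr lborel borel h"
    by (rule pair_measure_distr[symmetric]) (auto simp: h lborel.sigma_finite_measure_axioms distr_id2)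
  also have "distr lborel borel (\<lambda>x::'a. x) = lborel" by (simp add: distr_id2)
  finally show ?thesis by (simp add: h lborel_prod borel_prod)
qed

text \<open>
  The substitution \<open>y = x + t\<close> in double integrals.
\<close>
lemma lborel_pair_distr_shear:
  "distr lborel borel (\<lambda>(x::'a::euclidean_space, t). (x, x + t)) = lborel"
proof (rule measure_eqI)
  fix A assume "A \<in> sets (distr lborel borel (\<lambda>(x::'a, t). (x, x + t)))"
  then have A: "A \<in> sets borel" by simp
  then have [measurable]: "A \<in> sets (borel \<Otimes>\<^sub>M borel)" by (simp only: borel_prod)
  have m: "(\<lambda>(x::'a, t). (x, x + t)) \<in> lborel \<rightarrow>\<^sub>M borel"
    by (simp flip: borel_prod)
  have "emeasure (distr lborel borel (\<lambda>(x::'a, t). (x, x + t))) A = (\<integral>\<^sup>+p. indicator A p \<partial>distr lborel borel (\<lambda>(x::'a, t). (x, x + t)))"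
    using A by (subst nn_integral_indicator) auto
  also have "\<dots> = (\<integral>\<^sup>+(x, t). indicator A (x, x + t) \<partial>(lborel \<Otimes>\<^sub>M lborel))"
    using m by (subst nn_integral_distr) (auto simp: lborel_prod borel_prod[symmetric] case_prod_unfold)
  also have "\<dots> = (\<integral>\<^sup>+x. \<integral>\<^sup>+t. indicator A (x, x + t) \<partial>lborel \<partial>lborel)"
    by (subst lborel.nn_integral_fst[symmetric]) auto
  also have "\<dots> = (\<integral>\<^sup>+x. \<integral>\<^sup>+y. indicator A (x, y) \<partial>lborel \<partial>lborel)"
  proof (rule nn_integral_cong)
    fix x :: 'a
    have "(\<integral>\<^sup>+y. indicator A (x, y) \<partial>lborel) = (\<integral>\<^sup>+y. indicator A (x, y) \<partial>distr lborel borel ((+) x))"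
      by (simp add: lborel_distr_plus)
    also have "\<dots> = (\<integral>\<^sup>+t. indicator A (x, x + t) \<partial>lborel)"
      by (subst nn_integral_distr) auto
    finally show "(\<integral>\<^sup>+t. indicator A (x, x + t) \<partial>lborel) = (\<integral>\<^sup>+y. indicator A (x, y) \<partial>lborel)" by simp
  qed
  also have "\<dots> = emeasure (lborel \<Otimes>\<^sub>M lborel) A"
    by (subst lborel.nn_integral_fst) auto
  finally show "emeasure (distr lborel borel (\<lambda>(x::'a, t). (x, x + t))) A = emeasure lborel A"
    by (simp add: lborel_prod)
qed simp

section \<open>The energy form\<close>

text \<open>
  Without the factor \<open>c\<^sub>N\<^sub>,\<^sub>s / 2\<close>, over the whole space, and with respect to Borel instead of Lebesgue
  measure, so that Fubini's theorem and images of measures are directly available.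
\<close>
definition energy :: "real \<Rightarrow> (real^'n \<Rightarrow> real) \<Rightarrow> (real^'n \<Rightarrow> real) \<Rightarrow> real" where
  "energy s a b = (\<integral>(x, y). (a x - a y) * (b x - b y) * frac_kernel s (x - y) \<partial>lborel)"

definition finite_energy :: "real \<Rightarrow> (real^'n \<Rightarrow> real) \<Rightarrow> bool" where
  "finite_energy s a \<longleftrightarrow> a \<in> borel_measurable borel \<and>
     integrable lborel (\<lambda>(x, y). (a x - a y)\<^sup>2 * frac_kernel s (x - y))"

lemma measurable_pair_borel:
  fixes f :: "'a::euclidean_space \<Rightarrow> 'b::euclidean_space \<Rightarrow> real"
  shows "(\<lambda>(x, y). f x y) \<in> borel_measurable borel \<longleftrightarrow> (\<lambda>(x, y). f x y) \<in> borel_measurable (borel \<Otimes>\<^sub>M borel)"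
  by (simp add: borel_prod)

lemma finite_energy_measurable: "finite_energy s a \<Longrightarrow> a \<in> borel_measurable borel"
  by (simp add: finite_energy_def)

lemma measurable_energy_integrand:
  assumes [measurable]: "a \<in> borel_measurable borel" "b \<in> borel_measurable borel"
  shows "(\<lambda>(x, y). (a x - a y) * (b x - b y) * frac_kernel s (x - y)) \<in> borel_measurable borel"
  unfolding measurable_pair_borel by measurable

lemma integrable_energy_cross:
  fixes a b :: "real^'n \<Rightarrow> real"
  assumes a: "finite_energy s a" and b: "finite_energy s b"
  shows "integrable lborel (\<lambda>(x, y). (a x - a y) * (b x - b y) * frac_kernel s (x - y))"
proof (rule Bochner_Integration.integrable_bound)
  show "integrable lborel (\<lambda>p. (\<lambda>(x, y). (a x - a y)\<^sup>2 * frac_kernel s (x - y)) p + (\<lambda>(x, y). (b x - b y)\<^sup>2 * frac_kernel s (x - y)) p)"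
    using a b unfolding finite_energy_def by (intro Bochner_Integration.integrable_add) auto
  show "(\<lambda>(x, y). (a x - a y) * (b x - b y) * frac_kernel s (x - y)) \<in> borel_measurable lborel"
    using measurable_energy_integrand[OF finite_energy_measurable[OF a] finite_energy_measurable[OF b]] by simp
  have "\<bar>c * d\<bar> \<le> c\<^sup>2 + d\<^sup>2" for c d :: real
  proof -
    have "0 \<le> \<bar>c\<bar> * \<bar>d\<bar>" by simp
    then show ?thesis using sum_squares_bound[of "\<bar>c\<bar>" "\<bar>d\<bar>"] by (simp only: abs_mult power2_abs)
  qed
  then have "\<bar>(a x - a y) * (b x - b y) * frac_kernel s (x - y)\<bar> \<le> ((a x - a y)\<^sup>2 + (b x - b y)\<^sup>2) * frac_kernel s (x - y)" for x y
    unfolding abs_mult[of "_ * _"] by (intro mult_mono) auto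
  then show "AE p in lborel. norm ((\<lambda>(x, y). (a x - a y) * (b x - b y) * frac_kernel s (x - y)) p)
      \<le> norm ((\<lambda>(x, y). (a x - a y)\<^sup>2 * frac_kernel s (x - y)) p + (\<lambda>(x, y). (b x - b y)\<^sup>2 * frac_kernel s (x - y)) p)"
    by (auto simp: distrib_right)
qed

lemma measure_preserving_integral:
  fixes f :: "'a::euclidean_space \<Rightarrow> real"
  assumes [measurable]: "T \<in> borel \<rightarrow>\<^sub>M borel" and T: "distr lborel borel T = lborel" and f: "integrable lborel f"
  shows "integrable lborel (\<lambda>x. f (T x))" and "(\<integral>x. f (T x) \<partial>lborel) = (\<integral>x. f x \<partial>lborel)"
proof -
  have [measurable]: "f \<in> borel_measurable borel" using f borel_measurable_integrable by auto
  show "integrable lborel (\<lambda>x. f (T x))"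
    using f by (subst integrable_distr_eq[symmetric, where N=borel]) (auto simp: T)
  have "(\<integral>x. f x \<partial>distr lborel borel T) = (\<integral>x. f (T x) \<partial>lborel)"
    by (rule integral_distr) auto
  then show "(\<integral>x. f (T x) \<partial>lborel) = (\<integral>x. f x \<partial>lborel)" by (simp add: T)
qed

lemma measure_preserving_nn_integral:
  assumes [measurable]: "T \<in> borel \<rightarrow>\<^sub>M borel" and T: "distr lborel borel T = lborel" and [measurable]: "f \<in> borel_measurable borel"
  shows "(\<integral>\<^sup>+x. f (T x) \<partial>lborel) = (\<integral>\<^sup>+x. f x \<partial>lborel)"
proof -
  have "(\<integral>\<^sup>+x. f x \<partial>distr lborel borel T) = (\<integral>\<^sup>+x. f (T x) \<partial>lborel)"
    by (rule nn_integral_distr) auto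
  then show ?thesis by (simp add: T)
qed

lemma measurable_map_fst:
  fixes h :: "'a::euclidean_space \<Rightarrow> 'a"
  assumes [measurable]: "h \<in> borel \<rightarrow>\<^sub>M borel"
  shows "(\<lambda>(x, y::'b::euclidean_space). (h x, y)) \<in> borel \<rightarrow>\<^sub>M borel"
proof -
  have "(\<lambda>(x, y::'b). (h x, y)) \<in> borel \<Otimes>\<^sub>M borel \<rightarrow>\<^sub>M borel \<Otimes>\<^sub>M borel" by measurable
  then show ?thesis by (simp only: borel_prod)
qed

lemma measurable_map_snd:
  fixes h :: "'b::euclidean_space \<Rightarrow> 'b"
  assumes [measurable]: "h \<in> borel \<rightarrow>\<^sub>M borel"
  shows "(\<lambda>(x::'a::euclidean_space, y). (x, h y)) \<in> borel \<rightarrow>\<^sub>M borel"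
proof -
  have "(\<lambda>(x::'a, y). (x, h y)) \<in> borel \<Otimes>\<^sub>M borel \<rightarrow>\<^sub>M borel \<Otimes>\<^sub>M borel" by measurable
  then show ?thesis by (simp only: borel_prod)
qed

lemma measurable_map_shear:
  "(\<lambda>(x::'a::euclidean_space, t). (x, x + t)) \<in> borel \<rightarrow>\<^sub>M borel"
proof -
  have "(\<lambda>(x::'a, t). (x, x + t)) \<in> borel \<Otimes>\<^sub>M borel \<rightarrow>\<^sub>M borel \<Otimes>\<^sub>M borel" by measurable
  then show ?thesis by (simp only: borel_prod)
qed

lemma finite_energy_add:
  assumes a: "finite_energy s a" and b: "finite_energy s b"
  shows "finite_energy s (\<lambda>x. a x + b x)"
proof -
  have [measurable]: "a \<in> borel_measurable borel" "b \<in> borel_measurable borel"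
    using a b finite_energy_measurable by auto
  have "(\<lambda>(x, y). ((a x + b x) - (a y + b y))\<^sup>2 * frac_kernel s (x - y)) =
     (\<lambda>p. (\<lambda>(x, y). (a x - a y)\<^sup>2 * frac_kernel s (x - y)) p + (\<lambda>(x, y). (b x - b y)\<^sup>2 * frac_kernel s (x - y)) p
        + 2 * (\<lambda>(x, y). (a x - a y) * (b x - b y) * frac_kernel s (x - y)) p)"
    by (auto simp: fun_eq_iff power2_eq_square algebra_simps)
  then have "integrable lborel (\<lambda>(x, y). ((a x + b x) - (a y + b y))\<^sup>2 * frac_kernel s (x - y))"
    using a b integrable_energy_cross[OF a b] unfolding finite_energy_def by simp
  then show ?thesis unfolding finite_energy_def by auto
qed

lemma energy_add_left:
  assumes "finite_energy s a" "finite_energy s b" "finite_energy s c"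
  shows "energy s (\<lambda>x. a x + b x) c = energy s a c + energy s b c"
proof -
  have "energy s (\<lambda>x. a x + b x) c = (\<integral>p. (\<lambda>(x, y). (a x - a y) * (c x - c y) * frac_kernel s (x - y)) p
      + (\<lambda>(x, y). (b x - b y) * (c x - c y) * frac_kernel s (x - y)) p \<partial>lborel)"
    unfolding energy_def by (intro Bochner_Integration.integral_cong) (auto simp: algebra_simps)
  also have "\<dots> = energy s a c + energy s b c"
    unfolding energy_def using assms by (intro Bochner_Integration.integral_add integrable_energy_cross)
  finally show ?thesis .
qed

lemma finite_energy_cmult:
  assumes "finite_energy s a"
  shows "finite_energy s (\<lambda>x. k * a x)"
proof -
  have eq: "(\<lambda>(x, y). (k * a x - k * a y)\<^sup>2 * frac_kernel s (x - y)) = (\<lambda>p. k\<^sup>2 * (\<lambda>(x, y). (a x - a y)\<^sup>2 * frac_kernel s (x - y)) p)"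
    by (auto simp: fun_eq_iff power_mult_distrib simp flip: right_diff_distrib)
  show ?thesis using assms unfolding finite_energy_def eq by (auto intro!: borel_measurable_times)
qed

lemma finite_energy_uminus:
  assumes "finite_energy s a"
  shows "finite_energy s (\<lambda>x. - a x)"
proof -
  have "(- a x - - a y)\<^sup>2 = (a x - a y)\<^sup>2" for x y
    by (simp add: power2_eq_square algebra_simps)
  then show ?thesis using assms unfolding finite_energy_def by simp
qed

context
  fixes e :: "real^'n" and \<mu> :: real
  assumes e: "norm e = 1"
begin

lemma integrable_reflect_fst:
  assumes "integrable lborel (\<lambda>(x, y). f x y :: real)"
  shows "integrable lborel (\<lambda>(x, y). f (hyp_reflect e \<mu> x) y)"
    and "(\<integral>(x, y). f (hyp_reflect e \<mu> x) y \<partial>lborel) = (\<integral>(x, y). f x y \<partial>lborel)"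
  using measure_preserving_integral[OF measurable_map_fst lborel_pair_distr_fst assms, OF _ _ lborel_distr_hyp_reflect, of e \<mu>] e
  by (simp_all add: case_prod_unfold)

lemma integrable_reflect_snd:
  assumes "integrable lborel (\<lambda>(x, y). f x y :: real)"
  shows "integrable lborel (\<lambda>(x, y). f x (hyp_reflect e \<mu> y))"
    and "(\<integral>(x, y). f x (hyp_reflect e \<mu> y) \<partial>lborel) = (\<integral>(x, y). f x y \<partial>lborel)"
  using measure_preserving_integral[OF measurable_map_snd lborel_pair_distr_snd assms, OF _ _ lborel_distr_hyp_reflect, of e \<mu>] e
  by (simp_all add: case_prod_unfold)

lemma integral_reflect:
  assumes "integrable lborel (f :: real^'n \<Rightarrow> real)"
  shows "integrable lborel (\<lambda>x. f (hyp_reflect e \<mu> x))" and "(\<integral>x. f (hyp_reflect e \<mu> x) \<partial>lborel) = (\<integral>x. f x \<partial>lborel)"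
  using measure_preserving_integral[OF measurable_hyp_reflect lborel_distr_hyp_reflect assms] e by auto

lemma AE_reflect:
  assumes "AE x in lborel. P x"
  shows "AE x in lborel. P (hyp_reflect e \<mu> x)"
proof -
  obtain N where N: "N \<in> null_sets lborel" "\<And>x. x \<notin> N \<Longrightarrow> P x"
    using assms by (elim AE_E3) auto
  have "AE x in distr lborel borel (hyp_reflect e \<mu>). x \<notin> N"
    using N(1) by (simp add: lborel_distr_hyp_reflect[OF e] AE_not_in)
  then have "AE x in lborel. hyp_reflect e \<mu> x \<notin> N"
    by (rule AE_distrD[rotated]) simp
  then show ?thesis by eventually_elim (use N in auto)
qed

text \<open>
  Averaging over the four combinations of reflections does not change an integral. It produces
  pointwise inequalities that fail for the original integrand.
\<close>
lemma integral_reflect_sum4: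
  assumes f: "integrable lborel (\<lambda>(x, y). f x y :: real)"
  shows "integrable lborel (\<lambda>(x, y). f x y + f (hyp_reflect e \<mu> x) y + f x (hyp_reflect e \<mu> y) + f (hyp_reflect e \<mu> x) (hyp_reflect e \<mu> y))"
    and "(\<integral>(x, y). f x y + f (hyp_reflect e \<mu> x) y + f x (hyp_reflect e \<mu> y) + f (hyp_reflect e \<mu> x) (hyp_reflect e \<mu> y) \<partial>lborel) = 4 * (\<integral>(x, y). f x y \<partial>lborel)"
proof -
  note 1 = integrable_reflect_fst[OF f]
  note 2 = integrable_reflect_snd[OF f]
  note 3 = integrable_reflect_snd[OF 1(1)]
  have eq: "(\<lambda>(x, y). f x y + f (hyp_reflect e \<mu> x) y + f x (hyp_reflect e \<mu> y) + f (hyp_reflect e \<mu> x) (hyp_reflect e \<mu> y)) =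
     (\<lambda>p. (\<lambda>(x, y). f x y) p + (\<lambda>(x, y). f (hyp_reflect e \<mu> x) y) p + (\<lambda>(x, y). f x (hyp_reflect e \<mu> y)) p + (\<lambda>(x, y). f (hyp_reflect e \<mu> x) (hyp_reflect e \<mu> y)) p)"
    by (auto simp: fun_eq_iff)
  show "integrable lborel (\<lambda>(x, y). f x y + f (hyp_reflect e \<mu> x) y + f x (hyp_reflect e \<mu> y) + f (hyp_reflect e \<mu> x) (hyp_reflect e \<mu> y))"
    unfolding eq by (intro Bochner_Integration.integrable_add f 1 2 3)
  show "(\<integral>(x, y). f x y + f (hyp_reflect e \<mu> x) y + f x (hyp_reflect e \<mu> y) + f (hyp_reflect e \<mu> x) (hyp_reflect e \<mu> y) \<partial>lborel) = 4 * (\<integral>(x, y). f x y \<partial>lborel)"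
    unfolding eq using f 1 2 3
    by (simp add: Bochner_Integration.integral_add Bochner_Integration.integrable_add)
qed

lemma finite_energy_reflect:
  assumes a: "finite_energy s a"
  shows "finite_energy s (\<lambda>x. a (hyp_reflect e \<mu> x))"
proof -
  have [measurable]: "a \<in> borel_measurable borel" using a finite_energy_measurable by auto
  have "integrable lborel (\<lambda>(x, y). (a x - a y)\<^sup>2 * frac_kernel s (x - y))"
    using a by (simp add: finite_energy_def)
  note integrable_reflect_snd(1)[OF integrable_reflect_fst(1)[OF this]]
  moreover have "frac_kernel s (hyp_reflect e \<mu> x - hyp_reflect e \<mu> y) = frac_kernel s (x - y)" for x y
    by (simp add: frac_kernel_def norm_diff_hyp_reflect[OF e])
  ultimately show ?thesis unfolding finite_energy_def by simp
qed

end

section \<open>Truncation of odd functions\<close>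

text \<open>
  For odd \<open>a\<close> and \<open>b\<close> this is half the sum of the energy density over the four reflections of its two
  variables, by \<open>reflect_sum4_energy\<close>.
\<close>
definition reflected_form :: "real \<Rightarrow> real^'n \<Rightarrow> real \<Rightarrow> (real^'n \<Rightarrow> real) \<Rightarrow> (real^'n \<Rightarrow> real) \<Rightarrow> real^'n \<Rightarrow> real^'n \<Rightarrow> real" where
  "reflected_form s e \<mu> a b x y =
     (a x - a y) * (b x - b y) * frac_kernel s (x - y) + (a x + a y) * (b x + b y) * frac_kernel s (x - hyp_reflect e \<mu> y)"

text \<open>
  Only the odd part of the first argument survives testing against an odd function.
\<close>
lemma reflect_sum4_energy:
  fixes a b :: "real^'n \<Rightarrow> real" and s :: real
  assumes e: "norm e = 1" and b: "\<And>x. b (hyp_reflect e \<mu> x) = - b x"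
  defines "f \<equiv> \<lambda>x y. (a x - a y) * (b x - b y) * frac_kernel s (x - y)"
  defines "R \<equiv> hyp_reflect e \<mu>"
  shows "f x y + f (R x) y + f x (R y) + f (R x) (R y) = reflected_form s e \<mu> (\<lambda>x. a x - a (R x)) b x y"
proof -
  have "frac_kernel s (R x - R y) = frac_kernel s (x - y)" "frac_kernel s (R x - y) = frac_kernel s (x - R y)"
    by (simp_all add: R_def frac_kernel_def norm_diff_hyp_reflect[OF e] norm_diff_hyp_reflect_swap[OF e] hyp_reflect_involution[OF e])
  then show ?thesis
    using b unfolding f_def reflected_form_def R_def[symmetric] by (simp add: algebra_simps)
qed

text \<open>
  For \<open>z\<close> odd under the reflection, this is the odd extension of the positive part of \<open>z\<close> on one side
  of the plane.
\<close>
definition odd_positive_part :: "real^'n \<Rightarrow> real \<Rightarrow> (real^'n \<Rightarrow> real) \<Rightarrow> real^'n \<Rightarrow> real" where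
  "odd_positive_part e \<mu> z x = (if x \<bullet> e \<le> \<mu> then max 0 (z x) else min 0 (z x))"

lemma abs_odd_positive_part_le: "\<bar>odd_positive_part e \<mu> z x\<bar> \<le> \<bar>z x\<bar>"
  by (auto simp: odd_positive_part_def)

text \<open>
  The positive and the negative part of a number have product 0, so the difference of the two sides
  consists of the mixed products only, each with coefficient \<open>k - l\<close>. The alternative \<open>a = b\<close> serves
  the diagonal, where the kernel has been given the value 0.
\<close>
lemma truncation_identity:
  fixes a b k l :: real
  assumes "l \<le> k \<or> a = b"
  shows "(a - b) * (max 0 a - max 0 b) * k + (a + b) * (max 0 a + max 0 b) * l =
     (max 0 a - max 0 b) * (max 0 a - max 0 b) * k + (max 0 a + max 0 b) * (max 0 a + max 0 b) * l
      + ((\<bar>a\<bar> - max 0 a) * max 0 b + (\<bar>b\<bar> - max 0 b) * max 0 a) * \<bar>k - l\<bar>"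
  using assms by (auto simp: max_def algebra_simps abs_if)

context
  fixes s :: real and e :: "real^'n" and \<mu> :: real and z \<phi> :: "real^'n \<Rightarrow> real"
  assumes s: "0 < s" and e: "norm e = 1"
    and odd: "\<And>x. z (hyp_reflect e \<mu> x) = - z x"
  defines "\<phi> \<equiv> odd_positive_part e \<mu> z"
begin

lemma odd_positive_part_odd: "\<phi> (hyp_reflect e \<mu> x) = - \<phi> x"
proof -
  have "z x = 0" if "x \<bullet> e = \<mu>"
  proof -
    have "hyp_reflect e \<mu> x = x" using that by (simp add: hyp_reflect_def)
    then show ?thesis using odd[of x] by simp
  qed
  then show ?thesis
    using hyp_reflect_inner[OF e, of \<mu> x] odd[of x]
    by (auto simp: \<phi>_def odd_positive_part_def max_def min_def)
qed

text \<open>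
  Both sides are invariant under reflecting \<open>x\<close> or \<open>y\<close>, since this exchanges the two kernel values and
  changes the sign of odd functions. Hence both points can be taken on the side \<open>x \<bullet> e \<le> \<mu>\<close>, where
  \<open>truncation_identity\<close> applies.
\<close>
lemma odd_positive_part_reflected_form:
  "reflected_form s e \<mu> z \<phi> x y = reflected_form s e \<mu> \<phi> \<phi> x y
     + ((\<bar>z x\<bar> - \<bar>\<phi> x\<bar>) * \<bar>\<phi> y\<bar> + (\<bar>z y\<bar> - \<bar>\<phi> y\<bar>) * \<bar>\<phi> x\<bar>) * \<bar>frac_kernel s (x - y) - frac_kernel s (x - hyp_reflect e \<mu> y)\<bar>"
  (is "?L x y = ?M x y + ?N x y")
proof -
  have K: "frac_kernel s (hyp_reflect e \<mu> x - hyp_reflect e \<mu> y) = frac_kernel s (x - y)" "frac_kernel s (hyp_reflect e \<mu> x - y) = frac_kernel s (x - hyp_reflect e \<mu> y)"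
    "hyp_reflect e \<mu> (hyp_reflect e \<mu> x) = x" for x y
    by (simp_all add: frac_kernel_def norm_diff_hyp_reflect[OF e] norm_diff_hyp_reflect_swap[OF e] hyp_reflect_involution[OF e])
  have fst: "?L (hyp_reflect e \<mu> x) y = ?L x y" "?M (hyp_reflect e \<mu> x) y = ?M x y" "?N (hyp_reflect e \<mu> x) y = ?N x y" for x y
    unfolding reflected_form_def by (simp_all add: K odd odd_positive_part_odd algebra_simps abs_minus_commute)
  have snd: "?L x (hyp_reflect e \<mu> y) = ?L x y" "?M x (hyp_reflect e \<mu> y) = ?M x y" "?N x (hyp_reflect e \<mu> y) = ?N x y" for x y
    unfolding reflected_form_def by (simp_all add: K odd odd_positive_part_odd algebra_simps abs_minus_commute)
  have main: "?L x y = ?M x y + ?N x y" if x: "x \<bullet> e \<le> \<mu>" and y: "y \<bullet> e \<le> \<mu>" for x y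
  proof -
    have "frac_kernel s (x - hyp_reflect e \<mu> y) \<le> frac_kernel s (x - y) \<or> z x = z y"
    proof (cases "x = y")
      case False
      have "(norm (x - y))\<^sup>2 \<le> (norm (x - hyp_reflect e \<mu> y))\<^sup>2"
        using x y by (simp add: norm_diff_hyp_reflect_sq[OF e])
      then have "norm (x - y) \<le> norm (x - hyp_reflect e \<mu> y)" by (simp add: power2_le_iff_abs_le)
      then show ?thesis using False s by (intro disjI1 frac_kernel_antimono) auto
    qed simp
    from truncation_identity[OF this] show ?thesis
      using x y by (simp add: reflected_form_def \<phi>_def odd_positive_part_def)
  qed
  have half: "hyp_reflect e \<mu> x \<bullet> e \<le> \<mu>" if "\<not> x \<bullet> e \<le> \<mu>" for x
    using that hyp_reflect_inner[OF e, of \<mu> x] by simp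
  show ?thesis
    using main[of x y] main[of "hyp_reflect e \<mu> x" y] main[of x "hyp_reflect e \<mu> y"] main[of "hyp_reflect e \<mu> x" "hyp_reflect e \<mu> y"] half[of x] half[of y]
    unfolding fst snd by blast
qed

lemma reflected_form_nonneg: "0 \<le> reflected_form s e \<mu> a a x y"
  unfolding reflected_form_def by simp

text \<open>
  Expand the nonnegative form of \<open>z - \<phi>\<close> and use that the mixed term is at least the form of \<open>\<phi>\<close>.
\<close>
lemma odd_positive_part_reflected_form_le: "reflected_form s e \<mu> \<phi> \<phi> x y \<le> reflected_form s e \<mu> z z x y"
proof -
  have "0 \<le> reflected_form s e \<mu> (\<lambda>x. z x - \<phi> x) (\<lambda>x. z x - \<phi> x) x y" by (rule reflected_form_nonneg)
  also have "\<dots> = reflected_form s e \<mu> z z x y - 2 * reflected_form s e \<mu> z \<phi> x y + reflected_form s e \<mu> \<phi> \<phi> x y"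
    by (simp add: reflected_form_def algebra_simps)
  moreover have "reflected_form s e \<mu> \<phi> \<phi> x y \<le> reflected_form s e \<mu> z \<phi> x y"
    unfolding odd_positive_part_reflected_form using abs_odd_positive_part_le[of e \<mu> z] by (simp add: \<phi>_def)
  ultimately show ?thesis by linarith
qed

lemma measurable_odd_positive_part:
  assumes [measurable]: "z \<in> borel_measurable borel"
  shows "\<phi> \<in> borel_measurable borel"
  unfolding \<phi>_def odd_positive_part_def by measurable

end

lemma nn_integral_reflect_sum4:
  fixes f :: "real^'n \<Rightarrow> real^'n \<Rightarrow> ennreal"
  assumes e: "norm e = 1" and f[measurable]: "(\<lambda>(x, y). f x y) \<in> borel_measurable borel"
  shows "(\<integral>\<^sup>+(x, y). f x y + f (hyp_reflect e \<mu> x) y + f x (hyp_reflect e \<mu> y) + f (hyp_reflect e \<mu> x) (hyp_reflect e \<mu> y) \<partial>lborel)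
    = 4 * (\<integral>\<^sup>+(x, y). f x y \<partial>lborel)"
proof -
  let ?R = "hyp_reflect e \<mu>"
  have four: "4 * a = a + (a + (a + a))" for a :: ennreal
  proof -
    have "(4::ennreal) = 1 + (1 + (1 + 1))" by simp
    then show ?thesis by (simp only: distrib_right mult_1)
  qed
  have R: "distr lborel borel ?R = lborel" by (rule lborel_distr_hyp_reflect[OF e])
  have fst: "(\<lambda>(x, y). h (?R x) y) \<in> borel_measurable borel" "(\<integral>\<^sup>+(x, y). h (?R x) y \<partial>lborel) = (\<integral>\<^sup>+(x, y). h x y \<partial>lborel)"
    if h: "(\<lambda>(x, y). h x y) \<in> borel_measurable borel" for h :: "real^'n \<Rightarrow> real^'n \<Rightarrow> ennreal"
    using measure_preserving_nn_integral[OF measurable_map_fst lborel_pair_distr_fst[OF _ R] h]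
      measurable_compose[OF measurable_map_fst h, of ?R]
    by (simp_all add: case_prod_unfold)
  have snd: "(\<lambda>(x, y). h x (?R y)) \<in> borel_measurable borel" "(\<integral>\<^sup>+(x, y). h x (?R y) \<partial>lborel) = (\<integral>\<^sup>+(x, y). h x y \<partial>lborel)"
    if h: "(\<lambda>(x, y). h x y) \<in> borel_measurable borel" for h :: "real^'n \<Rightarrow> real^'n \<Rightarrow> ennreal"
    using measure_preserving_nn_integral[OF measurable_map_snd lborel_pair_distr_snd[OF _ R] h]
      measurable_compose[OF measurable_map_snd h, of ?R]
    by (simp_all add: case_prod_unfold)
  note m1[measurable] = fst(1)[OF f]
  note m2[measurable] = snd(1)[OF f]
  note m3[measurable] = snd(1)[OF m1]
  have "(\<integral>\<^sup>+(x, y). f x y + f (?R x) y + f x (?R y) + f (?R x) (?R y) \<partial>lborel)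
     = (\<integral>\<^sup>+p. (\<lambda>(x, y). f x y) p + (\<lambda>(x, y). f (?R x) y) p + (\<lambda>(x, y). f x (?R y)) p + (\<lambda>(x, y). f (?R x) (?R y)) p \<partial>lborel)"
    by (intro nn_integral_cong) auto
  also have "\<dots> = 4 * (\<integral>\<^sup>+(x, y). f x y \<partial>lborel)"
    using fst(2)[OF f] snd(2)[OF f] snd(2)[OF m1]
    by (simp add: nn_integral_add four add.assoc)
  finally show ?thesis .
qed

text \<open>
  For \<open>s \<ge> 1/2\<close> functions of finite energy cannot in general be cut off at a hyperplane. Here the oddness of
  the function saves the argument, through the averaged inequality \<open>odd_positive_part_reflected_form_le\<close>.
\<close>
lemma finite_energy_odd_positive_part:
  fixes U :: "real^'n \<Rightarrow> real" and \<mu> :: real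
  assumes s: "0 < s" and e: "norm e = 1" and U: "finite_energy s U"
  defines "z \<equiv> \<lambda>x. U x - U (hyp_reflect e \<mu> x)"
  shows "finite_energy s (odd_positive_part e \<mu> z)"
proof -
  let ?R = "hyp_reflect e \<mu>" and ?\<phi> = "odd_positive_part e \<mu> z"
  have odd: "z (?R x) = - z x" for x
    by (simp add: z_def hyp_reflect_involution[OF e])
  have z: "finite_energy s z"
    using finite_energy_add[OF U finite_energy_uminus[OF finite_energy_reflect[OF e U]]]
    by (simp add: z_def)
  have zm: "z \<in> borel_measurable borel" and \<phi>m: "?\<phi> \<in> borel_measurable borel"
    using finite_energy_measurable[OF z] measurable_odd_positive_part[where z = z, OF s e odd] by auto
  define H where "H a x y = ennreal ((a x - a y) * (a x - a y) * frac_kernel s (x - y))" for a :: "real^'n \<Rightarrow> real" and x y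
  have Hm: "(\<lambda>(x, y). H a x y) \<in> borel_measurable borel" if "a \<in> borel_measurable borel" for a
    using measurable_energy_integrand[OF that that] unfolding H_def by (simp add: case_prod_unfold)
  have H4: "H a x y + H a (?R x) y + H a x (?R y) + H a (?R x) (?R y) = ennreal (2 * reflected_form s e \<mu> a a x y)"
    if "\<And>x. a (?R x) = - a x" for a x y
  proof -
    have "ennreal (2 * reflected_form s e \<mu> a a x y) = ennreal (reflected_form s e \<mu> (\<lambda>x. a x - a (?R x)) a x y)"
      by (intro arg_cong[where f = ennreal]) (simp add: reflected_form_def that algebra_simps)
    then show ?thesis
      unfolding H_def reflect_sum4_energy[where b = a, OF e that, symmetric]
      by (simp flip: ennreal_plus)
  qed
  have "4 * (\<integral>\<^sup>+(x, y). H ?\<phi> x y \<partial>lborel) \<le> 4 * (\<integral>\<^sup>+(x, y). H z x y \<partial>lborel)"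
    unfolding nn_integral_reflect_sum4[OF e Hm[OF \<phi>m], of \<mu>, symmetric] nn_integral_reflect_sum4[OF e Hm[OF zm], of \<mu>, symmetric]
    by (intro nn_integral_mono)
       (auto simp: H4[of z, OF odd] H4[of ?\<phi>, OF odd_positive_part_odd[where z = z, OF s e odd]] intro!: ennreal_leI odd_positive_part_reflected_form_le s e odd)
  moreover have "(\<integral>\<^sup>+(x, y). H z x y \<partial>lborel) = (\<integral>\<^sup>+p. ennreal (norm ((\<lambda>(x, y). (z x - z y)\<^sup>2 * frac_kernel s (x - y)) p)) \<partial>lborel)"
    by (intro nn_integral_cong) (auto simp: H_def power2_eq_square abs_mult)
  then have "(\<integral>\<^sup>+(x, y). H z x y \<partial>lborel) < \<infinity>"
    using z unfolding finite_energy_def integrable_iff_bounded by auto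
  then have "4 * (\<integral>\<^sup>+(x, y). H z x y \<partial>lborel) < \<infinity>"
    by (simp add: ennreal_mult_less_top)
  ultimately have "4 * (\<integral>\<^sup>+(x, y). H ?\<phi> x y \<partial>lborel) < \<infinity>"
    by (rule order.strict_trans1)
  then have "(\<integral>\<^sup>+(x, y). H ?\<phi> x y \<partial>lborel) < \<infinity>"
    by (auto simp: ennreal_mult_less_top)
  moreover have "(\<integral>\<^sup>+(x, y). H ?\<phi> x y \<partial>lborel) = (\<integral>\<^sup>+p. ennreal (norm ((\<lambda>(x, y). (?\<phi> x - ?\<phi> y)\<^sup>2 * frac_kernel s (x - y)) p)) \<partial>lborel)"
    by (intro nn_integral_cong) (auto simp: H_def power2_eq_square abs_mult)
  ultimately show ?thesis
    using measurable_energy_integrand[OF \<phi>m \<phi>m] \<phi>m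
    unfolding finite_energy_def integrable_iff_bounded by (simp add: power2_eq_square)
qed

text \<open>
  The function \<open>Z\<close> is any minorant of the surplus in \<open>odd_positive_part_reflected_form\<close>. With \<open>Z = 0\<close> one
  gets the estimate for small overlaps; the strong maximum principle uses the term with \<open>Z\<close>.
\<close>
lemma energy_odd_positive_part_ge:
  fixes U :: "real^'n \<Rightarrow> real" and \<mu> :: real and Z :: "real^'n \<Rightarrow> real^'n \<Rightarrow> real"
  assumes s: "0 < s" and e: "norm e = 1" and U: "finite_energy s U"
  defines "z \<equiv> \<lambda>x. U x - U (hyp_reflect e \<mu> x)"
  defines "\<phi> \<equiv> odd_positive_part e \<mu> z"
  assumes Z: "integrable lborel (\<lambda>(x, y). Z x y)"
    and le: "\<And>x y. Z x y \<le> ((\<bar>z x\<bar> - \<bar>\<phi> x\<bar>) * \<bar>\<phi> y\<bar> + (\<bar>z y\<bar> - \<bar>\<phi> y\<bar>) * \<bar>\<phi> x\<bar>)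
                  * \<bar>frac_kernel s (x - y) - frac_kernel s (x - hyp_reflect e \<mu> y)\<bar>"
  shows "energy s U \<phi> \<ge> energy s \<phi> \<phi> / 2 + (\<integral>(x, y). Z x y \<partial>lborel) / 4"
proof -
  let ?R = "hyp_reflect e \<mu>"
  have odd: "z (?R x) = - z x" for x
    by (simp add: z_def hyp_reflect_involution[OF e])
  have \<phi>: "finite_energy s \<phi>"
    unfolding \<phi>_def z_def by (rule finite_energy_odd_positive_part[OF s e U])
  have \<phi>odd: "\<phi> (?R x) = - \<phi> x" for x
    unfolding \<phi>_def by (rule odd_positive_part_odd[where z = z, OF s e odd])
  note U4 = integral_reflect_sum4[OF e integrable_energy_cross[OF U \<phi>], of \<mu>,
      unfolded reflect_sum4_energy[where b = \<phi>, OF e \<phi>odd]]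
  note \<phi>4 = integral_reflect_sum4[OF e integrable_energy_cross[OF \<phi> \<phi>], of \<mu>,
      unfolded reflect_sum4_energy[where b = \<phi>, OF e \<phi>odd]]
  have double: "reflected_form s e \<mu> (\<lambda>x. \<phi> x - \<phi> (?R x)) \<phi> x y = 2 * reflected_form s e \<mu> \<phi> \<phi> x y" for x y
    by (simp add: reflected_form_def \<phi>odd algebra_simps)
  have "4 * energy s U \<phi> = (\<integral>p. (\<lambda>(x, y). reflected_form s e \<mu> z \<phi> x y) p \<partial>lborel)"
    using U4(2) by (simp add: energy_def z_def)
  also have "\<dots> \<ge> (\<integral>p. (1/2) * (\<lambda>(x, y). 2 * reflected_form s e \<mu> \<phi> \<phi> x y) p + (\<lambda>(x, y). Z x y) p \<partial>lborel)"
  proof (rule integral_mono)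
    show "integrable lborel (\<lambda>p. (1/2) * (\<lambda>(x, y). 2 * reflected_form s e \<mu> \<phi> \<phi> x y) p + (\<lambda>(x, y). Z x y) p)"
      using \<phi>4(1) Z by (intro Bochner_Integration.integrable_add) (auto simp: double)
    show "integrable lborel (\<lambda>(x, y). reflected_form s e \<mu> z \<phi> x y)"
      using U4(1) by (simp add: z_def)
    show "(1/2) * (\<lambda>(x, y). 2 * reflected_form s e \<mu> \<phi> \<phi> x y) p + (\<lambda>(x, y). Z x y) p \<le> (\<lambda>(x, y). reflected_form s e \<mu> z \<phi> x y) p" for p
      using le by (cases p) (simp add: odd_positive_part_reflected_form[where z = z, OF s e odd, folded \<phi>_def])
  qed
  also have "(\<integral>p. (1/2) * (\<lambda>(x, y). 2 * reflected_form s e \<mu> \<phi> \<phi> x y) p + (\<lambda>(x, y). Z x y) p \<partial>lborel)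
      = (1/2) * (\<integral>(x, y). 2 * reflected_form s e \<mu> \<phi> \<phi> x y \<partial>lborel) + (\<integral>(x, y). Z x y \<partial>lborel)"
    using \<phi>4(1) Z by (subst Bochner_Integration.integral_add) (auto simp: double)
  also have "(\<integral>(x, y). 2 * reflected_form s e \<mu> \<phi> \<phi> x y \<partial>lborel) = 4 * energy s \<phi> \<phi>"
    using \<phi>4(2) by (simp add: double energy_def)
  finally show ?thesis by simp
qed

section \<open>Coercivity and second differences\<close>

text \<open>
  Keep only the pairs \<open>(x, y)\<close> with \<open>\<phi> y = 0\<close> in the energy of \<open>\<phi>\<close>.
\<close>
lemma energy_ge_small_support:
  fixes \<phi> :: "real^'n \<Rightarrow> real"
  assumes \<phi>: "finite_energy s \<phi>" and C: "0 < C"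
    and mass: "\<And>x. ennreal C \<le> (\<integral>\<^sup>+y. indicator (- {y. \<phi> y \<noteq> 0}) y * ennreal (frac_kernel s (x - y)) \<partial>lborel)"
    and int: "integrable lborel (\<lambda>x. (\<phi> x)\<^sup>2)"
  shows "C * (\<integral>x. (\<phi> x)\<^sup>2 \<partial>lborel) \<le> energy s \<phi> \<phi>"
proof -
  have [measurable]: "\<phi> \<in> borel_measurable borel" using \<phi> finite_energy_measurable by auto
  have "ennreal (C * (\<integral>x. (\<phi> x)\<^sup>2 \<partial>lborel)) = (\<integral>\<^sup>+x. ennreal ((\<phi> x)\<^sup>2) * ennreal C \<partial>lborel)"
    using C int by (subst nn_integral_multc) (auto simp: nn_integral_eq_integral ennreal_mult' mult.commute)
  also have "\<dots> \<le> (\<integral>\<^sup>+x. ennreal ((\<phi> x)\<^sup>2) * (\<integral>\<^sup>+y. indicator (- {y. \<phi> y \<noteq> 0}) y * ennreal (frac_kernel s (x - y)) \<partial>lborel) \<partial>lborel)"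
    by (intro nn_integral_mono mult_left_mono mass) auto
  also have "\<dots> = (\<integral>\<^sup>+x. \<integral>\<^sup>+y. ennreal ((\<phi> x)\<^sup>2) * (indicator (- {y. \<phi> y \<noteq> 0}) y * ennreal (frac_kernel s (x - y))) \<partial>lborel \<partial>lborel)"
    by (simp add: nn_integral_cmult)
  also have "\<dots> \<le> (\<integral>\<^sup>+x. \<integral>\<^sup>+y. ennreal ((\<phi> x - \<phi> y) * (\<phi> x - \<phi> y) * frac_kernel s (x - y)) \<partial>lborel \<partial>lborel)"
    by (intro nn_integral_mono) (auto split: split_indicator simp: power2_eq_square simp flip: ennreal_mult)
  also have "\<dots> = (\<integral>\<^sup>+p. ennreal ((\<lambda>(x, y). (\<phi> x - \<phi> y) * (\<phi> x - \<phi> y) * frac_kernel s (x - y)) p) \<partial>(lborel \<Otimes>\<^sub>M lborel))"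
    by (subst lborel.nn_integral_fst[symmetric]) auto
  also have "\<dots> = ennreal (energy s \<phi> \<phi>)"
    unfolding energy_def lborel_prod using integrable_energy_cross[OF \<phi> \<phi>]
    by (subst nn_integral_eq_integral) (auto intro!: AE_I2)
  finally show ?thesis
    by (subst (asm) ennreal_le_iff) (auto simp: energy_def intro!: integral_nonneg_AE AE_I2)
qed

lemma integrable_bounded_support:
  fixes \<phi> :: "'a::euclidean_space \<Rightarrow> real"
  assumes [measurable]: "\<phi> \<in> borel_measurable borel" "S \<in> sets borel" and "bounded S"
    and bdd: "\<And>x. \<bar>\<phi> x\<bar> \<le> B" and supp: "\<And>x. x \<notin> S \<Longrightarrow> \<phi> x = 0"
  shows "integrable lborel \<phi>"
proof (rule Bochner_Integration.integrable_bound)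
  show "integrable lborel (\<lambda>x. B * indicat_real S x)"
    using emeasure_bounded_finite[OF \<open>bounded S\<close>] by (intro integrable_mult_right integrable_real_indicator) (auto simp: less_top)
  show "AE x in lborel. norm (\<phi> x) \<le> norm (B * indicat_real S x)"
    using bdd supp by (intro AE_I2) (auto split: split_indicator intro: order_trans[OF _ abs_ge_self])
qed simp

lemma integrable_mult_bounded:
  fixes a b :: "'a \<Rightarrow> real"
  assumes "integrable M a" "b \<in> borel_measurable M" "\<And>x. \<bar>b x\<bar> \<le> B"
  shows "integrable M (\<lambda>x. a x * b x)"
proof (rule Bochner_Integration.integrable_bound)
  show "integrable M (\<lambda>x. B * a x)" using assms by simp
  show "AE x in M. norm (a x * b x) \<le> norm (B * a x)"
  proof (rule AE_I2)
    fix x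
    have "\<bar>a x\<bar> * \<bar>b x\<bar> \<le> \<bar>a x\<bar> * \<bar>B\<bar>" using assms(3)[of x] by (intro mult_left_mono) auto
    then show "norm (a x * b x) \<le> norm (B * a x)" by (simp add: abs_mult mult.commute)
  qed
qed (use assms in auto)

text \<open>
  For fixed \<open>t = y - x\<close>, translation invariance moves both differences onto \<open>h\<close>, which gives
  \<open>\<phi> x * (2 * h x - h (x + t) - h (x - t))\<close>. In this way second differences of \<open>h\<close> are used without a principal value;
  a first difference would not be integrable against the kernel if \<open>s \<ge> 1/2\<close>.
\<close>
lemma energy_le_second_difference:
  fixes h \<phi> :: "real^'n \<Rightarrow> real" and m :: "real^'n \<Rightarrow> real"
  assumes h: "finite_energy s h" "integrable lborel h" and \<phi>: "finite_energy s \<phi>" "integrable lborel \<phi>"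
    and bdd: "\<And>x. \<bar>\<phi> x\<bar> \<le> B"
    and m: "integrable lborel (\<lambda>t. m t * frac_kernel s t)"
    and le: "\<And>x t. \<phi> x * (2 * h x - h (x + t) - h (x - t)) \<le> \<bar>\<phi> x\<bar> * m t"
  shows "energy s h \<phi> \<le> (\<integral>x. \<bar>\<phi> x\<bar> \<partial>lborel) * (\<integral>t. m t * frac_kernel s t \<partial>lborel)"
proof -
  have [measurable]: "\<phi> \<in> borel_measurable borel" "h \<in> borel_measurable borel"
    using h \<phi> finite_energy_measurable by auto
  let ?G = "\<lambda>(x, t). (h x - h (x + t)) * (\<phi> x - \<phi> (x + t)) * frac_kernel s t"
  have shear: "integrable lborel ?G" "energy s h \<phi> = (\<integral>p. ?G p \<partial>lborel)"
    using measure_preserving_integral[OF measurable_map_shear lborel_pair_distr_shear integrable_energy_cross[OF h(1) \<phi>(1)]]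
    by (simp_all add: case_prod_unfold energy_def)
  have G: "integrable (lborel \<Otimes>\<^sub>M lborel) ?G" using shear(1) by (simp only: lborel_prod)
  have tr: "integrable lborel (\<lambda>x. a (x + t)) \<and> (\<integral>x. a (x + t) \<partial>lborel) = (\<integral>x. a x \<partial>lborel)"
    if "integrable lborel a" for a :: "real^'n \<Rightarrow> real" and t
    using measure_preserving_integral[of "(+) t" a] that by (simp add: lborel_distr_plus add.commute)
  have inner: "(\<integral>x. ?G (x, t) \<partial>lborel) \<le> (\<integral>x. \<bar>\<phi> x\<bar> \<partial>lborel) * (m t * frac_kernel s t)" for t
  proof -
    have i1: "integrable lborel (\<lambda>x. h x * \<phi> x)"
      using integrable_mult_bounded[OF h(2), of \<phi> B] bdd by simp
    have i2: "integrable lborel (\<lambda>x. h (x + t) * \<phi> x)"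
      using integrable_mult_bounded[of lborel "\<lambda>x. h (x + t)" \<phi> B] tr[OF h(2)] bdd by simp
    have i3': "integrable lborel (\<lambda>x. h (x - t) * \<phi> x)"
      using integrable_mult_bounded[of lborel "\<lambda>x. h (x - t)" \<phi> B] tr[OF h(2), of "- t"] bdd by simp
    have i3: "integrable lborel (\<lambda>x. h x * \<phi> (x + t))" "(\<integral>x. h x * \<phi> (x + t) \<partial>lborel) = (\<integral>x. h (x - t) * \<phi> x \<partial>lborel)"
      using tr[OF i3', of t] by simp_all
    have i4: "integrable lborel (\<lambda>x. h (x + t) * \<phi> (x + t))" "(\<integral>x. h (x + t) * \<phi> (x + t) \<partial>lborel) = (\<integral>x. h x * \<phi> x \<partial>lborel)"
      using tr[OF i1, of t] by simp_all
    have "(\<integral>x. (h x - h (x + t)) * (\<phi> x - \<phi> (x + t)) \<partial>lborel)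
        = (\<integral>x. h x * \<phi> x - h (x + t) * \<phi> x - h x * \<phi> (x + t) + h (x + t) * \<phi> (x + t) \<partial>lborel)"
      by (intro Bochner_Integration.integral_cong) (auto simp: algebra_simps)
    also have "\<dots> = (\<integral>x. h x * \<phi> x \<partial>lborel) - (\<integral>x. h (x + t) * \<phi> x \<partial>lborel) - (\<integral>x. h (x - t) * \<phi> x \<partial>lborel) + (\<integral>x. h x * \<phi> x \<partial>lborel)"
      using i1 i2 i3 i4 by simp
    also have "\<dots> = (\<integral>x. 2 * (h x * \<phi> x) - h (x + t) * \<phi> x - h (x - t) * \<phi> x \<partial>lborel)"
      using i1 i2 i3' by simp
    also have "\<dots> \<le> (\<integral>x. \<bar>\<phi> x\<bar> * m t \<partial>lborel)"
    proof (rule integral_mono)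
      show "integrable lborel (\<lambda>x. 2 * (h x * \<phi> x) - h (x + t) * \<phi> x - h (x - t) * \<phi> x)"
        using i1 i2 i3' by simp
      show "integrable lborel (\<lambda>x. \<bar>\<phi> x\<bar> * m t)" using \<phi>(2) by simp
      show "2 * (h x * \<phi> x) - h (x + t) * \<phi> x - h (x - t) * \<phi> x \<le> \<bar>\<phi> x\<bar> * m t" for x
        using le[of x t] by (simp add: algebra_simps)
    qed
    also have "\<dots> = (\<integral>x. \<bar>\<phi> x\<bar> \<partial>lborel) * m t" by simp
    finally have "(\<integral>x. (h x - h (x + t)) * (\<phi> x - \<phi> (x + t)) \<partial>lborel) * frac_kernel s t \<le> (\<integral>x. \<bar>\<phi> x\<bar> \<partial>lborel) * m t * frac_kernel s t"
      by (rule mult_right_mono) simp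
    moreover have "(\<integral>x. ?G (x, t) \<partial>lborel) = (\<integral>x. (h x - h (x + t)) * (\<phi> x - \<phi> (x + t)) \<partial>lborel) * frac_kernel s t"
      by simp
    ultimately show ?thesis by (simp only: mult.assoc)
  qed
  have "energy s h \<phi> = (\<integral>p. (\<lambda>(x, t). ?G (x, t)) p \<partial>(lborel \<Otimes>\<^sub>M lborel))"
    unfolding shear(2) lborel_prod by simp
  also have "\<dots> = (\<integral>t. (\<integral>x. ?G (x, t) \<partial>lborel) \<partial>lborel)"
    using G by (intro lborel_pair.integral_snd[symmetric]) simp
  also have "\<dots> \<le> (\<integral>t. (\<integral>x. \<bar>\<phi> x\<bar> \<partial>lborel) * (m t * frac_kernel s t) \<partial>lborel)"
    using lborel_pair.integrable_snd[of "\<lambda>x t. ?G (x, t)"] G m inner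
    by (intro integral_mono) auto
  finally show ?thesis by simp
qed

section \<open>Quadratic bumps\<close>

text \<open>
  A truncated paraboloid. It is not differentiable at the edge of its support, but as a maximum of
  functions with second derivatives bounded below it satisfies the one-sided estimate
  \<open>bump_second_difference\<close>. This is the right direction at points where the test function is positive.
\<close>
definition bump :: "real^'n \<Rightarrow> real \<Rightarrow> real^'n \<Rightarrow> real" where
  "bump p r x = max 0 (1 - (norm (x - p))\<^sup>2 / r\<^sup>2)"

lemma bump_nonneg [simp]: "0 \<le> bump p r x"
  by (simp add: bump_def)

lemma bump_le_1: "bump p r x \<le> 1"
  by (simp add: bump_def)

lemma bump_center [simp]: "bump p r p = 1"
  by (simp add: bump_def)

lemma bump_eq_0:
  assumes "0 < r" "r \<le> norm (x - p)"
  shows "bump p r x = 0"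
proof -
  have "r\<^sup>2 \<le> (norm (x - p))\<^sup>2" using assms by (intro power_mono) auto
  then show ?thesis using assms by (simp add: bump_def)
qed

lemma measurable_bump [measurable]: "bump p r \<in> borel_measurable borel"
  unfolding bump_def by measurable

lemma continuous_on_bump: "continuous_on S (bump p r)"
proof (cases "r = 0")
  case True
  then show ?thesis by (simp add: bump_def)
next
  case False
  then show ?thesis unfolding bump_def by (intro continuous_intros) auto
qed

lemma integrable_bump:
  assumes "0 < r"
  shows "integrable lborel (bump p r)"
proof (rule Bochner_Integration.integrable_bound)
  show "integrable lborel (indicat_real (ball p r))"
    using emeasure_lborel_ball_finite[of p r] by (intro integrable_real_indicator) auto
  show "AE x in lborel. norm (bump p r x) \<le> norm (indicat_real (ball p r) x)"
    using bump_le_1 bump_eq_0[OF assms, of _ p] by (intro AE_I2) (auto split: split_indicator simp: dist_norm norm_minus_commute not_less)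
qed auto

lemma bump_second_difference:
  assumes "0 < r"
  shows "2 * bump p r x - bump p r (x + t) - bump p r (x - t) \<le> 2 * min 1 ((norm t)\<^sup>2 / r\<^sup>2)"
proof -
  have "2 * bump p r x - bump p r (x + t) - bump p r (x - t) \<le> 2 * ((norm t)\<^sup>2 / r\<^sup>2)"
  proof (cases "bump p r x = 0")
    case True
    then show ?thesis using bump_nonneg[of p r "x + t"] bump_nonneg[of p r "x - t"]
      by (smt (verit) divide_nonneg_nonneg zero_le_power2)
  next
    case False
    have par: "(norm (x + t - p))\<^sup>2 + (norm (x - t - p))\<^sup>2 = 2 * (norm (x - p))\<^sup>2 + 2 * (norm t)\<^sup>2"
      unfolding power2_norm_eq_inner
      by (simp add: inner_add_left inner_add_right inner_diff_left inner_diff_right inner_commute algebra_simps)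
    have "1 - (norm (x + t - p))\<^sup>2 / r\<^sup>2 \<le> bump p r (x + t)" "1 - (norm (x - t - p))\<^sup>2 / r\<^sup>2 \<le> bump p r (x - t)"
      by (simp_all add: bump_def)
    moreover have "bump p r x = 1 - (norm (x - p))\<^sup>2 / r\<^sup>2"
      using False by (simp add: bump_def max_def split: if_splits)
    ultimately have "2 * bump p r x - bump p r (x + t) - bump p r (x - t)
        \<le> ((norm (x + t - p))\<^sup>2 + (norm (x - t - p))\<^sup>2 - 2 * (norm (x - p))\<^sup>2) / r\<^sup>2"
      by (simp add: add_divide_distrib diff_divide_distrib)
    then show ?thesis by (simp add: par)
  qed
  moreover have "2 * bump p r x - bump p r (x + t) - bump p r (x - t) \<le> 2"
    using bump_le_1[of p r x] bump_nonneg[of p r "x + t"] bump_nonneg[of p r "x - t"] by linarith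
  ultimately show ?thesis by (simp add: min_def)
qed

text \<open>
  Replaces \<open>bump_second_difference\<close> at the points where the test function is negative. These lie far
  away from \<open>p\<close>, and a translate by \<open>t\<close> reaches the support only if \<open>|t| \<ge> r\<close>.
\<close>
lemma bump_far:
  assumes "0 < r" "2 * r \<le> norm (x - p)"
  shows "bump p r (x + t) \<le> min 1 ((norm t)\<^sup>2 / r\<^sup>2)"
proof (cases "r \<le> norm (x + t - p)")
  case True
  then have "bump p r (x + t) = 0" using bump_eq_0[OF assms(1), of "x + t" p] by simp
  then show ?thesis by simp
next
  case False
  have "norm (x - p) \<le> norm (x + t - p) + norm t"
    using norm_triangle_ineq4[of "x + t - p" t] by (simp add: algebra_simps)
  then have "r \<le> norm t" using False assms by linarith
  then have "r\<^sup>2 \<le> (norm t)\<^sup>2" using assms by (intro power_mono) auto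
  then show ?thesis using bump_le_1 assms by (simp add: min_def)
qed

lemma bump_lipschitz:
  assumes "0 < r"
  shows "\<bar>bump p r x - bump p r y\<bar> \<le> 2 / r * norm (x - y)"
proof -
  define \<rho> where "\<rho> z = min r (norm (z - p))" for z
  have b: "bump p r z = 1 - (\<rho> z)\<^sup>2 / r\<^sup>2" for z
  proof (cases "r \<le> norm (z - p)")
    case True
    then show ?thesis using assms bump_eq_0[OF assms True] by (simp add: \<rho>_def)
  next
    case False
    then have "(norm (z - p))\<^sup>2 \<le> r\<^sup>2" by (intro power_mono) auto
    then show ?thesis using False assms by (simp add: \<rho>_def bump_def)
  qed
  have rho: "0 \<le> \<rho> z" "\<rho> z \<le> r" for z using assms by (auto simp: \<rho>_def)
  have "\<bar>norm (x - p) - norm (y - p)\<bar> \<le> norm (x - y)"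
    using norm_triangle_ineq3[of "x - p" "y - p"] by simp
  then have lip: "\<bar>\<rho> x - \<rho> y\<bar> \<le> norm (x - y)"
    unfolding \<rho>_def min_def by (auto split: if_splits)
  have "bump p r x - bump p r y = (\<rho> y - \<rho> x) * (\<rho> x + \<rho> y) / r\<^sup>2"
    unfolding b by (simp add: power2_eq_square algebra_simps flip: diff_divide_distrib add_divide_distrib)
  then have "\<bar>bump p r x - bump p r y\<bar> = \<bar>\<rho> x - \<rho> y\<bar> * (\<rho> x + \<rho> y) / r\<^sup>2"
    using rho[of x] rho[of y] by (simp add: abs_mult abs_minus_commute)
  also have "\<dots> \<le> norm (x - y) * (2 * r) / r\<^sup>2"
    using rho[of x] rho[of y] lip by (intro divide_right_mono mult_mono) auto
  also have "\<dots> = 2 / r * norm (x - y)"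
    using assms by (simp add: power2_eq_square)
  finally show ?thesis .
qed

lemma integrable_frac_kernel_min_scaled:
  fixes s r :: real
  assumes s: "0 < s" "s < 1" and r: "0 < r"
  shows "integrable lborel (\<lambda>t::real^'n. min 1 ((norm t)\<^sup>2 / r\<^sup>2) * frac_kernel s t)"
proof (rule Bochner_Integration.integrable_bound)
  show "integrable lborel (\<lambda>t::real^'n. max 1 (1 / r\<^sup>2) * (min 1 ((norm t)\<^sup>2) * frac_kernel s t))"
    by (intro integrable_mult_right integrable_frac_kernel_min s)
  have "min 1 (q / r\<^sup>2) \<le> max 1 (1 / r\<^sup>2) * min 1 q" if "0 \<le> q" for q :: real
  proof (cases "q \<le> 1")
    case True
    have "min 1 (q / r\<^sup>2) \<le> 1 / r\<^sup>2 * q" by simp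
    also have "\<dots> \<le> max 1 (1 / r\<^sup>2) * q" using that by (intro mult_right_mono) auto
    finally show ?thesis using True by simp
  qed auto
  then show "AE t::real^'n in lborel. norm (min 1 ((norm t)\<^sup>2 / r\<^sup>2) * frac_kernel s t) \<le> norm (max 1 (1 / r\<^sup>2) * (min 1 ((norm t)\<^sup>2) * frac_kernel s t))"
    by (auto simp: abs_mult mult.assoc[symmetric] intro!: AE_I2 mult_right_mono)
qed simp

lemma integrable_pair_convolution:
  fixes m :: "real^'n \<Rightarrow> real"
  assumes A: "A \<in> sets borel" "emeasure lborel A < \<infinity>" and m: "integrable lborel m" and even: "\<And>t. m (- t) = m t"
  shows "integrable lborel (\<lambda>(x, y). indicat_real A x * m (x - y))"
    and "integrable lborel (\<lambda>(x, y). indicat_real A y * m (x - y))"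
proof -
  have [measurable]: "m \<in> borel_measurable borel" using m borel_measurable_integrable by auto
  note A(1)[measurable]
  have even': "m (x - y) = m (y - x)" for x y using even[of "x - y"] by simp
  have tr: "integrable lborel (\<lambda>y. a (x - y))" "(\<integral>y. a (x - y) \<partial>lborel) = (\<integral>y. a y \<partial>lborel)"
    if "integrable lborel a" "\<And>t. a (- t) = a t" for a :: "real^'n \<Rightarrow> real" and x
  proof -
    have "a (x - y) = a (y - x)" for y using that(2)[of "x - y"] by simp
    then show "integrable lborel (\<lambda>y. a (x - y))" "(\<integral>y. a (x - y) \<partial>lborel) = (\<integral>y. a y \<partial>lborel)"
      using measure_preserving_integral[of "(+) (- x)" a] that(1) by (simp_all add: lborel_distr_plus)
  qed
  have *: "integrable (lborel \<Otimes>\<^sub>M lborel) (\<lambda>(x, y). indicat_real A x * m (x - y))"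
  proof (rule lborel_pair.Fubini_integrable)
    have "integrable lborel (\<lambda>x. indicat_real A x * (\<integral>t. \<bar>m t\<bar> \<partial>lborel))"
      using A by (intro integrable_mult_left integrable_real_indicator) auto
    moreover have "(\<integral>y. \<bar>m (x - y)\<bar> \<partial>lborel) = (\<integral>t. \<bar>m t\<bar> \<partial>lborel)" for x
      using tr(2)[of "\<lambda>t. \<bar>m t\<bar>" x] m even by simp
    ultimately show "integrable lborel (\<lambda>x. \<integral>y. norm ((\<lambda>(x, y). indicat_real A x * m (x - y)) (x, y)) \<partial>lborel)"
      by (simp add: abs_mult)
    show "AE x in lborel. integrable lborel (\<lambda>y. (\<lambda>(x, y). indicat_real A x * m (x - y)) (x, y))"
      using tr(1)[OF m even] by (intro AE_I2) simp
  qed simp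
  then show "integrable lborel (\<lambda>(x, y). indicat_real A x * m (x - y))" by (simp only: lborel_prod)
  have "integrable (lborel \<Otimes>\<^sub>M lborel) (\<lambda>(x, y). (\<lambda>(x, y). indicat_real A x * m (x - y)) (y, x))"
    using lborel_pair.integrable_product_swap[OF *] by simp
  then show "integrable lborel (\<lambda>(x, y). indicat_real A y * m (x - y))"
    unfolding lborel_prod by (simp add: even' case_prod_unfold)
qed

text \<open>
  Lipschitz continuity makes the squared difference at most \<open>min 1 (|x - y|\<^sup>2 / (r/2)\<^sup>2)\<close>, and it vanishes
  unless one of the points is in the ball.
\<close>
lemma finite_energy_bump:
  assumes s: "0 < s" "s < 1" and r: "0 < r"
  shows "finite_energy s (bump p r)"
  unfolding finite_energy_def
proof
  let ?m = "\<lambda>t::real^'n. min 1 ((norm t)\<^sup>2 / (r/2)\<^sup>2) * frac_kernel s t"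
  have m: "integrable lborel ?m" using integrable_frac_kernel_min_scaled[OF s, of "r/2"] r by simp
  have B: "ball p r \<in> sets borel" "emeasure lborel (ball p r) < \<infinity>"
    using emeasure_lborel_ball_finite by auto
  show "integrable lborel (\<lambda>(x, y). (bump p r x - bump p r y)\<^sup>2 * frac_kernel s (x - y))"
  proof (rule Bochner_Integration.integrable_bound)
    show "integrable lborel (\<lambda>z. (\<lambda>(x, y). indicat_real (ball p r) x * ?m (x - y)) z + (\<lambda>(x, y). indicat_real (ball p r) y * ?m (x - y)) z)"
      using integrable_pair_convolution[OF B m] by simp
    have "(bump p r x - bump p r y)\<^sup>2 \<le> (indicat_real (ball p r) x + indicat_real (ball p r) y) * min 1 ((norm (x - y))\<^sup>2 / (r/2)\<^sup>2)" for x y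
    proof (cases "x \<in> ball p r \<or> y \<in> ball p r")
      case True
      have "\<bar>bump p r x - bump p r y\<bar> \<le> 1"
        using bump_le_1[of p r x] bump_le_1[of p r y] bump_nonneg[of p r x] bump_nonneg[of p r y] by linarith
      then have 1: "(bump p r x - bump p r y)\<^sup>2 \<le> 1" by (simp add: abs_square_le_1)
      have "\<bar>bump p r x - bump p r y\<bar>\<^sup>2 \<le> (2 / r * norm (x - y))\<^sup>2"
        using bump_lipschitz[OF r] by (intro power_mono) auto
      then have "(bump p r x - bump p r y)\<^sup>2 \<le> min 1 ((norm (x - y))\<^sup>2 / (r/2)\<^sup>2)"
        using 1 r by (simp add: power_mult_distrib power_divide mult.commute)
      also have "\<dots> \<le> (indicat_real (ball p r) x + indicat_real (ball p r) y) * min 1 ((norm (x - y))\<^sup>2 / (r/2)\<^sup>2)"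
        using True mult_right_mono[of 1 "indicat_real (ball p r) x + indicat_real (ball p r) y" "min 1 ((norm (x - y))\<^sup>2 / (r/2)\<^sup>2)"]
        by (auto split: split_indicator)
      finally show ?thesis .
    next
      case False
      then show ?thesis using bump_eq_0[OF r, of x p] bump_eq_0[OF r, of y p]
        by (simp add: dist_norm norm_minus_commute)
    qed
    then have "(bump p r x - bump p r y)\<^sup>2 * frac_kernel s (x - y) \<le> (indicat_real (ball p r) x + indicat_real (ball p r) y) * min 1 ((norm (x - y))\<^sup>2 / (r/2)\<^sup>2) * frac_kernel s (x - y)" for x y
      by (intro mult_right_mono) auto
    then show "AE z in lborel. norm ((\<lambda>(x, y). (bump p r x - bump p r y)\<^sup>2 * frac_kernel s (x - y)) z)
       \<le> norm ((\<lambda>(x, y). indicat_real (ball p r) x * ?m (x - y)) z + (\<lambda>(x, y). indicat_real (ball p r) y * ?m (x - y)) z)"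
      by (intro AE_I2) (auto simp: abs_mult distrib_right mult.assoc intro: order_trans[OF _ abs_ge_self])
    show "(\<lambda>(x, y). (bump p r x - bump p r y)\<^sup>2 * frac_kernel s (x - y)) \<in> borel_measurable lborel"
      using measurable_energy_integrand[of "bump p r" "bump p r" s] by (simp add: power2_eq_square)
  qed
qed simp

section \<open>The abstract moving plane problem\<close>

text \<open>
  The reflection moves \<open>y\<close> strictly away from every \<open>x\<close> on the same side, and the sets are compact.
\<close>
lemma kernel_gap:
  fixes A B :: "(real^'n) set"
  assumes s: "0 < s" and e: "norm e = 1" and A: "compact A" "A \<noteq> {}" "\<And>x. x \<in> A \<Longrightarrow> x \<bullet> e < \<mu>"
    and B: "compact B" "B \<noteq> {}" "\<And>x. x \<in> B \<Longrightarrow> x \<bullet> e < \<mu>" and disj: "A \<inter> B = {}"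
  obtains \<kappa> where "0 < \<kappa>"
    "\<And>x y. x \<in> A \<Longrightarrow> y \<in> B \<Longrightarrow> \<kappa> \<le> frac_kernel s (x - y) - frac_kernel s (x - hyp_reflect e \<mu> y)"
proof -
  let ?f = "\<lambda>p::(real^'n) \<times> (real^'n). frac_kernel s (fst p - snd p) - frac_kernel s (fst p - hyp_reflect e \<mu> (snd p))"
  have ne: "fst p - snd p \<noteq> 0" "fst p - hyp_reflect e \<mu> (snd p) \<noteq> 0" if "p \<in> A \<times> B" for p
  proof -
    show "fst p - snd p \<noteq> 0" using that disj by auto
    have "fst p \<bullet> e < \<mu>" "hyp_reflect e \<mu> (snd p) \<bullet> e > \<mu>"
      using that A(3) B(3) by (auto simp: hyp_reflect_inner[OF e])
    then show "fst p - hyp_reflect e \<mu> (snd p) \<noteq> 0" by auto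
  qed
  have cont: "continuous_on (A \<times> B) ?f"
    unfolding frac_kernel_def using ne by (intro continuous_intros) auto
  have "A \<times> B \<noteq> {}" using A(2) B(2) by auto
  then obtain p where p: "p \<in> A \<times> B" "\<And>q. q \<in> A \<times> B \<Longrightarrow> ?f p \<le> ?f q"
    using continuous_attains_inf[OF compact_Times[OF A(1) B(1)] _ cont] by blast
  show thesis
  proof
    obtain x y where xy: "p = (x, y)" "x \<in> A" "y \<in> B" using p by auto
    have "0 < 4 * (\<mu> - x \<bullet> e) * (\<mu> - y \<bullet> e)" using A(3) B(3) xy by (intro mult_pos_pos) auto
    then have "(norm (x - y))\<^sup>2 < (norm (x - hyp_reflect e \<mu> y))\<^sup>2"
      unfolding norm_diff_hyp_reflect_sq[OF e] by linarith
    then have lt: "norm (x - y) < norm (x - hyp_reflect e \<mu> y)" by (simp add: power2_less_imp_less)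
    have "x - y \<noteq> 0" using ne(1)[OF p(1)] xy by simp
    from frac_kernel_strict_antimono[OF s this lt] show "0 < ?f p" using xy by simp
    show "?f p \<le> frac_kernel s (x - y) - frac_kernel s (x - hyp_reflect e \<mu> y)" if "x \<in> A" "y \<in> B" for x y
      using p(2)[of "(x, y)"] that by simp
  qed
qed

text \<open>
  The properties of a solution on which the method depends, for a fixed direction \<open>e\<close>. Here \<open>c\<close> is half
  the normalising constant, \<open>F\<close> collects the two nonlinear terms, and \<open>G\<close> is a Borel function that agrees almost
  everywhere in \<open>\<Omega>\<close> with \<open>x \<mapsto> F x (u x)\<close>; the latter is only known to be Lebesgue measurable. The value of
  \<open>u\<close> at the origin is normalised to 0, so that \<open>u \<ge> 0\<close> holds at every point.
\<close>
locale moving_plane_problem =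
  fixes s c :: real and \<Omega> :: "(real^'n) set" and F :: "real^'n \<Rightarrow> real \<Rightarrow> real" and u G :: "real^'n \<Rightarrow> real"
    and e :: "real^'n"
  assumes s: "0 < s" "s < 1" and c: "0 < c" and e: "norm e = 1"
    and dom: "open \<Omega>" "bounded \<Omega>" "0 \<in> \<Omega>"
    and symm: "\<And>x. x \<in> \<Omega> \<Longrightarrow> hyp_reflect e 0 x \<in> \<Omega>"
    and reflect_dom: "\<And>x \<mu>. x \<in> \<Omega> \<Longrightarrow> x \<bullet> e < \<mu> \<Longrightarrow> \<mu> < 0 \<Longrightarrow> hyp_reflect e \<mu> x \<in> \<Omega>"
    and u_cont: "continuous_on (- {0}) u"
    and u_pos: "\<And>x. x \<in> \<Omega> \<Longrightarrow> x \<noteq> 0 \<Longrightarrow> 0 < u x"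
    and u_outside: "\<And>x. x \<notin> \<Omega> \<Longrightarrow> u x = 0" and u_0: "u 0 = 0"
    and u_energy: "finite_energy s u"
    and G: "integrable lborel G" "AE x in lborel. x \<in> \<Omega> \<longrightarrow> G x = F x (u x)"
    and weak: "\<And>\<phi> B. finite_energy s \<phi> \<Longrightarrow> (\<And>x. \<bar>\<phi> x\<bar> \<le> B) \<Longrightarrow> (\<And>x. x \<notin> \<Omega> \<Longrightarrow> \<phi> x = 0) \<Longrightarrow>
        c * energy s u \<phi> = (\<integral>x. G x * \<phi> x \<partial>lborel)"
    and F_reflect: "\<And>\<mu> x t. \<mu> < 0 \<Longrightarrow> x \<in> \<Omega> \<Longrightarrow> x \<bullet> e < \<mu> \<Longrightarrow> hyp_reflect e \<mu> x \<noteq> 0 \<Longrightarrow> 0 \<le> t \<Longrightarrow>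
        F x t \<le> F (hyp_reflect e \<mu> x) t"
    and F_lipschitz: "\<And>M a. 0 < M \<Longrightarrow> 0 < a \<Longrightarrow> \<exists>L\<ge>0. \<forall>x\<in>\<Omega>. a \<le> norm x \<longrightarrow>
        (\<forall>t1\<in>{0..M}. \<forall>t2\<in>{0..M}. \<bar>F x t1 - F x t2\<bar> \<le> L * \<bar>t1 - t2\<bar>)"
begin

abbreviation "R \<equiv> hyp_reflect e"

lemma u_nonneg: "0 \<le> u x"
  using u_pos[of x] u_outside[of x] u_0 by (cases "x \<in> \<Omega>"; cases "x = 0") auto

lemma u_measurable [measurable]: "u \<in> borel_measurable borel"
  using u_energy finite_energy_measurable by auto

lemma in_dom: "0 < u x \<Longrightarrow> x \<in> \<Omega>"
  using u_outside by force

lemma reflect_reflect [simp]: "R \<mu> (R \<mu> x) = x"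
  by (rule hyp_reflect_involution[OF e])

lemma R_inner: "R \<mu> x \<bullet> e = 2 * \<mu> - x \<bullet> e"
  by (rule hyp_reflect_inner[OF e])

lemma norm_ge: "x \<bullet> e \<le> \<mu> \<Longrightarrow> - \<mu> \<le> norm x"
  using Cauchy_Schwarz_ineq2[of x e] e by auto

lemma u_bounded:
  assumes "\<mu> < 0"
  obtains M where "0 < M" "\<And>x. x \<bullet> e \<le> \<mu> \<Longrightarrow> u x \<le> M"
proof -
  let ?K = "closure \<Omega> \<inter> {x. x \<bullet> e \<le> \<mu>}"
  have "compact ?K"
    using dom by (intro compact_Int_closed closed_Collect_le continuous_intros) auto
  moreover have "continuous_on ?K u"
    using assms by (intro continuous_on_subset[OF u_cont]) auto
  ultimately have "bounded (u ` ?K)"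
    by (intro compact_imp_bounded compact_continuous_image)
  then obtain b where b: "\<And>x. x \<in> ?K \<Longrightarrow> \<bar>u x\<bar> \<le> b" by (auto simp: bounded_iff)
  show thesis
  proof
    show "0 < \<bar>b\<bar> + 1" by simp
    fix x assume x: "x \<bullet> e \<le> \<mu>"
    show "u x \<le> \<bar>b\<bar> + 1"
      using b[of x] x closure_subset[of \<Omega>] u_outside[of x] by (cases "x \<in> \<Omega>") auto
  qed
qed

lemma AE_reflect_nonzero: "AE x in lborel. R \<mu> x \<noteq> 0"
proof -
  have "AE x in lborel. x \<noteq> (0::real^'n)" by (rule AE_lborel_singleton)
  then show ?thesis by (rule AE_reflect[OF e])
qed

text \<open>
  Pairing \<open>x\<close> with its mirror image turns the integrand into \<open>(G x - G (R x)) * \<phi> x\<close> on one side of the plane,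
  and the monotonicity of \<open>F\<close> under the reflection replaces \<open>F (R x)\<close> by \<open>F x\<close>.
\<close>
lemma nonlinearity_reflect_bound:
  fixes \<phi> b :: "real^'n \<Rightarrow> real"
  assumes \<mu>: "\<mu> < 0" and \<phi>: "\<phi> \<in> borel_measurable borel" "\<And>x. \<bar>\<phi> x\<bar> \<le> B" "\<And>x. x \<notin> \<Omega> \<Longrightarrow> \<phi> x = 0"
    and odd: "\<And>x. \<phi> (R \<mu> x) = - \<phi> x" and pos: "\<And>x. x \<bullet> e < \<mu> \<Longrightarrow> 0 \<le> \<phi> x"
    and b: "integrable lborel b" "\<And>x. 0 \<le> b x" "\<And>x. b (R \<mu> x) = b x"
    and le: "\<And>x. x \<in> \<Omega> \<Longrightarrow> x \<bullet> e < \<mu> \<Longrightarrow> R \<mu> x \<noteq> 0 \<Longrightarrow> 0 < \<phi> x \<Longrightarrow> (F x (u x) - F x (u (R \<mu> x))) * \<phi> x \<le> b x"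
  shows "(\<integral>x. G x * \<phi> x \<partial>lborel) \<le> (\<integral>x. b x \<partial>lborel) / 2"
proof -
  let ?P = "\<lambda>x. G x * \<phi> x"
  have P: "integrable lborel ?P"
    using \<phi> G by (intro integrable_mult_bounded) auto
  note RP = integral_reflect[OF e P, of \<mu>]
  have half: "?P x + ?P (R \<mu> x) \<le> b x"
    if "x \<bullet> e < \<mu>" "R \<mu> x \<noteq> 0" "x \<in> \<Omega> \<longrightarrow> G x = F x (u x)" "R \<mu> x \<in> \<Omega> \<longrightarrow> G (R \<mu> x) = F (R \<mu> x) (u (R \<mu> x))" for x
  proof (cases "\<phi> x = 0")
    case True
    then show ?thesis using odd[of x] b(2)[of x] by simp
  next
    case False
    then have x: "x \<in> \<Omega>" "0 < \<phi> x" using \<phi>(3)[of x] pos[OF that(1)] by auto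
    then have Rx: "R \<mu> x \<in> \<Omega>" using that(1) \<mu> reflect_dom by blast
    have "F x (u (R \<mu> x)) \<le> F (R \<mu> x) (u (R \<mu> x))"
      using F_reflect[OF \<mu> x(1) that(1,2) u_nonneg] .
    then have "(F x (u x) - F (R \<mu> x) (u (R \<mu> x))) * \<phi> x \<le> (F x (u x) - F x (u (R \<mu> x))) * \<phi> x"
      using x by (intro mult_right_mono) auto
    also have "\<dots> \<le> b x" by (rule le[OF x(1) that(1,2) x(2)])
    finally show ?thesis using that(3,4) x Rx by (simp add: odd algebra_simps)
  qed
  have "2 * (\<integral>x. ?P x \<partial>lborel) = (\<integral>x. ?P x + ?P (R \<mu> x) \<partial>lborel)"
    using P RP by simp
  also have "\<dots> \<le> (\<integral>x. b x \<partial>lborel)"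
  proof (rule integral_mono_AE)
    show "AE x in lborel. ?P x + ?P (R \<mu> x) \<le> b x"
      using AE_reflect_nonzero[of \<mu>] AE_lborel_singleton[of 0] G(2) AE_reflect[OF e G(2), of \<mu>]
    proof eventually_elim
      case (elim x)
      consider "x \<bullet> e < \<mu>" | "R \<mu> x \<bullet> e < \<mu>" | "x \<bullet> e = \<mu>" by (auto simp: R_inner) (smt (verit))
      then show ?case
      proof cases
        case 1
        then show ?thesis using half elim by blast
      next
        case 2
        then show ?thesis using half[of "R \<mu> x"] elim b(3)[of x] by (simp add: add.commute)
      next
        case 3
        then have "R \<mu> x = x" by (simp add: hyp_reflect_def)
        then have "\<phi> x = 0" using odd[of x] by simp
        then show ?thesis using odd[of x] b(2)[of x] by simp
      qed
    qed
  qed (use P RP b in auto)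
  finally show ?thesis by simp
qed

lemma odd_positive_part_AE_zero:
  assumes cont: "continuous_on {x. x \<bullet> e < \<mu> \<and> R \<mu> x \<noteq> 0} z"
    and zero: "AE x in lborel. odd_positive_part e \<mu> z x = 0"
    and x: "x \<bullet> e < \<mu>" "R \<mu> x \<noteq> 0"
  shows "z x \<le> 0"
proof (rule ccontr)
  let ?W = "{x. x \<bullet> e < \<mu> \<and> R \<mu> x \<noteq> 0}"
  assume "\<not> z x \<le> 0"
  then have ne: "?W \<inter> z -` {0<..} \<noteq> {}" using x by auto
  have "open ?W"
    by (intro open_Collect_conj open_Collect_less open_Collect_neq continuous_intros)
  then have "open (?W \<inter> z -` {0<..})"
    using cont by (intro continuous_open_preimage) auto
  then obtain y where "y \<in> ?W \<inter> z -` {0<..}" "odd_positive_part e \<mu> z y = 0"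
    using AE_lborel_open_ex[OF zero _ ne] by blast
  then show False by (auto simp: odd_positive_part_def)
qed

lemma continuous_on_u_diff:
  assumes "\<mu> < 0"
  shows "continuous_on {x. x \<bullet> e < \<mu> \<and> R \<mu> x \<noteq> 0} (\<lambda>x. u x - u (R \<mu> x))"
  using assms by (intro continuous_intros continuous_on_compose2[OF u_cont]) auto

text \<open>
  Admissibility in the weak formulation. The function \<open>h\<close> is 0 or a small bump. If \<open>\<phi> x > 0\<close> on the side
  \<open>x \<bullet> e \<le> \<mu>\<close>, then \<open>u x + h x > 0\<close>, so \<open>x\<close> is in \<open>\<Omega>\<close>; the mirror image of such a point is in \<open>\<Omega>\<close> because
  \<open>\<Omega>\<close> is convex and symmetric in the direction \<open>e\<close>.
\<close>
lemma test_function: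
  fixes h :: "real^'n \<Rightarrow> real"
  assumes \<mu>: "\<mu> < 0" and h: "finite_energy s h" "\<And>x. 0 \<le> h x" "\<And>x. h x \<le> 1" "\<And>x. x \<notin> \<Omega> \<Longrightarrow> h x = 0"
    and M: "\<And>x. x \<bullet> e \<le> \<mu> \<Longrightarrow> u x \<le> M"
  defines "\<phi> \<equiv> odd_positive_part e \<mu> (\<lambda>x. (u x + h x) - (u (R \<mu> x) + h (R \<mu> x)))"
  shows "finite_energy s \<phi>" and "\<phi> (R \<mu> x) = - \<phi> x" and "\<bar>\<phi> x\<bar> \<le> M + 1" and "x \<notin> \<Omega> \<Longrightarrow> \<phi> x = 0"
    and "integrable lborel \<phi>" and "integrable lborel (\<lambda>x. (\<phi> x)\<^sup>2)" and "\<phi> \<in> borel_measurable borel"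
proof -
  let ?z = "\<lambda>x. (u x + h x) - (u (R \<mu> x) + h (R \<mu> x))"
  show fin: "finite_energy s \<phi>"
    unfolding \<phi>_def
    by (rule finite_energy_odd_positive_part[OF s(1) e finite_energy_add[OF u_energy h(1)]])
  show odd: "\<phi> (R \<mu> x) = - \<phi> x" for x
    unfolding \<phi>_def by (rule odd_positive_part_odd[OF s(1) e]) simp
  show meas: "\<phi> \<in> borel_measurable borel" using fin by (rule finite_energy_measurable)
  have half: "0 \<le> \<phi> x \<and> \<phi> x \<le> M + 1 \<and> (x \<notin> \<Omega> \<longrightarrow> \<phi> x = 0)" if "x \<bullet> e \<le> \<mu>" for x
    using that M[OF that] h(2)[of x] h(2)[of "R \<mu> x"] h(3)[of x] h(4)[of x] u_outside[of x] u_nonneg[of x] u_nonneg[of "R \<mu> x"]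
    by (auto simp: \<phi>_def odd_positive_part_def)
  have side: "x \<bullet> e \<le> \<mu> \<or> R \<mu> x \<bullet> e < \<mu>" for x
    by (auto simp: R_inner)
  show bdd: "\<bar>\<phi> x\<bar> \<le> M + 1" for x
    using half[of x] half[of "R \<mu> x"] side[of x] odd[of x] by fastforce
  show supp: "\<phi> x = 0" if "x \<notin> \<Omega>" for x
  proof (cases "x \<bullet> e \<le> \<mu>")
    case True
    then show ?thesis using half that by blast
  next
    case False
    then have R: "R \<mu> x \<bullet> e < \<mu>" using side by blast
    then have "R \<mu> x \<notin> \<Omega>" using reflect_dom[of "R \<mu> x" \<mu>] that \<mu> by auto
    then show ?thesis using half[of "R \<mu> x"] R odd[of x] by simp
  qed
  show "integrable lborel \<phi>" by (rule integrable_bounded_support[OF meas borel_open[OF dom(1)] dom(2) bdd supp])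
  show "integrable lborel (\<lambda>x. (\<phi> x)\<^sup>2)"
  proof (rule integrable_bounded_support[OF _ borel_open[OF dom(1)] dom(2)])
    show "\<bar>(\<phi> x)\<^sup>2\<bar> \<le> (M + 1)\<^sup>2" for x using power_mono[OF bdd[of x], of 2] by simp
  qed (use meas supp in auto)
qed

section \<open>Maximum principle for small overlaps\<close>

definition overlap :: "real \<Rightarrow> (real^'n) set" where
  "overlap \<mu> = {x. x \<bullet> e < \<mu> \<and> u (R \<mu> x) < u x}"

lemma overlap_measurable [measurable]: "overlap \<mu> \<in> sets borel"
  unfolding overlap_def by measurable

lemma overlap_subset: "overlap \<mu> \<subseteq> \<Omega>"
proof
  fix x assume "x \<in> overlap \<mu>"
  then have "0 < u x" using u_nonneg[of "R \<mu> x"] by (auto simp: overlap_def)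
  then show "x \<in> \<Omega>" by (rule in_dom)
qed

text \<open>
  With \<open>\<phi>\<close> the truncation of \<open>w = u - u \<circ> R\<close>, the weak formulation gives
  \<open>c * energy \<phi> \<phi> \<le> L * \<integral> \<phi>\<^sup>2\<close>, whereas coercivity gives \<open>c * energy \<phi> \<phi> \<ge> (L + 1) * \<integral> \<phi>\<^sup>2\<close> once the support is small.
  The Lipschitz constant \<open>L\<close>, and with it \<open>\<delta>\<close>, is uniform in \<open>\<mu> \<le> \<mu>1\<close>.
\<close>
lemma small_overlap_principle:
  assumes \<mu>1: "\<mu>1 < 0"
  obtains \<delta> where "0 < \<delta>"
    "\<And>\<mu> x. \<mu> \<le> \<mu>1 \<Longrightarrow> emeasure lborel (overlap \<mu>) \<le> ennreal \<delta> \<Longrightarrow> x \<bullet> e < \<mu> \<Longrightarrow> R \<mu> x \<noteq> 0 \<Longrightarrow> u x \<le> u (R \<mu> x)"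
proof -
  obtain M where M: "0 < M" "\<And>x. x \<bullet> e \<le> \<mu>1 \<Longrightarrow> u x \<le> M" using u_bounded[OF \<mu>1] by blast
  obtain L where L: "0 \<le> L" and lip: "\<And>x t1 t2. x \<in> \<Omega> \<Longrightarrow> - \<mu>1 \<le> norm x \<Longrightarrow> t1 \<in> {0..M} \<Longrightarrow> t2 \<in> {0..M} \<Longrightarrow>
      \<bar>F x t1 - F x t2\<bar> \<le> L * \<bar>t1 - t2\<bar>"
    using F_lipschitz[OF M(1), of "- \<mu>1"] \<mu>1 by auto
  \<comment> \<open>coercivity with this constant beats the Lipschitz constant\<close>
  define C where "C = (L + 1) / c"
  have C: "0 < C" using L c by (simp add: C_def)
  obtain \<delta> where \<delta>: "0 < \<delta>" and mass: "\<And>D x. D \<in> sets (borel :: (real^'n) measure) \<Longrightarrow> emeasure lborel D \<le> ennreal \<delta> \<Longrightarrow>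
       ennreal C \<le> (\<integral>\<^sup>+y. indicator (- D) y * ennreal (frac_kernel s (x - y)) \<partial>lborel)"
    using frac_kernel_mass_outside_small_set[OF s(1) C] by blast
  show thesis
  proof
    show "0 < \<delta> / 2" using \<delta> by simp
    fix \<mu> x0 assume \<mu>: "\<mu> \<le> \<mu>1" and small: "emeasure lborel (overlap \<mu>) \<le> ennreal (\<delta> / 2)"
      and x0: "x0 \<bullet> e < \<mu>" "R \<mu> x0 \<noteq> 0"
    have \<mu>0: "\<mu> < 0" using \<mu> \<mu>1 by simp
    define \<phi> where "\<phi> = odd_positive_part e \<mu> (\<lambda>x. (u x + 0) - (u (R \<mu> x) + 0))"
    have \<phi>_def': "\<phi> = odd_positive_part e \<mu> (\<lambda>x. u x - u (R \<mu> x))" by (simp add: \<phi>_def)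
    have zero: "finite_energy s (\<lambda>x::real^'n. 0)" by (simp add: finite_energy_def case_prod_unfold)
    have M': "\<And>x. x \<bullet> e \<le> \<mu> \<Longrightarrow> u x \<le> M" using M(2) \<mu> by force
    note \<phi> = test_function[OF \<mu>0 zero order.refl zero_le_one refl M', folded \<phi>_def]
    have pos: "\<phi> x = u x - u (R \<mu> x) \<and> x \<in> overlap \<mu>" if "x \<bullet> e \<le> \<mu>" "\<phi> x \<noteq> 0" for x
    proof -
      have "x \<bullet> e \<noteq> \<mu>"
      proof
        assume "x \<bullet> e = \<mu>"
        then have "R \<mu> x = x" by (simp add: hyp_reflect_def)
        then show False using \<phi>(2)[of x] that by simp
      qed
      then show ?thesis using that by (auto simp: \<phi>_def' odd_positive_part_def overlap_def max_def split: if_splits)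
    qed
    have "{y. \<phi> y \<noteq> 0} \<subseteq> overlap \<mu> \<union> R \<mu> -` overlap \<mu>"
    proof
      fix y assume y: "y \<in> {y. \<phi> y \<noteq> 0}"
      show "y \<in> overlap \<mu> \<union> R \<mu> -` overlap \<mu>"
      proof (cases "y \<bullet> e \<le> \<mu>")
        case True
        then show ?thesis using pos y by blast
      next
        case False
        then have "R \<mu> y \<bullet> e \<le> \<mu>" by (simp add: R_inner)
        moreover have "\<phi> (R \<mu> y) \<noteq> 0" using y \<phi>(2) by simp
        ultimately show ?thesis using pos by blast
      qed
    qed
    then have "emeasure lborel {y. \<phi> y \<noteq> 0} \<le> emeasure lborel (overlap \<mu> \<union> R \<mu> -` overlap \<mu>)"
      using measurable_sets[OF measurable_hyp_reflect overlap_measurable, of e \<mu> \<mu>] by (intro emeasure_mono) auto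
    also have "\<dots> \<le> emeasure lborel (overlap \<mu>) + emeasure lborel (R \<mu> -` overlap \<mu>)"
      using measurable_sets[OF measurable_hyp_reflect overlap_measurable, of e \<mu> \<mu>] by (intro emeasure_subadditive) auto
    also have "emeasure lborel (R \<mu> -` overlap \<mu>) = emeasure (distr lborel borel (R \<mu>)) (overlap \<mu>)"
      by (subst emeasure_distr) auto
    also have "\<dots> = emeasure lborel (overlap \<mu>)" by (simp add: lborel_distr_hyp_reflect[OF e])
    also have "emeasure lborel (overlap \<mu>) + emeasure lborel (overlap \<mu>) \<le> ennreal (\<delta> / 2) + ennreal (\<delta> / 2)"
      by (intro add_mono small)
    also have "\<dots> = ennreal \<delta>" using \<delta> by (simp flip: ennreal_plus)
    finally have supp: "emeasure lborel {y. \<phi> y \<noteq> 0} \<le> ennreal \<delta>" .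
    have "{y. \<phi> y \<noteq> 0} \<in> sets borel" using \<phi>(7) by measurable
    then have coercive: "C * (\<integral>x. (\<phi> x)\<^sup>2 \<partial>lborel) \<le> energy s \<phi> \<phi>"
      using supp by (intro energy_ge_small_support \<phi> C mass)
    have const0: "(\<lambda>(x::real^'n, y::real^'n). 0::real) = (\<lambda>_. 0)" by auto
    have absle: "\<bar>\<phi> x\<bar> \<le> \<bar>u x - u (R \<mu> x)\<bar>" for x
      unfolding \<phi>_def' by (rule abs_odd_positive_part_le)
    have "energy s \<phi> \<phi> / 2 + (\<integral>(x, y). 0 \<partial>(lborel :: ((real^'n) \<times> (real^'n)) measure)) / 4 \<le> energy s u \<phi>"
      unfolding \<phi>_def'
    proof (rule energy_odd_positive_part_ge[OF s(1) e u_energy, where Z = "\<lambda>_ _. 0"])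
      show "integrable lborel (\<lambda>(x::real^'n, y::real^'n). 0::real)" unfolding const0 by simp
    qed (unfold \<phi>_def'[symmetric], intro mult_nonneg_nonneg add_nonneg_nonneg, use absle in auto)
    then have "energy s \<phi> \<phi> / 2 \<le> energy s u \<phi>" unfolding const0 by simp
    then have "c * (C * (\<integral>x. (\<phi> x)\<^sup>2 \<partial>lborel)) \<le> c * (2 * energy s u \<phi>)"
      using coercive c by (intro mult_left_mono) auto
    also have "\<dots> = 2 * (\<integral>x. G x * \<phi> x \<partial>lborel)"
      using weak[OF \<phi>(1,3,4)] by simp
    also have "(\<integral>x. G x * \<phi> x \<partial>lborel) \<le> (\<integral>x. L * (\<phi> x)\<^sup>2 \<partial>lborel) / 2"
    proof (rule nonlinearity_reflect_bound[where b = "\<lambda>x. L * (\<phi> x)\<^sup>2", OF \<mu>0 \<phi>(7,3,4,2)])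
      show "0 \<le> \<phi> x" if "x \<bullet> e < \<mu>" for x using that by (simp add: \<phi>_def' odd_positive_part_def)
      show "integrable lborel (\<lambda>x. L * (\<phi> x)\<^sup>2)" using \<phi>(6) by simp
      show "(F x (u x) - F x (u (R \<mu> x))) * \<phi> x \<le> L * (\<phi> x)\<^sup>2"
        if x: "x \<in> \<Omega>" "x \<bullet> e < \<mu>" "R \<mu> x \<noteq> 0" "0 < \<phi> x" for x
      proof -
        have p: "\<phi> x = u x - u (R \<mu> x)" using pos[of x] x by simp
        have "- \<mu>1 \<le> norm x" using norm_ge[of x \<mu>1] x \<mu> by simp
        moreover have "u x \<le> M" "0 \<le> u x" "0 \<le> u (R \<mu> x)" "u (R \<mu> x) \<le> M"
          using M'[of x] u_nonneg x p by auto
        ultimately have "\<bar>F x (u x) - F x (u (R \<mu> x))\<bar> \<le> L * \<bar>u x - u (R \<mu> x)\<bar>"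
          using x by (intro lip) auto
        then have "F x (u x) - F x (u (R \<mu> x)) \<le> L * \<phi> x" using x p by simp
        then have "(F x (u x) - F x (u (R \<mu> x))) * \<phi> x \<le> L * \<phi> x * \<phi> x"
          using x by (intro mult_right_mono) auto
        then show ?thesis by (simp add: power2_eq_square)
      qed
    qed (use L \<phi>(2) in auto)
    finally have "(L + 1) * (\<integral>x. (\<phi> x)\<^sup>2 \<partial>lborel) \<le> L * (\<integral>x. (\<phi> x)\<^sup>2 \<partial>lborel)"
      using c by (simp add: C_def)
    then have "(\<integral>x. (\<phi> x)\<^sup>2 \<partial>lborel) \<le> 0" by (simp add: algebra_simps)
    then have "(\<integral>x. (\<phi> x)\<^sup>2 \<partial>lborel) = 0" by (intro antisym integral_nonneg_AE) auto
    then have "AE x in lborel. (\<phi> x)\<^sup>2 = 0"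
      using integral_nonneg_eq_0_iff_AE[OF \<phi>(6)] by simp
    then have "AE x in lborel. \<phi> x = 0" by simp
    from odd_positive_part_AE_zero[OF continuous_on_u_diff[OF \<mu>0] this[unfolded \<phi>_def'] x0]
    show "u x0 \<le> u (R \<mu> x0)" by simp
  qed
qed

section \<open>Strong maximum principle\<close>

text \<open>
  Excludes that \<open>u\<close> is symmetric with respect to a plane other than \<open>x \<bullet> e = 0\<close>: a point of \<open>\<Omega>\<close> with almost
  maximal \<open>x \<bullet> e\<close> is reflected out of \<open>\<Omega>\<close>.
\<close>
lemma positive_gap_point:
  assumes \<mu>: "\<mu> < 0"
  obtains p where "p \<bullet> e < \<mu>" "R \<mu> p \<noteq> 0" "p \<notin> \<Omega>" "u p < u (R \<mu> p)"
proof -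
  let ?S = "(\<lambda>x. x \<bullet> e) ` \<Omega>"
  have bdd: "bdd_above ?S"
  proof -
    obtain b where b: "\<And>x. x \<in> \<Omega> \<Longrightarrow> norm x \<le> b" using dom(2) by (auto simp: bounded_iff)
    have "x \<bullet> e \<le> b" if "x \<in> \<Omega>" for x
      using b[OF that] Cauchy_Schwarz_ineq2[of x e] e by auto
    then show ?thesis by (auto intro!: bdd_aboveI[of _ b])
  qed
  obtain \<rho> where \<rho>: "0 < \<rho>" "ball 0 \<rho> \<subseteq> \<Omega>" using dom openE by blast
  have "(\<rho>/2) *\<^sub>R e \<in> \<Omega>" using \<rho> e by (intro subsetD[OF \<rho>(2)]) simp
  then have "((\<rho>/2) *\<^sub>R e) \<bullet> e \<le> Sup ?S" by (intro cSup_upper bdd imageI)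
  then have sup: "0 < Sup ?S" using \<rho> e by (simp add: norm_eq_1)
  \<comment> \<open>the positive lower bound for \<open>q \<bullet> e\<close> also guarantees \<open>q \<noteq> 0\<close> and \<open>q \<bullet> e > \<mu>\<close>\<close>
  then have "max (Sup ?S + 2 * \<mu>) 0 < Sup ?S" using \<mu> by simp
  then obtain q where q: "q \<in> \<Omega>" "max (Sup ?S + 2 * \<mu>) 0 < q \<bullet> e"
    using less_cSup_iff[OF _ bdd] dom(3) by (metis (no_types, lifting) empty_iff image_iff image_is_empty)
  have "R \<mu> q \<notin> \<Omega>"
  proof
    assume "R \<mu> q \<in> \<Omega>"
    then have "R 0 (R \<mu> q) \<in> \<Omega>" by (rule symm)
    then have "R 0 (R \<mu> q) \<bullet> e \<le> Sup ?S" by (intro cSup_upper bdd imageI)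
    then show False using q by (simp add: R_inner)
  qed
  moreover have "q \<noteq> 0" using q by auto
  moreover have "0 < u q" using q \<open>q \<noteq> 0\<close> u_pos by blast
  moreover have "R \<mu> q \<bullet> e < \<mu>" using q \<mu> by (simp add: R_inner)
  ultimately show thesis using that[of "R \<mu> q"] u_outside[of "R \<mu> q"] by simp
qed

text \<open>
  Suppose that \<open>v = u \<circ> R - u\<close> vanishes at \<open>x0\<close>. Let \<open>h\<close> be a bump of height \<open>\<epsilon>\<close> at \<open>x0\<close>, supported in the small ball \<open>B\<close>,
  and truncate \<open>h - v\<close> to a test function \<open>\<phi>\<close>, which up to a null set is supported in \<open>B\<close> and its mirror image. On a ball \<open>A\<close> away from \<open>x0\<close> one has
  \<open>v \<ge> m > 0\<close>, and the surplus in the energy inequality is at least \<open>m\<close> times a constant times \<open>\<integral> |\<phi>|\<close>,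
  with a constant that does not depend on \<open>\<epsilon>\<close>. The energy of \<open>h\<close> against \<open>\<phi>\<close> and the nonlinear term are at most a
  constant times \<open>\<epsilon> * \<integral> |\<phi>|\<close>, the latter because \<open>v < h \<le> \<epsilon>\<close> wherever \<open>\<phi>\<close> is positive. For small \<open>\<epsilon>\<close> this forces \<open>\<phi> = 0\<close>,
  that is \<open>v \<ge> h\<close>, in contradiction to \<open>v x0 = 0 < h x0\<close>.
\<close>
lemma strong_maximum_principle:
  assumes \<mu>: "\<mu> < 0" and order: "\<And>x. x \<bullet> e < \<mu> \<Longrightarrow> R \<mu> x \<noteq> 0 \<Longrightarrow> u x \<le> u (R \<mu> x)"
    and x0: "x0 \<in> \<Omega>" "x0 \<bullet> e < \<mu>" "R \<mu> x0 \<noteq> 0"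
  shows "u x0 < u (R \<mu> x0)"
proof (rule ccontr)
  assume "\<not> u x0 < u (R \<mu> x0)"
  then have touch: "u (R \<mu> x0) = u x0" using order[OF x0(2,3)] by simp
  let ?W = "{x. x \<bullet> e < \<mu> \<and> R \<mu> x \<noteq> 0}"
  let ?v = "\<lambda>x. u (R \<mu> x) - u x"
  have openW: "open ?W"
    by (intro open_Collect_conj open_Collect_less open_Collect_neq continuous_intros)
  have contv: "continuous_on ?W ?v"
    using continuous_on_minus[OF continuous_on_u_diff[OF \<mu>]] by simp
  obtain p where p: "p \<bullet> e < \<mu>" "R \<mu> p \<noteq> 0" "p \<notin> \<Omega>" "u p < u (R \<mu> p)"
    using positive_gap_point[OF \<mu>] by blast
  define m where "m = ?v p / 2"
  have m: "0 < m" using p by (simp add: m_def)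
  \<comment> \<open>balls of radius at most \<open>d\<close> about \<open>x0\<close> and \<open>p\<close> are disjoint\<close>
  define d where "d = norm (x0 - p) / 3"
  have d: "0 < d" using x0 p by (auto simp: d_def)
  have "open (?W \<inter> ?v -` {m<..})" using openW contv by (intro continuous_open_preimage) auto
  moreover have "p \<in> ?W \<inter> ?v -` {m<..}" using p by (simp add: m_def)
  ultimately obtain \<rho>' where \<rho>': "0 < \<rho>'" "cball p \<rho>' \<subseteq> ?W \<inter> ?v -` {m<..}"
    using open_contains_cball by blast
  define A where "A = cball p (min \<rho>' d)"
  have A: "compact A" "A \<noteq> {}" "\<And>x. x \<in> A \<Longrightarrow> x \<bullet> e < \<mu>" "\<And>x. x \<in> A \<Longrightarrow> m \<le> ?v x"
    using \<rho>' d unfolding A_def by (auto simp: subset_iff)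
  obtain r' where r': "0 < r'" "ball x0 r' \<subseteq> \<Omega>" using dom x0 openE by blast
  \<comment> \<open>the last bound keeps the mirror image of the ball at distance \<open>2 r\<close> from \<open>x0\<close>, as \<open>bump_far\<close> requires\<close>
  define r where "r = min r' (min d ((\<mu> - x0 \<bullet> e) / 2))"
  have r: "0 < r" "ball x0 r \<subseteq> \<Omega>" "r \<le> d" "2 * r \<le> \<mu> - x0 \<bullet> e"
  proof -
    have "r \<le> (\<mu> - x0 \<bullet> e) / 2" unfolding r_def by (rule min.coboundedI2, rule min.cobounded2)
    moreover have "r \<le> r'" by (simp add: r_def)
    ultimately show "2 * r \<le> \<mu> - x0 \<bullet> e" "ball x0 r \<subseteq> \<Omega>" using r'(2) by (auto intro: order_trans[OF subset_ball])
    show "0 < r" "r \<le> d" using r' d x0 by (auto simp: r_def)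
  qed
  have far: "2 * r \<le> norm (x - x0)" if "\<mu> \<le> x \<bullet> e" for x
  proof -
    have "(x - x0) \<bullet> e \<le> norm (x - x0)" using Cauchy_Schwarz_ineq2[of "x - x0" e] e by auto
    then show ?thesis using that r(4) by (simp add: inner_diff_left)
  qed
  define B where "B = cball x0 r"
  have B: "compact B" "B \<noteq> {}" "\<And>x. x \<in> B \<Longrightarrow> x \<bullet> e < \<mu>"
  proof -
    show "x \<bullet> e < \<mu>" if "x \<in> B" for x
      using far[of x] that r(1) by (force simp: B_def dist_norm norm_minus_commute)
  qed (use r in \<open>auto simp: B_def\<close>)
  have AB: "norm (x - x0) \<ge> r" if "x \<in> A" for x
  proof -
    have "norm (x0 - p) \<le> norm (x - x0) + norm (x - p)"
      using norm_triangle_ineq4[of "x - p" "x - x0"] by (simp add: algebra_simps)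
    moreover have "norm (x - p) \<le> d" using that by (simp add: A_def dist_norm norm_minus_commute)
    moreover have "norm (x0 - p) = 3 * d" by (simp add: d_def)
    ultimately show ?thesis using r(3) d by linarith
  qed
  have disj: "A \<inter> B = {}"
  proof (rule equals0I)
    fix x assume "x \<in> A \<inter> B"
    then have "norm (x - p) \<le> d" "norm (x - x0) \<le> r"
      by (auto simp: A_def B_def dist_norm norm_minus_commute)
    moreover have "norm (x0 - p) \<le> norm (x - p) + norm (x - x0)"
      using norm_triangle_ineq4[of "x - p" "x - x0"] by (simp add: algebra_simps)
    moreover have "norm (x0 - p) = 3 * d" by (simp add: d_def)
    ultimately show False using r(3) d by linarith
  qed
  obtain \<kappa> where \<kappa>: "0 < \<kappa>" and gap: "\<And>x y. x \<in> A \<Longrightarrow> y \<in> B \<Longrightarrow> \<kappa> \<le> frac_kernel s (x - y) - frac_kernel s (x - R \<mu> y)"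
    using kernel_gap[OF s(1) e A(1-3) B disj] by blast
  obtain M where M: "0 < M" "\<And>x. x \<bullet> e \<le> \<mu> \<Longrightarrow> u x \<le> M" using u_bounded[OF \<mu>] by blast
  obtain L where L: "0 \<le> L" and lip: "\<And>x t1 t2. x \<in> \<Omega> \<Longrightarrow> - \<mu> \<le> norm x \<Longrightarrow> t1 \<in> {0..M+1} \<Longrightarrow> t2 \<in> {0..M+1} \<Longrightarrow>
      \<bar>F x t1 - F x t2\<bar> \<le> L * \<bar>t1 - t2\<bar>"
    using F_lipschitz[of "M + 1" "- \<mu>"] \<mu> M(1) by auto
  let ?m = "\<lambda>t::real^'n. min 1 ((norm t)\<^sup>2 / r\<^sup>2)"
  define T where "T = (\<integral>t. ?m t * frac_kernel s t \<partial>lborel)"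
  have T: "0 \<le> T" unfolding T_def by (intro integral_nonneg_AE) auto
  define a where "a = measure lborel A"
  have a: "0 < a"
  proof -
    have "0 < min \<rho>' d" using \<rho>' d by simp
    then show ?thesis unfolding a_def A_def by (simp add: content_cball)
  qed
  \<comment> \<open>\<open>\<epsilon> * D\<close> bounds the terms that are small with the bump, relative to \<open>\<integral> |\<phi>|\<close>\<close>
  define D where "D = L / 2 + 2 * c * T + 1"
  have D: "0 < D" using L c T by (simp add: D_def add_nonneg_pos)
  define \<epsilon> where "\<epsilon> = min 1 (c * (m * \<kappa> * a) / 4 / D)"
  have \<epsilon>: "0 < \<epsilon>" "\<epsilon> \<le> 1" using c m \<kappa> a D by (auto simp: \<epsilon>_def)
  have \<epsilon>D: "\<epsilon> * (L / 2 + 2 * c * T) < c * (m * \<kappa> * a) / 4"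
  proof -
    have "\<epsilon> * (L / 2 + 2 * c * T) < \<epsilon> * D" using \<epsilon> by (simp add: D_def)
    also have "\<dots> \<le> c * (m * \<kappa> * a) / 4 / D * D" using D by (intro mult_right_mono) (auto simp: \<epsilon>_def)
    finally show ?thesis using D by simp
  qed
  define h where "h x = \<epsilon> * bump x0 r x" for x
  have h: "finite_energy s h" "\<And>x. 0 \<le> h x" "\<And>x. h x \<le> \<epsilon>" "\<And>x. h x \<le> 1" "\<And>x. x \<notin> \<Omega> \<Longrightarrow> h x = 0" "\<And>x. r \<le> norm (x - x0) \<Longrightarrow> h x = 0"
    "integrable lborel h"
  proof -
    have "h = (\<lambda>x. \<epsilon> * bump x0 r x)" by (simp add: fun_eq_iff h_def)
    then show "finite_energy s h" using finite_energy_cmult[OF finite_energy_bump[OF s r(1)]] by simp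
    show "0 \<le> h x" "h x \<le> \<epsilon>" for x using \<epsilon> bump_le_1[of x0 r x] by (simp_all add: h_def mult_left_le)
    then show "h x \<le> 1" for x using \<epsilon> order_trans by blast
    show 0: "h x = 0" if "r \<le> norm (x - x0)" for x using bump_eq_0[OF r(1) that] by (simp add: h_def)
    show "h x = 0" if "x \<notin> \<Omega>" for x
      using that r(2) by (intro 0) (force simp: dist_norm norm_minus_commute)
    show "integrable lborel h" unfolding h_def using integrable_bump[OF r(1), of x0] by simp
  qed
  define \<phi> where "\<phi> = odd_positive_part e \<mu> (\<lambda>x. (u x + h x) - (u (R \<mu> x) + h (R \<mu> x)))"
  note \<phi> = test_function[OF \<mu> h(1,2,4,5) M(2), folded \<phi>_def]
  have hR: "h (R \<mu> x) = 0" if "x \<bullet> e \<le> \<mu>" for x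
    using that far[of "R \<mu> x"] r(1) by (intro h(6)) (auto simp: R_inner)
  have \<phi>_eq: "\<phi> x = max 0 (h x - ?v x)" if "x \<bullet> e \<le> \<mu>" for x
    using that hR[OF that] by (simp add: \<phi>_def odd_positive_part_def algebra_simps)
  \<comment> \<open>\<open>\<phi> y \<noteq> 0\<close> requires \<open>v y < h y\<close>, and \<open>v \<ge> 0\<close> by assumption, so \<open>y\<close> lies in the support of \<open>h\<close>\<close>
  have supp: "y \<in> B \<and> 0 \<le> ?v y \<and> ?v y < h y" if "y \<bullet> e \<le> \<mu>" "R \<mu> y \<noteq> 0" "\<phi> y \<noteq> 0" for y
  proof -
    have "y \<bullet> e \<noteq> \<mu>"
    proof
      assume "y \<bullet> e = \<mu>"
      then have "R \<mu> y = y" by (simp add: hyp_reflect_def)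
      then show False using \<phi>(2)[of y] that by simp
    qed
    then have v: "0 \<le> ?v y" using order[of y] that by simp
    then have lt: "?v y < h y" using that \<phi>_eq[OF that(1)] by (auto simp: max_def split: if_splits)
    then have "\<not> r \<le> norm (y - x0)" using h(6)[of y] v by force
    then show ?thesis using v lt by (simp add: B_def dist_norm norm_minus_commute)
  qed
  \<comment> \<open>\<open>\<psi>\<close> differs from \<open>|\<phi>|\<close> at most at the origin and its mirror image, where \<open>v\<close> carries no information\<close>
  define \<psi> where "\<psi> y = indicator (B \<union> R \<mu> -` B) y * \<bar>\<phi> y\<bar>" for y
  have Bm[measurable]: "B \<in> sets borel" using B(1) by (simp add: borel_closed compact_imp_closed)
  have RB[measurable]: "R \<mu> -` B \<in> sets borel"
    using measurable_sets[OF measurable_hyp_reflect Bm, of e \<mu>] by simp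
  note \<phi>(7)[measurable]
  have \<psi>: "integrable lborel \<psi>"
    unfolding \<psi>_def using integrable_real_mult_indicator[of "B \<union> R \<mu> -` B" lborel "\<lambda>y. \<bar>\<phi> y\<bar>"] \<phi>(5) by (simp add: mult.commute)
  have "AE y in lborel. \<psi> y = \<bar>\<phi> y\<bar>"
    using AE_reflect_nonzero[of \<mu>] AE_lborel_singleton[of 0]
  proof eventually_elim
    case (elim y)
    show ?case
    proof (cases "y \<bullet> e \<le> \<mu>")
      case True
      then show ?thesis using supp[of y] elim by (auto simp: \<psi>_def split: split_indicator)
    next
      case False
      then have "R \<mu> y \<bullet> e \<le> \<mu>" by (simp add: R_inner)
      then show ?thesis using supp[of "R \<mu> y"] elim \<phi>(2)[of y] by (auto simp: \<psi>_def split: split_indicator)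
    qed
  qed
  then have int\<psi>: "(\<integral>y. \<psi> y \<partial>lborel) = (\<integral>y. \<bar>\<phi> y\<bar> \<partial>lborel)"
    by (intro integral_cong_AE) (use \<psi> in auto)
  define I where "I = (\<integral>y. \<bar>\<phi> y\<bar> \<partial>lborel)"
  have Am: "A \<in> sets borel" using A(1) by (simp add: borel_closed compact_imp_closed)
  have finA: "emeasure lborel A < \<infinity>" using A(1) by (intro emeasure_bounded_finite compact_imp_bounded)
  have prod: "integrable (lborel \<Otimes>\<^sub>M lborel) (\<lambda>(x, y). indicat_real A x * \<psi> y)"
    "(\<integral>(x, y). indicat_real A x * \<psi> y \<partial>(lborel \<Otimes>\<^sub>M lborel)) = a * I"
  proof -
    have iA: "integrable lborel (indicat_real A)" using Am finA by (intro integrable_real_indicator) auto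
    show 1: "integrable (lborel \<Otimes>\<^sub>M lborel) (\<lambda>(x, y). indicat_real A x * \<psi> y)"
    proof (rule lborel_pair.Fubini_integrable)
      show "(\<lambda>(x, y). indicat_real A x * \<psi> y) \<in> borel_measurable (lborel \<Otimes>\<^sub>M lborel)"
        using Am \<psi> by measurable
      show "integrable lborel (\<lambda>x. \<integral>y. norm ((\<lambda>(x, y). indicat_real A x * \<psi> y) (x, y)) \<partial>lborel)"
        using iA by (simp add: abs_mult)
    qed (use \<psi> in auto)
    have "(\<integral>x. (\<integral>y. (\<lambda>(x, y). indicat_real A x * \<psi> y) (x, y) \<partial>lborel) \<partial>lborel) = a * I"
      using finA Am by (simp add: int\<psi> I_def[symmetric] a_def)
    then show "(\<integral>(x, y). indicat_real A x * \<psi> y \<partial>(lborel \<Otimes>\<^sub>M lborel)) = a * I"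
      using lborel_pair.integral_fst'[OF 1] by simp
  qed
  \<comment> \<open>on \<open>A\<close> the negative part of \<open>h - v\<close> is at least \<open>m\<close>, and \<open>\<kappa>\<close> bounds the difference of the kernel values\<close>
  let ?Z = "\<lambda>x y. m * \<kappa> * (indicat_real A x * \<psi> y)"
  let ?z = "\<lambda>x. (u x + h x) - (u (R \<mu> x) + h (R \<mu> x))"
  have Z: "integrable lborel (\<lambda>(x, y). ?Z x y)" "(\<integral>(x, y). ?Z x y \<partial>lborel) = m * \<kappa> * a * I"
    using prod unfolding lborel_prod by (simp_all add: case_prod_unfold)
  have Zle: "?Z x y \<le> ((\<bar>?z x\<bar> - \<bar>\<phi> x\<bar>) * \<bar>\<phi> y\<bar> + (\<bar>?z y\<bar> - \<bar>\<phi> y\<bar>) * \<bar>\<phi> x\<bar>)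
                  * \<bar>frac_kernel s (x - y) - frac_kernel s (x - R \<mu> y)\<bar>" (is "_ \<le> ?X") for x y
  proof -
    have absle: "\<bar>\<phi> x\<bar> \<le> \<bar>?z x\<bar>" for x
      by (auto simp: \<phi>_def odd_positive_part_def)
    have "0 \<le> ?X" using absle by (intro mult_nonneg_nonneg add_nonneg_nonneg) auto
    moreover have "?Z x y \<le> ?X" if x: "x \<in> A" and y: "y \<in> B \<union> R \<mu> -` B"
    proof -
      have xe: "x \<bullet> e \<le> \<mu>" using A(3)[OF x] by simp
      have zx: "?z x = - ?v x" using hR[OF xe] h(6)[OF AB[OF x]] by simp
      then have "m \<le> \<bar>?z x\<bar>" "\<phi> x = 0"
        using A(4)[OF x] m \<phi>_eq[OF xe] h(6)[OF AB[OF x]] by auto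
      moreover have "\<kappa> \<le> \<bar>frac_kernel s (x - y) - frac_kernel s (x - R \<mu> y)\<bar>"
        using y gap[OF x, of y] gap[OF x, of "R \<mu> y"] by auto
      ultimately have "m * \<bar>\<phi> y\<bar> * \<kappa> \<le> ((\<bar>?z x\<bar> - \<bar>\<phi> x\<bar>) * \<bar>\<phi> y\<bar>) * \<bar>frac_kernel s (x - y) - frac_kernel s (x - R \<mu> y)\<bar>"
        using \<kappa> m by (intro mult_mono) auto
      then show ?thesis using x y \<open>\<phi> x = 0\<close> by (simp add: \<psi>_def algebra_simps)
    qed
    ultimately show ?thesis by (auto simp: \<psi>_def split: split_indicator)
  qed
  have lower: "energy s \<phi> \<phi> / 2 + m * \<kappa> * a * I / 4 \<le> energy s (\<lambda>x. u x + h x) \<phi>"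
    using energy_odd_positive_part_ge[OF s(1) e finite_energy_add[OF u_energy h(1)] Z(1), of \<mu>] Zle
    unfolding Z(2) \<phi>_def by blast
  have "0 \<le> energy s \<phi> \<phi>" unfolding energy_def by (intro integral_nonneg_AE) auto
  then have "c * (m * \<kappa> * a * I / 4) \<le> c * energy s (\<lambda>x. u x + h x) \<phi>"
    using lower c by (intro mult_left_mono) auto
  also have "\<dots> = c * energy s u \<phi> + c * energy s h \<phi>"
    by (simp add: energy_add_left[OF u_energy h(1) \<phi>(1)] distrib_left)
  also have "c * energy s u \<phi> = (\<integral>x. G x * \<phi> x \<partial>lborel)" by (rule weak[OF \<phi>(1,3,4)])
  also have "\<dots> \<le> (\<integral>x. L * \<epsilon> * \<bar>\<phi> x\<bar> \<partial>lborel) / 2"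
  proof (rule nonlinearity_reflect_bound[OF \<mu> \<phi>(7,3,4,2)])
    show "0 \<le> \<phi> x" if "x \<bullet> e < \<mu>" for x using that by (simp add: \<phi>_eq)
    show "integrable lborel (\<lambda>x. L * \<epsilon> * \<bar>\<phi> x\<bar>)" using \<phi>(5) by simp
    show "(F x (u x) - F x (u (R \<mu> x))) * \<phi> x \<le> L * \<epsilon> * \<bar>\<phi> x\<bar>"
      if x: "x \<in> \<Omega>" "x \<bullet> e < \<mu>" "R \<mu> x \<noteq> 0" "0 < \<phi> x" for x
    proof -
      have v: "0 \<le> ?v x" "?v x < \<epsilon>" using supp[of x] x h(3)[of x] by auto
      have "- \<mu> \<le> norm x" using norm_ge[of x \<mu>] x by simp
      moreover have "u x \<le> M" "0 \<le> u x" "0 \<le> u (R \<mu> x)" using M(2)[of x] u_nonneg x by auto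
      ultimately have "\<bar>F x (u x) - F x (u (R \<mu> x))\<bar> \<le> L * \<bar>u x - u (R \<mu> x)\<bar>"
        using x v \<epsilon> by (intro lip) auto
      also have "\<dots> \<le> L * \<epsilon>" using v L by (intro mult_left_mono) auto
      finally have "F x (u x) - F x (u (R \<mu> x)) \<le> L * \<epsilon>" by simp
      then show ?thesis using x by (simp add: mult_right_mono)
    qed
  qed (use L \<epsilon> \<phi>(2) in auto)
  also have "\<dots> = \<epsilon> * (L / 2) * I" by (simp add: I_def)
  also have "c * energy s h \<phi> \<le> c * (I * (2 * \<epsilon> * T))"
  proof -
    have "energy s h \<phi> \<le> (\<integral>x. \<bar>\<phi> x\<bar> \<partial>lborel) * (\<integral>t. 2 * \<epsilon> * ?m t * frac_kernel s t \<partial>lborel)"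
    \<comment> \<open>one-sided smoothness of the bump where \<open>\<phi> \<ge> 0\<close>, its distance from \<open>x\<close> where \<open>\<phi> \<le> 0\<close>\<close>
    proof (rule energy_le_second_difference[OF h(1,7) \<phi>(1,5,3)])
      have "integrable lborel (\<lambda>t. 2 * \<epsilon> * (?m t * frac_kernel s t))"
        by (intro integrable_mult_right integrable_frac_kernel_min_scaled s r)
      then show "integrable lborel (\<lambda>t. 2 * \<epsilon> * ?m t * frac_kernel s t)" by (simp only: mult.assoc)
      show "\<phi> x * (2 * h x - h (x + t) - h (x - t)) \<le> \<bar>\<phi> x\<bar> * (2 * \<epsilon> * ?m t)" for x t
      proof (cases "x \<bullet> e \<le> \<mu>")
        case True
        have "\<epsilon> * (2 * bump x0 r x - bump x0 r (x + t) - bump x0 r (x - t)) \<le> \<epsilon> * (2 * ?m t)"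
          using \<epsilon> bump_second_difference[OF r(1), of x0 x t] by (intro mult_left_mono) auto
        then have "2 * h x - h (x + t) - h (x - t) \<le> 2 * \<epsilon> * ?m t" by (simp add: h_def algebra_simps)
        moreover have "0 \<le> \<phi> x" using True by (simp add: \<phi>_eq)
        ultimately show ?thesis by (simp add: mult_left_mono)
      next
        case False
        have "0 \<le> \<phi> (R \<mu> x)" using False by (simp add: \<phi>_eq R_inner)
        then have neg: "\<phi> x \<le> 0" using \<phi>(2)[of x] by simp
        have x: "2 * r \<le> norm (x - x0)" using far[of x] False by simp
        then have hx: "h x = 0" using h(6)[of x] r(1) by simp
        have "\<epsilon> * (bump x0 r (x + t) + bump x0 r (x - t)) \<le> \<epsilon> * (2 * ?m t)"
          using \<epsilon> bump_far[OF r(1) x, of t] bump_far[OF r(1) x, of "- t"] by (intro mult_left_mono) auto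
        then have "h (x + t) + h (x - t) \<le> 2 * \<epsilon> * ?m t" by (simp add: h_def algebra_simps)
        then have "- (2 * h x - h (x + t) - h (x - t)) \<le> 2 * \<epsilon> * ?m t" using hx by linarith
        then have "- \<phi> x * - (2 * h x - h (x + t) - h (x - t)) \<le> - \<phi> x * (2 * \<epsilon> * ?m t)"
          using neg by (intro mult_left_mono) auto
        then show ?thesis unfolding minus_mult_minus abs_of_nonpos[OF neg] .
      qed
    qed
    also have "(\<integral>t. 2 * \<epsilon> * ?m t * frac_kernel s t \<partial>lborel) = 2 * \<epsilon> * T"
      by (simp add: T_def mult.assoc)
    finally show ?thesis using c by (simp add: I_def)
  qed
  finally have "(c * (m * \<kappa> * a) / 4) * I \<le> (\<epsilon> * (L / 2 + 2 * c * T)) * I"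
    by (simp add: algebra_simps)
  moreover have I0: "0 \<le> I" unfolding I_def by (intro integral_nonneg_AE) auto
  ultimately have "I = 0" using \<epsilon>D by (smt (verit) mult_strict_right_mono)
  then have "AE x in lborel. \<bar>\<phi> x\<bar> = 0"
    unfolding I_def using integral_nonneg_eq_0_iff_AE[of lborel "\<lambda>x. \<bar>\<phi> x\<bar>"] \<phi>(5) by simp
  then have "AE x in lborel. \<phi> x = 0" by simp
  moreover have "continuous_on ?W ?z"
  proof -
    have ch: "continuous_on S h" for S unfolding h_def by (intro continuous_intros continuous_on_bump)
    have "continuous_on ?W (\<lambda>x. (u x - u (R \<mu> x)) + (h x - h (R \<mu> x)))"
      by (intro continuous_on_add continuous_on_u_diff[OF \<mu>] continuous_on_diff ch
          continuous_on_compose2[OF ch[of UNIV] continuous_on_hyp_reflect[OF continuous_on_id]]) auto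
    then show ?thesis by (simp add: algebra_simps)
  qed
  ultimately have "?z x0 \<le> 0"
    using x0 unfolding \<phi>_def by (intro odd_positive_part_AE_zero)
  moreover have "h x0 = \<epsilon>" by (simp add: h_def)
  ultimately show False using touch hR[of x0] x0 \<epsilon> by simp
qed

section \<open>Moving the plane\<close>

lemma tendsto_u_reflect:
  assumes lim: "(\<nu> \<longlongrightarrow> \<mu>) net" and x: "R \<mu> x \<noteq> 0"
  shows "((\<lambda>i. u (R (\<nu> i) x)) \<longlongrightarrow> u (R \<mu> x)) net"
proof -
  have "isCont u (R \<mu> x)"
    using continuous_on_eq_continuous_at[of "- {0}" u] u_cont x by auto
  moreover have "((\<lambda>i. R (\<nu> i) x) \<longlongrightarrow> R \<mu> x) net"
    unfolding hyp_reflect_def by (intro tendsto_intros lim)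
  ultimately show ?thesis by (rule isCont_tendsto_compose)
qed

lemma order_at_limit:
  assumes below: "\<And>\<mu> x. \<mu> < m \<Longrightarrow> x \<bullet> e < \<mu> \<Longrightarrow> R \<mu> x \<noteq> 0 \<Longrightarrow> u x \<le> u (R \<mu> x)"
    and x: "x \<bullet> e < m" "R m x \<noteq> 0"
  shows "u x \<le> u (R m x)"
proof (rule tendsto_lowerbound)
  have lim: "((\<lambda>\<mu>. \<mu>) \<longlongrightarrow> m) (at_left m)" by (rule tendsto_ident_at)
  show "((\<lambda>\<mu>. u (R \<mu> x)) \<longlongrightarrow> u (R m x)) (at_left m)"
    by (rule tendsto_u_reflect[OF lim x(2)])
  have "((\<lambda>\<mu>. R \<mu> x) \<longlongrightarrow> R m x) (at_left m)"
    unfolding hyp_reflect_def by (intro tendsto_intros lim)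
  then have "eventually (\<lambda>\<mu>. R \<mu> x \<noteq> 0) (at_left m)"
    using x(2) by (rule tendsto_imp_eventually_ne)
  moreover have "eventually (\<lambda>\<mu>. \<mu> \<in> {x \<bullet> e<..<m}) (at_left m)"
    by (rule eventually_at_leftI[OF _ x(1)])
  ultimately show "eventually (\<lambda>\<mu>. u x \<le> u (R \<mu> x)) (at_left m)"
    by eventually_elim (use below in auto)
qed simp

text \<open>
  The infimum \<open>m\<close> of the bad positions is itself good, by continuity, and the strict
  inequality there makes the overlaps at nearby bad positions have small measure.
\<close>
lemma reflection_order:
  assumes \<mu>: "\<mu> < 0" and x: "x \<bullet> e < \<mu>" "R \<mu> x \<noteq> 0"
  shows "u x \<le> u (R \<mu> x)"
proof (rule ccontr)
  define S where "S = {\<mu>. \<mu> < 0 \<and> (\<exists>x. x \<bullet> e < \<mu> \<and> R \<mu> x \<noteq> 0 \<and> u (R \<mu> x) < u x)}"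
  assume "\<not> u x \<le> u (R \<mu> x)"
  then have \<mu>S: "\<mu> \<in> S" using \<mu> x by (auto simp: S_def)
  obtain b where b: "\<And>x. x \<in> \<Omega> \<Longrightarrow> norm x \<le> b" using dom(2) by (auto simp: bounded_iff)
  have "- b \<le> \<nu>" if \<nu>S: "\<nu> \<in> S" for \<nu>
  proof -
    obtain y where y: "y \<bullet> e < \<nu>" "u (R \<nu> y) < u y" using \<nu>S by (auto simp: S_def)
    then have "y \<in> \<Omega>" using overlap_subset[of \<nu>] by (auto simp: overlap_def)
    then have "- b \<le> y \<bullet> e" using b[of y] Cauchy_Schwarz_ineq2[of y e] e by auto
    then show ?thesis using y by simp
  qed
  then have bdd: "bdd_below S" by (intro bdd_belowI)
  define m where "m = Inf S"
  have m: "m < 0" using cInf_lower[OF \<mu>S bdd] \<mu> by (simp add: m_def)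
  have below: "u x \<le> u (R \<nu> x)" if "\<nu> < m" "x \<bullet> e < \<nu>" "R \<nu> x \<noteq> 0" for \<nu> x
    using that m cInf_lower[OF _ bdd, of \<nu>] by (force simp: S_def m_def)
  have order_m: "u x \<le> u (R m x)" if "x \<bullet> e < m" "R m x \<noteq> 0" for x
    using order_at_limit[OF below that] .
  obtain \<delta> where \<delta>: "0 < \<delta>" and principle: "\<And>\<nu> x. \<nu> \<le> m / 2 \<Longrightarrow> emeasure lborel (overlap \<nu>) \<le> ennreal \<delta> \<Longrightarrow>
      x \<bullet> e < \<nu> \<Longrightarrow> R \<nu> x \<noteq> 0 \<Longrightarrow> u x \<le> u (R \<nu> x)"
    using small_overlap_principle[of "m / 2"] m by auto
  \<comment> \<open>bad positions that tend to \<open>m\<close> and stay below \<open>m / 2 < 0\<close>, where \<open>\<delta>\<close> is uniform\<close>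
  have "\<exists>\<nu>\<in>S. \<nu> < m + min (1 / real (Suc n)) (- m / 2)" for n
    using cInf_lessD[of S "m + min (1 / real (Suc n)) (- m / 2)"] \<mu>S m by (auto simp: m_def)
  then obtain \<nu> where \<nu>: "\<And>n. \<nu> n \<in> S" "\<And>n. \<nu> n < m + min (1 / real (Suc n)) (- m / 2)" by metis
  have \<nu>_ge: "m \<le> \<nu> n" for n using cInf_lower[OF \<nu>(1) bdd] by (simp add: m_def)
  have \<nu>_le: "\<nu> n \<le> m / 2" "\<nu> n \<le> m + 1 / real (Suc n)" for n
    using \<nu>(2)[of n] min.cobounded1[of "1 / real (Suc n)" "- m / 2"] min.cobounded2[of "1 / real (Suc n)" "- m / 2"]
    by linarith+
  have lim: "\<nu> \<longlonglongrightarrow> m"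
  proof (rule tendsto_sandwich[of "\<lambda>_. m" _ _ "\<lambda>n. m + 1 / real (Suc n)"])
    show "(\<lambda>n. m + 1 / real (Suc n)) \<longlonglongrightarrow> m"
      using tendsto_add[OF tendsto_const LIMSEQ_Suc[OF lim_1_over_n], of m] by simp
  qed (use \<nu>_ge \<nu>_le in \<open>auto intro: always_eventually\<close>)
  have [measurable]: "\<Omega> \<in> sets borel" using dom by auto
  have large: "\<delta> < measure lborel (overlap (\<nu> n))" for n
  proof (rule ccontr)
    assume small: "\<not> \<delta> < measure lborel (overlap (\<nu> n))"
    have "emeasure lborel (overlap (\<nu> n)) < \<infinity>"
      using dom overlap_subset by (intro emeasure_bounded_finite) (auto intro: bounded_subset)
    then have "emeasure lborel (overlap (\<nu> n)) \<le> ennreal \<delta>"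
      using small by (simp add: emeasure_eq_ennreal_measure ennreal_leI)
    with principle[OF \<nu>_le(1)] \<nu>(1)[of n] show False by (force simp: S_def)
  qed
  have pointwise: "AE x in lborel. (\<lambda>n. indicat_real (overlap (\<nu> n)) x) \<longlonglongrightarrow> 0"
  proof -
    have "{x::real^'n. e \<bullet> x = m} \<in> null_sets lebesgue"
      using negligible_hyperplane[of e m] e m by (simp add: negligible_iff_null_sets)
    then have "AE x::real^'n in lebesgue. x \<notin> {x. e \<bullet> x = m}" by (rule AE_not_in)
    then have "AE x::real^'n in lborel. x \<notin> {x. e \<bullet> x = m}" by (simp only: AE_completion_iff)
    then show ?thesis
      using AE_reflect_nonzero[of m]
    proof eventually_elim
      case (elim x)
      have "eventually (\<lambda>n. x \<notin> overlap (\<nu> n)) sequentially"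
      proof (cases "x \<bullet> e < m")
        case True
        show ?thesis
        proof (cases "x \<in> \<Omega>")
          case True
          then have "u x < u (R m x)"
            using strong_maximum_principle[OF m order_m _ \<open>x \<bullet> e < m\<close>] elim by blast
          then have "eventually (\<lambda>n. u x < u (R (\<nu> n) x)) sequentially"
            using tendsto_u_reflect[OF lim, of x] elim by (intro order_tendstoD) auto
          then show ?thesis by eventually_elim (auto simp: overlap_def)
        qed (use overlap_subset in \<open>auto intro: always_eventually\<close>)
      next
        case False
        then have "m < x \<bullet> e" using elim by (auto simp: inner_commute)
        then have "eventually (\<lambda>n. \<nu> n < x \<bullet> e) sequentially"
          using lim by (intro order_tendstoD)
        then show ?thesis by eventually_elim (auto simp: overlap_def)
      qed
      then show ?case
        by (intro tendsto_eventually) (auto elim: eventually_mono)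
    qed
  qed
  have "(\<lambda>n. \<integral>x. indicat_real (overlap (\<nu> n)) x \<partial>lborel) \<longlonglongrightarrow> (\<integral>x. 0 \<partial>(lborel :: (real^'n) measure))"
  proof (rule integral_dominated_convergence[where w = "indicat_real \<Omega>"])
    show "integrable lborel (indicat_real \<Omega>)"
      using emeasure_bounded_finite[OF dom(2)] by (intro integrable_real_indicator) auto
    show "AE x in lborel. norm (indicat_real (overlap (\<nu> n)) x) \<le> indicat_real \<Omega> x" for n
      using overlap_subset by (auto split: split_indicator)
  qed (use pointwise in auto)
  then have "(\<lambda>n. measure lborel (overlap (\<nu> n))) \<longlonglongrightarrow> 0" by simp
  then have "\<delta> \<le> 0" using large by (intro tendsto_lowerbound[of _ 0 sequentially \<delta>]) (auto intro: always_eventually less_imp_le)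
  then show False using \<delta> by simp
qed

lemma reflection_strict:
  assumes "\<mu> < 0" "x \<in> \<Omega>" "x \<bullet> e < \<mu>" "R \<mu> x \<noteq> 0"
  shows "u x < u (R \<mu> x)"
  using strong_maximum_principle[OF assms(1) reflection_order assms(2-)] assms(1) by blast

lemma reflection_order_0:
  assumes x: "x \<bullet> e < 0"
  shows "u x \<le> u (R 0 x)"
proof (rule order_at_limit[OF reflection_order x])
  have "norm (R 0 x) = norm x" using e by simp
  then show "R 0 x \<noteq> 0" using x by auto
qed

end

section \<open>Weak solutions\<close>

text \<open>
  Allows changing the value of the solution at the origin inside double integrals.
\<close>
lemma AE_lborel_pair_nonzero:
  "AE z in (lborel :: ('a::euclidean_space \<times> 'b::euclidean_space) measure). fst z \<noteq> 0 \<and> snd z \<noteq> 0"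
proof -
  have "{0} \<times> UNIV \<in> null_sets (lborel \<Otimes>\<^sub>M lborel :: ('a \<times> 'b) measure)" "UNIV \<times> {0} \<in> null_sets (lborel \<Otimes>\<^sub>M lborel :: ('a \<times> 'b) measure)"
    by (auto simp: null_sets_def lborel.emeasure_pair_measure_Times)
  then have "AE z in (lborel :: ('a \<times> 'b) measure). z \<notin> {0} \<times> UNIV" "AE z in (lborel :: ('a \<times> 'b) measure). z \<notin> UNIV \<times> {0}"
    unfolding lborel_prod by (auto dest: AE_not_in)
  then show ?thesis by eventually_elim auto
qed

lemma reflect_in_domain:
  assumes e: "norm e = 1" and conv: "convex_in_direction e \<Omega>" and symm: "symmetric_in_direction e \<Omega>"
    and x: "x \<in> \<Omega>" "x \<bullet> e < \<mu>" "\<mu> < 0"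
  shows "hyp_reflect e \<mu> x \<in> \<Omega>"
proof -
  have "hyp_reflect e 0 x \<in> \<Omega>" using symm x(1) by (auto simp: symmetric_in_direction_def)
  then have "x + (- 2 * (x \<bullet> e)) *\<^sub>R e \<in> \<Omega>" by (simp add: hyp_reflect_def)
  with conv x(1) have seg: "closed_segment x (x + (- 2 * (x \<bullet> e)) *\<^sub>R e) \<subseteq> \<Omega>"
    unfolding convex_in_direction_def by blast
  \<comment> \<open>position of the reflected point on the segment from \<open>x\<close> to its mirror image in \<open>x \<bullet> e = 0\<close>\<close>
  define \<tau> where "\<tau> = (\<mu> - x \<bullet> e) / - (x \<bullet> e)"
  have \<tau>: "0 \<le> \<tau>" "\<tau> \<le> 1" "\<tau> * (- 2 * (x \<bullet> e)) = 2 * (\<mu> - x \<bullet> e)"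
    using x by (auto simp: \<tau>_def divide_simps)
  have "hyp_reflect e \<mu> x = x + (\<tau> * (- 2 * (x \<bullet> e))) *\<^sub>R e" unfolding \<tau>(3) hyp_reflect_def ..
  also have "\<dots> = (1 - \<tau>) *\<^sub>R x + \<tau> *\<^sub>R (x + (- 2 * (x \<bullet> e)) *\<^sub>R e)"
    by (simp add: algebra_simps)
  also have "\<dots> \<in> closed_segment x (x + (- 2 * (x \<bullet> e)) *\<^sub>R e)"
    using \<tau> unfolding closed_segment_def by blast
  finally show ?thesis using seg by blast
qed

text \<open>
  The solution is continuous on the closure of \<open>\<Omega>\<close> minus the origin and vanishes outside \<open>\<Omega>\<close>, so it is continuous
  away from the origin and in particular Borel measurable. All integrals can then be taken with respect to
  \<open>lborel\<close>. The integral over \<open>Q\<close> equals that over the whole space, as both factors vanish on the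
  complement.
\<close>
lemma weak_solution_moving_plane_problem:
  fixes u :: "real^'n \<Rightarrow> real" and e :: "real^'n"
  assumes s: "0 < s" "s < 1" and dom: "open \<Omega>" "bounded \<Omega>" "0 \<in> \<Omega>"
    and cont: "continuous_on (closure \<Omega> - {0}) u" and sol: "weak_solution k s \<Omega> g f u"
    and e: "norm e = 1" and conv: "convex_in_direction e \<Omega>" and symm: "symmetric_in_direction e \<Omega>"
    and mono: "reflection_monotone e \<Omega> f" and g: "\<forall>t\<ge>0. 0 \<le> g t"
    and f_lip: "loc_lipschitz_snd \<Omega> f" and g_lip: "loc_lipschitz g"
  obtains G where "moving_plane_problem s (frac_const k s / 2) \<Omega> (\<lambda>x t. g t / norm x powr (2 * s) + f x t)
      (\<lambda>x. if x = 0 then 0 else u x) G e"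
proof -
  define u' where "u' x = (if x = 0 then 0 else u x)" for x
  define F where "F x t = g t / norm x powr (2 * s) + f x t" for x t
  have u_pos: "\<And>x. x \<in> \<Omega> - {0} \<Longrightarrow> 0 < u x" and u_out: "\<And>x. x \<notin> \<Omega> \<Longrightarrow> u x = 0"
    and uHs: "u \<in> Hs s"
    and int_g: "set_integrable lebesgue \<Omega> (\<lambda>x. g (u x) / norm x powr (2 * s))"
    and int_f: "set_integrable lebesgue \<Omega> (\<lambda>x. f x (u x))"
    using sol by (auto simp: weak_solution_def Hs0_def)
  have cont': "continuous_on (- {0}) u"
  proof -
    have eq: "(closure \<Omega> - {0}) \<union> - \<Omega> = - {0}" using closure_subset[of \<Omega>] dom(3) by auto
    have "continuous_on ((closure \<Omega> - {0}) \<union> - \<Omega>) u"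
    proof (rule continuous_on_Un_local)
      show "closedin (top_of_set ((closure \<Omega> - {0}) \<union> - \<Omega>)) (closure \<Omega> - {0})"
        unfolding eq using closedin_closed_Int[OF closed_closure[of \<Omega>], of "- {0}"] by (simp add: Diff_eq Int_commute)
      have "- \<Omega> = - {0} \<inter> - \<Omega>" using dom(3) by auto
      then show "closedin (top_of_set ((closure \<Omega> - {0}) \<union> - \<Omega>)) (- \<Omega>)"
        unfolding eq using closedin_closed_Int[of "- \<Omega>" "- {0}"] dom(1) by (metis closed_Compl)
      show "continuous_on (- \<Omega>) u"
        using u_out by (subst continuous_on_cong[OF refl, of _ _ "\<lambda>_. 0"]) auto
    qed (rule cont)
    then show ?thesis unfolding eq .
  qed
  have u'_cont: "continuous_on (- {0}) u'"
    using cont' by (subst continuous_on_cong[OF refl, of _ _ u]) (auto simp: u'_def)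
  have u'm[measurable]: "u' \<in> borel_measurable borel"
  proof -
    have "(\<lambda>x. indicator (- {0}) x *\<^sub>R u' x) \<in> borel_measurable borel"
      by (intro borel_measurable_continuous_on_indicator u'_cont) auto
    moreover have "(\<lambda>x. indicator (- {0}) x *\<^sub>R u' x) = u'"
      by (auto simp: fun_eq_iff u'_def split: split_indicator)
    ultimately show ?thesis by simp
  qed
  have um[measurable]: "u \<in> borel_measurable borel"
  proof -
    have "(\<lambda>x. u' x + indicat_real {0} x * u 0) = u" by (auto simp: fun_eq_iff u'_def)
    moreover have "(\<lambda>x. u' x + indicat_real {0} x * u 0) \<in> borel_measurable borel" by measurable
    ultimately show ?thesis by simp
  qed
  have \<Omega>m[measurable]: "\<Omega> \<in> sets borel" using dom by auto
  have leb: "\<phi> \<in> borel_measurable lebesgue" if "\<phi> \<in> borel_measurable borel" for \<phi> :: "'b::euclidean_space \<Rightarrow> real"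
    using that by (intro measurable_completion) simp
  have AE2: "AE z in lebesgue. fst z \<noteq> (0::real^'n) \<and> snd z \<noteq> (0::real^'n)"
    using AE_lborel_pair_nonzero by (rule AE_completion)
  let ?E = "\<lambda>a b. \<lambda>(x, y). (a x - a y) * (b x - b y) * frac_kernel s (x - y)"
  have Em: "?E a b \<in> borel_measurable borel" if "a \<in> borel_measurable borel" "b \<in> borel_measurable borel" for a b :: "real^'n \<Rightarrow> real"
    using that by (rule measurable_energy_integrand)
  have u'_energy: "finite_energy s u'"
  proof -
    have "integrable lebesgue (?E u u)"
      using uHs by (simp add: Hs_def frac_kernel_def power2_eq_square)
    moreover have "AE z in lebesgue. ?E u u z = ?E u' u' z"
      using AE2 by eventually_elim (auto simp: u'_def)
    ultimately have "integrable lebesgue (?E u' u')"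
      using Em[OF um um] Em[OF u'm u'm] by (subst integrable_cong_AE[where g = "?E u u"]) (auto intro: leb)
    then have "integrable lborel (?E u' u')"
      using Em[OF u'm u'm] by (subst (asm) integrable_completion) auto
    then show ?thesis using u'm by (simp add: finite_energy_def power2_eq_square)
  qed
  define Gr where "Gr x = indicat_real \<Omega> x * (g (u x) / norm x powr (2 * s) + f x (u x))" for x
  have Gr: "integrable lebesgue Gr"
  proof -
    have "integrable lebesgue (\<lambda>x. indicat_real \<Omega> x *\<^sub>R (g (u x) / norm x powr (2 * s)) + indicat_real \<Omega> x *\<^sub>R f x (u x))"
      using int_g int_f unfolding set_integrable_def by (rule Bochner_Integration.integrable_add)
    then show ?thesis by (simp add: Gr_def[abs_def] distrib_left)
  qed
  obtain G where G: "G \<in> borel_measurable lborel" "AE x in lborel. Gr x = G x"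
    using completion_ex_borel_measurable_real[OF borel_measurable_integrable[OF Gr]] by auto
  have "integrable lebesgue G"
    using G(1) by (intro integrable_cong_AE_imp[OF Gr leb AE_completion[OF G(2)]]) simp
  then have G_int: "integrable lborel G" using G(1) by (subst (asm) integrable_completion) auto
  have "moving_plane_problem s (frac_const k s / 2) \<Omega> F u' G e"
  proof
    show "0 < s" "s < 1" "0 < frac_const k s / 2" "norm e = 1" "open \<Omega>" "bounded \<Omega>" "0 \<in> \<Omega>"
      using s frac_const_pos[OF s, of k] e dom by auto
    show "hyp_reflect e 0 x \<in> \<Omega>" if "x \<in> \<Omega>" for x
      using symm that by (auto simp: symmetric_in_direction_def)
    show "hyp_reflect e \<mu> x \<in> \<Omega>" if "x \<in> \<Omega>" "x \<bullet> e < \<mu>" "\<mu> < 0" for x \<mu>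
      by (rule reflect_in_domain[OF e conv symm that])
    show "continuous_on (- {0}) u'" by (rule u'_cont)
    show "0 < u' x" if "x \<in> \<Omega>" "x \<noteq> 0" for x using that u_pos by (simp add: u'_def)
    show "u' x = 0" if "x \<notin> \<Omega>" for x using that u_out by (simp add: u'_def)
    show "u' 0 = 0" by (simp add: u'_def)
    show "finite_energy s u'" by (rule u'_energy)
    show "integrable lborel G" by (rule G_int)
    show "AE x in lborel. x \<in> \<Omega> \<longrightarrow> G x = F x (u' x)"
      using G(2) AE_lborel_singleton[of 0] by eventually_elim (auto simp: Gr_def F_def u'_def)
    show "frac_const k s / 2 * energy s u' \<phi> = (\<integral>x. G x * \<phi> x \<partial>lborel)"
      if \<phi>: "finite_energy s \<phi>" "\<And>x. \<bar>\<phi> x\<bar> \<le> B" "\<And>x. x \<notin> \<Omega> \<Longrightarrow> \<phi> x = 0" for \<phi> :: "real^'n \<Rightarrow> real" and B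
    proof -
      have \<phi>m[measurable]: "\<phi> \<in> borel_measurable borel" using \<phi>(1) by (rule finite_energy_measurable)
      have "integrable lborel (\<lambda>x. (\<phi> x)\<^sup>2)"
      proof (rule integrable_bounded_support[OF _ \<Omega>m dom(2)])
        show "\<bar>(\<phi> x)\<^sup>2\<bar> \<le> B\<^sup>2" for x using power_mono[OF \<phi>(2)[of x], of 2] by simp
      qed (use \<phi>(3) in auto)
      then have "integrable lebesgue (\<lambda>x. (\<phi> x)\<^sup>2)" by (subst integrable_completion) auto
      moreover have "integrable lebesgue (?E \<phi> \<phi>)"
        using \<phi>(1) Em[OF \<phi>m \<phi>m] by (subst integrable_completion) (auto simp: finite_energy_def power2_eq_square)
      ultimately have "\<phi> \<in> Hs0 s \<Omega> \<inter> Linfty"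
        using leb[OF \<phi>m] \<phi>(2,3)
        by (auto simp: Hs0_def Hs_def Linfty_def frac_kernel_def power2_eq_square intro!: exI[of _ B])
      then have "frac_const k s / 2 * set_lebesgue_integral lebesgue (- ((- \<Omega>) \<times> (- \<Omega>)))
            (\<lambda>(x, y). (u x - u y) * (\<phi> x - \<phi> y) / norm (x - y) powr (real CARD('n) + 2 * s))
        = set_lebesgue_integral lebesgue \<Omega> (\<lambda>x. g (u x) / norm x powr (2 * s) * \<phi> x)
          + set_lebesgue_integral lebesgue \<Omega> (\<lambda>x. f x (u x) * \<phi> x)"
        using sol unfolding weak_solution_def by blast
      also have "set_lebesgue_integral lebesgue (- ((- \<Omega>) \<times> (- \<Omega>)))
            (\<lambda>(x, y). (u x - u y) * (\<phi> x - \<phi> y) / norm (x - y) powr (real CARD('n) + 2 * s)) = integral\<^sup>L lebesgue (?E u \<phi>)"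
        unfolding set_lebesgue_integral_def
        by (intro Bochner_Integration.integral_cong) (auto simp: frac_kernel_def u_out \<phi>(3) split: split_indicator)
      also have "\<dots> = integral\<^sup>L lebesgue (?E u' \<phi>)"
      proof (rule integral_cong_AE)
        show "AE z in lebesgue. ?E u \<phi> z = ?E u' \<phi> z"
          using AE2 by eventually_elim (auto simp: u'_def)
      qed (auto intro: leb Em[OF um \<phi>m] Em[OF u'm \<phi>m])
      also have "\<dots> = energy s u' \<phi>"
        unfolding energy_def using Em[OF u'm \<phi>m] by (intro integral_completion) simp
      also have "set_lebesgue_integral lebesgue \<Omega> (\<lambda>x. g (u x) / norm x powr (2 * s) * \<phi> x)
          + set_lebesgue_integral lebesgue \<Omega> (\<lambda>x. f x (u x) * \<phi> x) = (\<integral>x. Gr x * \<phi> x \<partial>lebesgue)"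
      proof -
        have "integrable lebesgue (\<lambda>x. (indicat_real \<Omega> x *\<^sub>R (g (u x) / norm x powr (2 * s))) * \<phi> x)"
          "integrable lebesgue (\<lambda>x. (indicat_real \<Omega> x *\<^sub>R f x (u x)) * \<phi> x)"
          by (rule integrable_mult_bounded[OF int_g[unfolded set_integrable_def] leb[OF \<phi>m] \<phi>(2)],
              rule integrable_mult_bounded[OF int_f[unfolded set_integrable_def] leb[OF \<phi>m] \<phi>(2)])
        then show ?thesis
          unfolding set_lebesgue_integral_def
          by (subst Bochner_Integration.integral_add[symmetric])
             (auto simp: mult.assoc Gr_def algebra_simps intro!: Bochner_Integration.integral_cong)
      qed
      also have "\<dots> = (\<integral>x. G x * \<phi> x \<partial>lebesgue)"
      proof (rule integral_cong_AE)
        show "AE x in lebesgue. Gr x * \<phi> x = G x * \<phi> x"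
          using AE_completion[OF G(2)] by eventually_elim simp
      qed (use leb[OF \<phi>m] leb[of G] G(1) Gr in \<open>auto intro!: borel_measurable_times\<close>)
      also have "\<dots> = (\<integral>x. G x * \<phi> x \<partial>lborel)"
        using G(1) by (intro integral_completion) auto
      finally show ?thesis .
    qed
    show "F x t \<le> F (hyp_reflect e \<mu> x) t"
      if x: "\<mu> < 0" "x \<in> \<Omega>" "x \<bullet> e < \<mu>" "hyp_reflect e \<mu> x \<noteq> 0" "0 \<le> t" for \<mu> x t
    proof -
      have "f x t \<le> f (hyp_reflect e \<mu> x) t" using mono x unfolding reflection_monotone_def by blast
      moreover have "4 * \<mu> * (\<mu> - x \<bullet> e) \<le> 0" using x by (simp add: mult_le_0_iff)
      then have "(norm (hyp_reflect e \<mu> x))\<^sup>2 \<le> (norm x)\<^sup>2"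
        unfolding norm_hyp_reflect_sq[OF e] by linarith
      then have "norm (hyp_reflect e \<mu> x) \<le> norm x" by (simp add: power2_le_iff_abs_le)
      then have "norm (hyp_reflect e \<mu> x) powr (2 * s) \<le> norm x powr (2 * s)"
        using s by (intro powr_mono2) auto
      then have "g t / norm x powr (2 * s) \<le> g t / norm (hyp_reflect e \<mu> x) powr (2 * s)"
        by (intro frac_le) (use x g in simp_all)
      ultimately show ?thesis by (simp add: F_def)
    qed
    show "\<exists>L\<ge>0. \<forall>x\<in>\<Omega>. a \<le> norm x \<longrightarrow> (\<forall>t1\<in>{0..M}. \<forall>t2\<in>{0..M}. \<bar>F x t1 - F x t2\<bar> \<le> L * \<bar>t1 - t2\<bar>)"
      if M: "0 < M" and a: "0 < a" for M a
    proof -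
      obtain Lf where Lf: "\<And>x t1 t2. x \<in> \<Omega> \<Longrightarrow> t1 \<in> {0..M} \<Longrightarrow> t2 \<in> {0..M} \<Longrightarrow> \<bar>f x t1 - f x t2\<bar> \<le> Lf * \<bar>t1 - t2\<bar>"
        using f_lip M unfolding loc_lipschitz_snd_def by blast
      obtain Lg where Lg: "\<And>t1 t2. t1 \<in> {0..M} \<Longrightarrow> t2 \<in> {0..M} \<Longrightarrow> \<bar>g t1 - g t2\<bar> \<le> Lg * \<bar>t1 - t2\<bar>"
        using g_lip M unfolding loc_lipschitz_def by blast
      define L where "L = \<bar>Lg\<bar> / a powr (2 * s) + \<bar>Lf\<bar>"
      have "\<bar>F x t1 - F x t2\<bar> \<le> L * \<bar>t1 - t2\<bar>" if x: "x \<in> \<Omega>" "a \<le> norm x" and t: "t1 \<in> {0..M}" "t2 \<in> {0..M}" for x t1 t2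
      proof -
        have "\<bar>g t1 - g t2\<bar> \<le> \<bar>Lg\<bar> * \<bar>t1 - t2\<bar>"
          using Lg[OF t] by (rule order_trans) (intro mult_right_mono, auto)
        moreover have "a powr (2 * s) \<le> norm x powr (2 * s)" using x a s by (intro powr_mono2) auto
        ultimately have "\<bar>g t1 - g t2\<bar> / norm x powr (2 * s) \<le> (\<bar>Lg\<bar> * \<bar>t1 - t2\<bar>) / a powr (2 * s)"
          using a by (intro frac_le) auto
        moreover have "\<bar>f x t1 - f x t2\<bar> \<le> \<bar>Lf\<bar> * \<bar>t1 - t2\<bar>"
          using Lf[OF x(1) t] by (rule order_trans) (intro mult_right_mono, auto)
        moreover have "\<bar>F x t1 - F x t2\<bar> \<le> \<bar>g t1 - g t2\<bar> / norm x powr (2 * s) + \<bar>f x t1 - f x t2\<bar>"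
        proof -
          have "F x t1 - F x t2 = (g t1 - g t2) / norm x powr (2 * s) + (f x t1 - f x t2)"
            by (simp add: F_def diff_divide_distrib)
          also have "\<bar>\<dots>\<bar> \<le> \<bar>(g t1 - g t2) / norm x powr (2 * s)\<bar> + \<bar>f x t1 - f x t2\<bar>" by (rule abs_triangle_ineq)
          finally show ?thesis by simp
        qed
        ultimately show ?thesis by (simp add: L_def distrib_right)
      qed
      moreover have "0 \<le> L" by (simp add: L_def)
      ultimately show ?thesis by blast
    qed
  qed
  then show thesis using that unfolding F_def[abs_def] u'_def[abs_def] by blast
qed

section \<open>Symmetry and monotonicity\<close>

lemma hyp_reflect_uminus: "hyp_reflect (- e) \<mu> x = hyp_reflect e (- \<mu>) x"
  by (simp add: hyp_reflect_def algebra_simps)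

text \<open>
  Since \<open>f\<close> is even in the direction \<open>e\<close>, the monotonicity on one side of the plane of symmetry carries over to the
  other by conjugation with the reflection in that plane.
\<close>
lemma reflection_monotone_uminus:
  assumes e: "norm e = 1" and conv: "convex_in_direction e \<Omega>" and symm: "symmetric_in_direction e \<Omega>"
    and mono: "reflection_monotone e \<Omega> f"
  shows "reflection_monotone (- e) \<Omega> f"
proof -
  let ?R = "hyp_reflect e"
  have R0: "?R 0 x \<in> \<Omega>" if "x \<in> \<Omega>" for x
    using symm that by (auto simp: symmetric_in_direction_def)
  have inv: "?R \<mu> (?R \<mu> x) = x" for \<mu> x by (rule hyp_reflect_involution[OF e])
  have even: "f (?R 0 x) t = f x t" if "x \<in> \<Omega>" "0 \<le> t" for x t
  proof -
    consider "x \<bullet> e < 0" | "?R 0 x \<bullet> e < 0" | "x \<bullet> e = 0" by (fastforce simp: hyp_reflect_inner[OF e])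
    then show ?thesis
    proof cases
      case 1
      then show ?thesis using mono that unfolding reflection_monotone_def by metis
    next
      case 2
      then have "f (?R 0 x) t = f (?R 0 (?R 0 x)) t" using mono that R0[OF that(1)] unfolding reflection_monotone_def by blast
      then show ?thesis by (simp add: inv)
    qed (simp add: hyp_reflect_def)
  qed
  have "f x t \<le> f (?R (- \<mu>) x) t" if x: "x \<in> \<Omega>" "- (x \<bullet> e) < \<mu>" "\<mu> < 0" "0 \<le> t" for x \<mu> t
  proof -
    have x': "?R 0 x \<in> \<Omega>" "?R 0 x \<bullet> e < \<mu>" using x R0 by (auto simp: hyp_reflect_inner[OF e])
    have y: "?R \<mu> (?R 0 x) \<in> \<Omega>" by (rule reflect_in_domain[OF e conv symm x' x(3)])
    have comp: "?R (- \<mu>) x = ?R 0 (?R \<mu> (?R 0 x))"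
      using e by (simp add: hyp_reflect_def inner_add_left norm_eq_1 algebra_simps flip: scaleR_add_left)
    have "f x t = f (?R 0 x) t" using even x by simp
    also have "\<dots> \<le> f (?R \<mu> (?R 0 x)) t" using mono x' x unfolding reflection_monotone_def by blast
    also have "\<dots> = f (?R (- \<mu>) x) t" unfolding comp using even[OF y] x by simp
    finally show ?thesis .
  qed
  then show ?thesis
    unfolding reflection_monotone_def hyp_reflect_uminus using even by auto
qed

lemma convex_in_direction_uminus: "convex_in_direction (- e) \<Omega> \<longleftrightarrow> convex_in_direction e \<Omega>"
proof -
  have "convex_in_direction (- e) \<Omega>" if "convex_in_direction e \<Omega>" for e
    unfolding convex_in_direction_def
  proof (intro ballI allI impI)
    fix x t assume x: "x \<in> \<Omega>" "x + t *\<^sub>R - e \<in> \<Omega>"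
    then show "closed_segment x (x + t *\<^sub>R - e) \<subseteq> \<Omega>"
      using that[unfolded convex_in_direction_def, rule_format, of x "- t"] by simp
  qed
  from this[of e] this[of "- e"] show ?thesis by auto
qed

text \<open>
  The inequality between \<open>u\<close> and its reflection in the limiting plane \<open>x \<bullet> e = 0\<close> holds for both directions
  \<open>e\<close> and \<open>- e\<close>, hence with equality. For the strict monotonicity take the plane halfway between the two points.
\<close>
lemma symmetric_and_monotone_in_direction:
  fixes u :: "real^'n \<Rightarrow> real" and e :: "real^'n"
  assumes s: "0 < s" "s < 1" and dom: "open \<Omega>" "bounded \<Omega>" "0 \<in> \<Omega>"
    and cont: "continuous_on (closure \<Omega> - {0}) u" and sol: "weak_solution k s \<Omega> g f u"
    and e: "norm e = 1" and conv: "convex_in_direction e \<Omega>" and symm: "symmetric_in_direction e \<Omega>"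
    and mono: "reflection_monotone e \<Omega> f" and g: "\<forall>t\<ge>0. 0 \<le> g t"
    and f_lip: "loc_lipschitz_snd \<Omega> f" and g_lip: "loc_lipschitz g"
  shows "u (hyp_reflect e 0 x) = u x"
    and "x \<in> \<Omega> \<Longrightarrow> 0 < t \<Longrightarrow> (x + t *\<^sub>R e) \<bullet> e < 0 \<Longrightarrow> u x < u (x + t *\<^sub>R e)"
proof -
  obtain G where "moving_plane_problem s (frac_const k s / 2) \<Omega> (\<lambda>x t. g t / norm x powr (2 * s) + f x t)
      (\<lambda>x. if x = 0 then 0 else u x) G e"
    by (rule weak_solution_moving_plane_problem[OF s dom cont sol e conv symm mono g f_lip g_lip])
  then interpret P: moving_plane_problem s "frac_const k s / 2" \<Omega> "\<lambda>x t. g t / norm x powr (2 * s) + f x t"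
      "\<lambda>x. if x = 0 then 0 else u x" G e .
  have symm': "symmetric_in_direction (- e) \<Omega>"
    using symm by (simp add: symmetric_in_direction_def hyp_reflect_uminus[abs_def])
  have e': "norm (- e) = 1" using e by simp
  obtain G' where "moving_plane_problem s (frac_const k s / 2) \<Omega> (\<lambda>x t. g t / norm x powr (2 * s) + f x t)
      (\<lambda>x. if x = 0 then 0 else u x) G' (- e)"
    by (rule weak_solution_moving_plane_problem[OF s dom cont sol e'
          convex_in_direction_uminus[THEN iffD2, OF conv] symm' reflection_monotone_uminus[OF e conv symm mono] g f_lip g_lip])
  then interpret N: moving_plane_problem s "frac_const k s / 2" \<Omega> "\<lambda>x t. g t / norm x powr (2 * s) + f x t"
      "\<lambda>x. if x = 0 then 0 else u x" G' "- e" .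
  have R0: "hyp_reflect e 0 x = 0 \<longleftrightarrow> x = 0" for x
    using norm_hyp_reflect_0[OF e, of x] by (metis norm_eq_zero)
  have inv: "hyp_reflect e 0 (hyp_reflect e 0 x) = x" for x by (rule hyp_reflect_involution[OF e])
  have half: "u (hyp_reflect e 0 x) = u x" if x: "x \<bullet> e < 0" for x
  proof (rule antisym)
    have x0: "x \<noteq> 0" using x by auto
    show "u x \<le> u (hyp_reflect e 0 x)"
      using P.reflection_order_0[OF x] x0 R0[of x] by simp
    have "hyp_reflect e 0 x \<bullet> - e < 0" using x by (simp add: hyp_reflect_inner[OF e])
    from N.reflection_order_0[OF this] show "u (hyp_reflect e 0 x) \<le> u x"
      using x0 R0[of x] by (simp add: hyp_reflect_uminus inv)
  qed
  consider "x \<bullet> e < 0" | "hyp_reflect e 0 x \<bullet> e < 0" | "x \<bullet> e = 0" by (fastforce simp: hyp_reflect_inner[OF e])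
  then show "u (hyp_reflect e 0 x) = u x"
  proof cases
    case 1
    then show ?thesis by (rule half)
  next
    case 2
    then show ?thesis using half[OF 2] by (simp add: inv)
  qed (simp add: hyp_reflect_def)
  show "u x < u (x + t *\<^sub>R e)" if x: "x \<in> \<Omega>" "0 < t" "(x + t *\<^sub>R e) \<bullet> e < 0"
  proof -
    let ?\<mu> = "x \<bullet> e + t / 2"
    have R: "hyp_reflect e ?\<mu> x = x + t *\<^sub>R e" by (simp add: hyp_reflect_def)
    have xe: "x \<bullet> e + t < 0" using x(3) e by (simp add: inner_add_left norm_eq_1)
    have ne: "x \<noteq> 0" "x + t *\<^sub>R e \<noteq> 0" using xe x(2,3) by auto
    have "?\<mu> < 0" "x \<bullet> e < ?\<mu>" using xe x(2) by auto
    from P.reflection_strict[OF this(1) x(1) this(2)] show ?thesis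
      using ne by (simp add: R)
  qed
qed

theorem theorem1p1:
  fixes s :: real
    and k :: "'n::finite"
    and \<Omega> :: "(real^'n) set"
    and f :: "real^'n \<Rightarrow> real \<Rightarrow> real"
    and g :: "real \<Rightarrow> real"
    and u :: "real^'n \<Rightarrow> real"
  assumes "0 < s" and "s < 1" and "real CARD('n) > 2 * s"
    and "bounded_smooth_domain \<Omega>" and "0 \<in> \<Omega>"
    and "continuous_on (closure \<Omega> - {0}) u"
    and "weak_solution k s \<Omega> g f u"
    and "convex_in_direction (axis k 1) \<Omega>"
    and "symmetric_in_direction (axis k 1) \<Omega>"
    and "reflection_monotone (axis k 1) \<Omega> f"
    and "\<forall>t\<ge>0. 0 \<le> g t"
    and "hypothesis_a \<Omega> f g \<or> hypothesis_b \<Omega> f g"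
  shows "(\<forall>x. u (hyp_reflect (axis k 1) 0 x) = u x) \<and>
    (\<forall>x\<in>\<Omega>. \<forall>y\<in>\<Omega>. (\<forall>i. i \<noteq> k \<longrightarrow> x $ i = y $ i) \<and> x $ k < y $ k \<and> y $ k < 0 \<longrightarrow> u x < u y) \<and>
    (\<forall>R>0. \<Omega> = ball 0 R \<and> (\<forall>e. norm e = 1 \<longrightarrow> reflection_monotone e \<Omega> f) \<longrightarrow>
       (\<forall>x y. norm x = norm y \<longrightarrow> u x = u y) \<and>
       (\<forall>x\<in>\<Omega>. \<forall>y\<in>\<Omega>. 0 < norm x \<and> norm x < norm y \<longrightarrow> u y < u x))"
proof -
  let ?e = "axis k 1 :: real^'n"
  have dom: "open \<Omega>" "bounded \<Omega>" using assms(4) by (auto simp: bounded_smooth_domain_def)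
  have lip: "loc_lipschitz_snd \<Omega> f" "loc_lipschitz g"
    using assms(12) by (auto simp: hypothesis_a_def hypothesis_b_def)
  have e1: "norm ?e = 1" by simp
  have xe: "x \<bullet> ?e = x $ k" for x by (simp add: inner_axis)
  note main = symmetric_and_monotone_in_direction[OF assms(1,2) dom assms(5,6,7) _ _ _ _ assms(11) lip]
  have sym: "u (hyp_reflect ?e 0 x) = u x" for x
    by (rule main(1)[OF e1 assms(8,9,10)])
  have incr: "u x < u y" if "x \<in> \<Omega>" "\<And>i. i \<noteq> k \<Longrightarrow> x $ i = y $ i" "x $ k < y $ k" "y $ k < 0" for x y
  proof -
    have "y = x + (y $ k - x $ k) *\<^sub>R ?e"
      using that(2) by (auto simp: vec_eq_iff axis_def)
    then show ?thesis
      using main(2)[OF e1 assms(8,9,10), of x "y $ k - x $ k"] that by (simp add: xe)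
  qed
  have radial: "(\<forall>x y. norm x = norm y \<longrightarrow> u x = u y) \<and>
       (\<forall>x\<in>\<Omega>. \<forall>y\<in>\<Omega>. 0 < norm x \<and> norm x < norm y \<longrightarrow> u y < u x)"
    if R: "0 < R" "\<Omega> = ball 0 R" and mono: "\<And>e. norm e = 1 \<Longrightarrow> reflection_monotone e \<Omega> f" for R
  proof -
    have conv: "convex_in_direction e \<Omega>" for e
      unfolding convex_in_direction_def R(2) using closed_segment_subset[OF _ _ convex_ball] by blast
    have symm: "symmetric_in_direction e \<Omega>" if e: "norm e = 1" for e
    proof -
      have "hyp_reflect e 0 x \<in> \<Omega>" if "x \<in> \<Omega>" for x using that e by (simp add: R(2))
      then have "hyp_reflect e 0 ` \<Omega> \<subseteq> \<Omega>" "\<Omega> \<subseteq> hyp_reflect e 0 ` \<Omega>"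
        using hyp_reflect_involution[OF e, of 0] by (blast, metis image_eqI subsetI)
      then show ?thesis by (simp add: symmetric_in_direction_def)
    qed
    have rad: "u x = u y" if xy: "norm x = norm y" for x y
    proof (cases "x = y")
      case False
      \<comment> \<open>the reflection along \<open>e\<close> exchanges the two points of equal norm\<close>
      define e where "e = (x - y) /\<^sub>R norm (x - y)"
      have d: "norm (x - y) \<noteq> 0" using False by simp
      then have e: "norm e = 1" by (simp add: e_def)
      have "(norm (x - y))\<^sup>2 = 2 * (x \<bullet> (x - y))"
        using xy by (simp add: power2_norm_eq_inner inner_diff_left inner_diff_right inner_commute norm_eq)
      then have "2 * (x \<bullet> e) = norm (x - y)"
        using d unfolding e_def inner_scaleR_right by (simp add: power2_eq_square divide_simps)
      then have "hyp_reflect e 0 x = x - norm (x - y) *\<^sub>R e" by (simp add: hyp_reflect_def algebra_simps)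
      also have "\<dots> = y" using d by (simp add: e_def)
      finally show ?thesis using main(1)[OF e conv symm[OF e] mono[OF e], of x] by simp
    qed simp
    have "u y < u x" if xy: "x \<in> \<Omega>" "y \<in> \<Omega>" "0 < norm x" "norm x < norm y" for x y
    proof -
      let ?x = "(- norm x) *\<^sub>R ?e" and ?y = "(- norm y) *\<^sub>R ?e"
      have "?y \<in> \<Omega>" using xy by (simp add: R(2))
      then have "u ?y < u ?x"
        using xy(3,4) by (intro incr) (auto simp: axis_def)
      moreover have "u ?x = u x" "u ?y = u y" by (rule rad, simp)+
      ultimately show ?thesis by simp
    qed
    then show ?thesis using rad by blast
  qed
  show ?thesis using sym incr radial by blast
qed

end
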